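(* Let $G$ be a finite connected outerplanar graph. Determining sets fail to have the exchange property in $G$ if and only if $G$ has a central block $B$ such that (i) the pointwise stabilizer of $V(B)$ in $\mathrm{Aut}(G)$ is trivial, (ii) $B$ contains a vertex moved by every reflection of $B$ in $\mathrm{Aut}_G(B)$, and (iii) $B$ contains two vertices fixed by different reflections of $B$ in $\mathrm{Aut}_G(B)$.
   Context: A set $S\subseteq V(G)$ is a determining set if the only automorphism of $G$ fixing every vertex of $S$ is the identity; it is minimal if no proper subset is a determining set. Determining sets have the exchange property in $G$ if whenever $S,R$ are minimal determining sets and $r\in R$, there is $s\in S$ such that $(S\setminus\{s\})\cup\{r\}$ is a minimal determining set. The block-cutvertex tree $T$ of $G$ has a $B$-vertex for each block and a $C$-vertex for each cutvertex, with a $B$-vertex adjacent to a $C$-vertex when the cutvertex lies in the block; its center is a single vertex. If that center is a $B$-vertex, the corresponding block is the central block. For a block $B$, let $\mathrm{Invar}(B)$ be the group of automorphisms of $G$ mapping $V(B)$ onto itself and $\mathrm{Stab}(B)$ the normal subgroup of those fixing every vertex of $B$; $\mathrm{Aut}_G(B)=\mathrm{Invar}(B)/\mathrm{Stab}(B)$, acting on $V(B)$. A block with at least three vertices is $2$-connected outerplanar and has a unique Hamilton cycle, so each element of $\mathrm{Aut}_G(B)$ acts on it as a rotation or reflection of that cycle; a reflection of $B$ is a nonidentity element acting as a reflection of the cycle. If $B=K_2$, its nontrivial symmetry is regarded as a reflection. *)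

theory Defs
  imports
    "HOL-Analysis.Analysis"
    "HOL-Algebra.Bij"
    "HOL-Algebra.Coset"
    "Graph_Theory.Graph_Theory"
begin

text \<open>
  A finite simple graph is a symmetric, loop-free digraph without parallel arcs, i.e. an
  instance of the locale \<open>graph\<close>. Each undirected edge \<open>{u, v}\<close> is a pair of opposite arcs.
\<close>

text \<open>
  A drawing places the vertices by \<open>p\<close> and draws the edge \<open>{u, v}\<close> as the simple arc
  \<open>\<gamma> {u, v}\<close>; indexing by the unordered pair makes opposite arcs share one curve.
\<close>

definition plane_drawing ::
    "('a, 'b) pre_digraph \<Rightarrow> ('a \<Rightarrow> complex) \<Rightarrow> ('a set \<Rightarrow> real \<Rightarrow> complex) \<Rightarrow> bool" where
  "plane_drawing G p \<gamma> \<longleftrightarrow>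
     inj_on p (verts G) \<and>
     (\<forall>u v. u \<rightarrow>\<^bsub>G\<^esub> v \<longrightarrow>
        arc (\<gamma> {u, v}) \<and>
        {pathstart (\<gamma> {u, v}), pathfinish (\<gamma> {u, v})} = {p u, p v} \<and>
        path_image (\<gamma> {u, v}) \<inter> p ` verts G = {p u, p v}) \<and>
     (\<forall>u v x y. u \<rightarrow>\<^bsub>G\<^esub> v \<longrightarrow> x \<rightarrow>\<^bsub>G\<^esub> y \<longrightarrow> {u, v} \<noteq> {x, y} \<longrightarrow>
        path_image (\<gamma> {u, v}) \<inter> path_image (\<gamma> {x, y}) = p ` ({u, v} \<inter> {x, y}))"

definition drawing_points ::
    "('a, 'b) pre_digraph \<Rightarrow> ('a \<Rightarrow> complex) \<Rightarrow> ('a set \<Rightarrow> real \<Rightarrow> complex) \<Rightarrow> complex set" where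
  "drawing_points G p \<gamma> = p ` verts G \<union> (\<Union>(u, v) \<in> arcs_ends G. path_image (\<gamma> {u, v}))"

definition outerplanar :: "('a, 'b) pre_digraph \<Rightarrow> bool" where
  "outerplanar G \<longleftrightarrow>
     (\<exists>p \<gamma>. plane_drawing G p \<gamma> \<and> p ` verts G \<subseteq> frontier (outside (drawing_points G p \<gamma>)))"

definition automorphisms :: "('a, 'b) pre_digraph \<Rightarrow> ('a \<Rightarrow> 'a) set" where
  "automorphisms G =
     {\<phi> \<in> Bij (verts G). \<forall>u \<in> verts G. \<forall>v \<in> verts G. \<phi> u \<rightarrow>\<^bsub>G\<^esub> \<phi> v \<longleftrightarrow> u \<rightarrow>\<^bsub>G\<^esub> v}"

definition aut_group :: "('a, 'b) pre_digraph \<Rightarrow> ('a \<Rightarrow> 'a) monoid" where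
  "aut_group G = (BijGroup (verts G)) \<lparr>carrier := automorphisms G\<rparr>"

definition determining_set :: "('a, 'b) pre_digraph \<Rightarrow> 'a set \<Rightarrow> bool" where
  "determining_set G S \<longleftrightarrow> S \<subseteq> verts G \<and>
     (\<forall>\<phi> \<in> carrier (aut_group G). (\<forall>v \<in> S. \<phi> v = v) \<longrightarrow> \<phi> = \<one>\<^bsub>aut_group G\<^esub>)"

definition minimal_determining_set :: "('a, 'b) pre_digraph \<Rightarrow> 'a set \<Rightarrow> bool" where
  "minimal_determining_set G S \<longleftrightarrow>
     determining_set G S \<and> (\<forall>T. T \<subset> S \<longrightarrow> \<not> determining_set G T)"

definition exchange_property :: "('a, 'b) pre_digraph \<Rightarrow> bool" where
  "exchange_property G \<longleftrightarrow>
     (\<forall>S R. minimal_determining_set G S \<longrightarrow> minimal_determining_set G R \<longrightarrow>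
        (\<forall>r \<in> R. \<exists>s \<in> S. minimal_determining_set G ((S - {s}) \<union> {r})))"

definition cutvertex :: "('a, 'b) pre_digraph \<Rightarrow> 'a \<Rightarrow> bool" where
  "cutvertex G v \<longleftrightarrow> v \<in> verts G \<and>
     (\<exists>x \<in> verts G - {v}. \<exists>y \<in> verts G - {v}.
        x \<rightarrow>\<^sup>*\<^bsub>G\<^esub> y \<and> \<not> x \<rightarrow>\<^sup>*\<^bsub>pre_digraph.del_vert G v\<^esub> y)"

definition nonseparable :: "('a, 'b) pre_digraph \<Rightarrow> bool" where
  "nonseparable H \<longleftrightarrow> graph H \<and> Digraph_Component.connected H \<and> (\<forall>v. \<not> cutvertex H v)"

definition blocks :: "('a, 'b) pre_digraph \<Rightarrow> ('a, 'b) pre_digraph set" where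
  "blocks G = {B. pre_digraph.max_subgraph G nonseparable B}"

definition bc_tree ::
    "('a, 'b) pre_digraph \<Rightarrow> (('a, 'b) pre_digraph + 'a) pair_pre_digraph" where
  "bc_tree G =
     (let I = {(Inl B, Inr c) | B c. B \<in> blocks G \<and> cutvertex G c \<and> c \<in> verts B}
      in \<lparr>pverts = Inl ` blocks G \<union> Inr ` {c. cutvertex G c}, parcs = I \<union> I\<inverse>\<rparr>)"

definition distance :: "('a, 'b) pre_digraph \<Rightarrow> 'a \<Rightarrow> 'a \<Rightarrow> ereal" where
  "distance G = wf_digraph.\<mu> G (\<lambda>_. 1)"

definition eccentricity :: "('a, 'b) pre_digraph \<Rightarrow> 'a \<Rightarrow> ereal" where
  "eccentricity G u = (SUP v \<in> verts G. distance G u v)"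

definition graph_center :: "('a, 'b) pre_digraph \<Rightarrow> 'a set" where
  "graph_center G = {u \<in> verts G. \<forall>v \<in> verts G. eccentricity G u \<le> eccentricity G v}"

definition central_block :: "('a, 'b) pre_digraph \<Rightarrow> ('a, 'b) pre_digraph \<Rightarrow> bool" where
  "central_block G B \<longleftrightarrow> graph_center (with_proj (bc_tree G)) = {Inl B}"

definition invar_group ::
    "('a, 'b) pre_digraph \<Rightarrow> ('a, 'b) pre_digraph \<Rightarrow> ('a \<Rightarrow> 'a) monoid" where
  "invar_group G B =
     (aut_group G) \<lparr>carrier := {\<phi> \<in> carrier (aut_group G). \<phi> ` verts B = verts B}\<rparr>"

definition stab :: "('a, 'b) pre_digraph \<Rightarrow> ('a, 'b) pre_digraph \<Rightarrow> ('a \<Rightarrow> 'a) set" where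
  "stab G B = {\<phi> \<in> carrier (aut_group G). \<forall>v \<in> verts B. \<phi> v = v}"

definition block_aut_group ::
    "('a, 'b) pre_digraph \<Rightarrow> ('a, 'b) pre_digraph \<Rightarrow> ('a \<Rightarrow> 'a) set monoid" where
  "block_aut_group G B = invar_group G B Mod stab G B"

text \<open>All members of a coset of the stabilizer agree on the vertices of the block.\<close>

definition coset_action :: "('a \<Rightarrow> 'a) set \<Rightarrow> 'a \<Rightarrow> 'a" where
  "coset_action X v = the_elem ((\<lambda>\<phi>. \<phi> v) ` X)"

definition hamilton_cycle :: "('a, 'b) pre_digraph \<Rightarrow> 'a list \<Rightarrow> bool" where
  "hamilton_cycle B vs \<longleftrightarrow>
     length vs \<ge> 3 \<and> distinct vs \<and> set vs = verts B \<and>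
     (\<forall>i < length vs. vs ! i \<rightarrow>\<^bsub>B\<^esub> vs ! ((i + 1) mod length vs))"

text \<open>The index map is \<open>i \<mapsto> k - i\<close> modulo the length, written without truncated subtraction.\<close>

definition cycle_reflection :: "'a list \<Rightarrow> ('a \<Rightarrow> 'a) \<Rightarrow> bool" where
  "cycle_reflection vs \<sigma> \<longleftrightarrow>
     (\<exists>k. \<forall>i < length vs. \<sigma> (vs ! i) = vs ! ((k + (length vs - i)) mod length vs))"

definition reflections ::
    "('a, 'b) pre_digraph \<Rightarrow> ('a, 'b) pre_digraph \<Rightarrow> ('a \<Rightarrow> 'a) set set" where
  "reflections G B =
     {X \<in> carrier (block_aut_group G B). X \<noteq> \<one>\<^bsub>block_aut_group G B\<^esub> \<and>
        (card (verts B) = 2 \<or>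
         (\<exists>vs. hamilton_cycle B vs \<and> cycle_reflection vs (coset_action X)))}"

lemma subgroup_automorphisms: "subgroup (automorphisms G) (BijGroup (verts G))"
proof -
  interpret S: group "BijGroup (verts G)" by (rule group_BijGroup)
  show ?thesis
  proof (rule S.subgroupI)
    show "automorphisms G \<subseteq> carrier (BijGroup (verts G))"
      by (auto simp: automorphisms_def BijGroup_def)
    have "(\<lambda>x\<in>verts G. x) \<in> automorphisms G"
      by (auto simp: automorphisms_def id_Bij)
    then show "automorphisms G \<noteq> {}" by blast
  next
    fix \<phi> assume a: "\<phi> \<in> automorphisms G"
    then have b: "\<phi> \<in> Bij (verts G)" by (simp add: automorphisms_def)
    then have bb: "bij_betw \<phi> (verts G) (verts G)" by (simp add: Bij_def)
    let ?i = "\<lambda>x\<in>verts G. (inv_into (verts G) \<phi>) x"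
    have m: "?i x \<in> verts G \<and> \<phi> (?i x) = x" if "x \<in> verts G" for x
      using bb that by (simp add: bij_betw_def inv_into_into f_inv_into_f)
    have "?i \<in> automorphisms G"
      unfolding automorphisms_def
    proof (intro CollectI conjI ballI)
      show "?i \<in> Bij (verts G)" by (rule restrict_inv_into_Bij[OF b])
      fix u v assume uv: "u \<in> verts G" "v \<in> verts G"
      have "\<phi> (?i u) \<rightarrow>\<^bsub>G\<^esub> \<phi> (?i v) \<longleftrightarrow> ?i u \<rightarrow>\<^bsub>G\<^esub> ?i v"
        using a m[OF uv(1)] m[OF uv(2)] unfolding automorphisms_def by blast
      then show "?i u \<rightarrow>\<^bsub>G\<^esub> ?i v \<longleftrightarrow> u \<rightarrow>\<^bsub>G\<^esub> v"
        using m[OF uv(1)] m[OF uv(2)] by simp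
    qed
    then show "inv\<^bsub>BijGroup (verts G)\<^esub> \<phi> \<in> automorphisms G"
      using b by (simp add: inv_BijGroup)
  next
    fix \<phi> \<psi> assume "\<phi> \<in> automorphisms G" "\<psi> \<in> automorphisms G"
    moreover from this have "\<psi> v \<in> verts G" if "v \<in> verts G" for v
      using that by (auto simp: automorphisms_def dest: Bij_imp_funcset)
    ultimately show "\<phi> \<otimes>\<^bsub>BijGroup (verts G)\<^esub> \<psi> \<in> automorphisms G"
      by (auto simp: automorphisms_def BijGroup_def compose_Bij compose_eq)
  qed
qed

lemma group_aut_group: "group (aut_group G)"
  unfolding aut_group_def
  by (rule subgroup.subgroup_is_group[OF subgroup_automorphisms group_BijGroup])

lemma subgroup_invar:
  "subgroup {\<phi> \<in> carrier (aut_group G). \<phi> ` verts B = verts B} (aut_group G)"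
  if "verts B \<subseteq> verts G"
proof -
  interpret A: group "aut_group G" by (rule group_aut_group)
  have mult: "(\<phi> \<otimes>\<^bsub>aut_group G\<^esub> \<psi>) v = \<phi> (\<psi> v)"
    if "\<phi> \<in> carrier (aut_group G)" "\<psi> \<in> carrier (aut_group G)" "v \<in> verts B" for \<phi> \<psi> v
    using that \<open>verts B \<subseteq> verts G\<close>
    by (auto simp: aut_group_def automorphisms_def BijGroup_def compose_eq)
  have one: "\<one>\<^bsub>aut_group G\<^esub> v = v" if "v \<in> verts B" for v
    using that \<open>verts B \<subseteq> verts G\<close> by (auto simp: aut_group_def BijGroup_def)
  show ?thesis
  proof (rule A.subgroupI)
    show "{\<phi> \<in> carrier (aut_group G). \<phi> ` verts B = verts B} \<noteq> {}"
      using one A.one_closed by force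
  next
    fix \<phi> assume "\<phi> \<in> {\<phi> \<in> carrier (aut_group G). \<phi> ` verts B = verts B}"
    then have c: "\<phi> \<in> carrier (aut_group G)" and i: "\<phi> ` verts B = verts B" by auto
    let ?i = "inv\<^bsub>aut_group G\<^esub> \<phi>"
    have "?i (\<phi> v) = v" if "v \<in> verts B" for v
      using mult[OF A.inv_closed[OF c] c that] one[OF that] c by simp
    then have "?i ` \<phi> ` verts B = verts B" by (force simp: image_image)
    with i c show "?i \<in> {\<phi> \<in> carrier (aut_group G). \<phi> ` verts B = verts B}" by simp
  next
    fix \<phi> \<psi>
    assume "\<phi> \<in> {\<phi> \<in> carrier (aut_group G). \<phi> ` verts B = verts B}"
      and "\<psi> \<in> {\<phi> \<in> carrier (aut_group G). \<phi> ` verts B = verts B}"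
    then have c: "\<phi> \<in> carrier (aut_group G)" "\<psi> \<in> carrier (aut_group G)"
      and i: "\<phi> ` verts B = verts B" "\<psi> ` verts B = verts B" by auto
    have "(\<phi> \<otimes>\<^bsub>aut_group G\<^esub> \<psi>) ` verts B = \<phi> ` \<psi> ` verts B"
      using mult[OF c] by (simp add: image_image)
    with c i show "\<phi> \<otimes>\<^bsub>aut_group G\<^esub> \<psi> \<in> {\<phi> \<in> carrier (aut_group G). \<phi> ` verts B = verts B}"
      by simp
  qed auto
qed

lemma stab_normal: "stab G B \<lhd> invar_group G B" if sub: "verts B \<subseteq> verts G"
proof -
  interpret I: group "invar_group G B"
    unfolding invar_group_def
    by (rule subgroup.subgroup_is_group[OF subgroup_invar[OF sub] group_aut_group])
  have mult: "(\<phi> \<otimes>\<^bsub>invar_group G B\<^esub> \<psi>) v = \<phi> (\<psi> v)"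
    if "\<phi> \<in> carrier (invar_group G B)" "\<psi> \<in> carrier (invar_group G B)" "v \<in> verts B" for \<phi> \<psi> v
    using that sub
    by (auto simp: invar_group_def aut_group_def automorphisms_def BijGroup_def compose_eq)
  have one: "\<one>\<^bsub>invar_group G B\<^esub> v = v" if "v \<in> verts B" for v
    using that sub by (auto simp: invar_group_def aut_group_def BijGroup_def)
  have inv: "(inv\<^bsub>invar_group G B\<^esub> \<phi>) (\<phi> v) = v" "\<phi> ((inv\<^bsub>invar_group G B\<^esub> \<phi>) v) = v"
    if "\<phi> \<in> carrier (invar_group G B)" "v \<in> verts B" for \<phi> v
    using mult[OF I.inv_closed[OF that(1)] that(1) that(2)]
      mult[OF that(1) I.inv_closed[OF that(1)] that(2)] one[OF that(2)] that(1) by simp_all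
  have st: "stab G B = {\<phi> \<in> carrier (invar_group G B). \<forall>v \<in> verts B. \<phi> v = v}"
    by (force simp: stab_def invar_group_def)
  have into: "\<phi> v \<in> verts B" if "\<phi> \<in> carrier (invar_group G B)" "v \<in> verts B" for \<phi> v
    using that by (auto simp: invar_group_def)
  have "subgroup (stab G B) (invar_group G B)"
  proof (rule I.subgroupI)
    show "stab G B \<noteq> {}" using one I.one_closed by (auto simp: st)
  next
    fix \<phi> assume "\<phi> \<in> stab G B"
    then show "inv\<^bsub>invar_group G B\<^esub> \<phi> \<in> stab G B" using inv(1) by (force simp: st)
  next
    fix \<phi> \<psi> assume "\<phi> \<in> stab G B" "\<psi> \<in> stab G B"
    then show "\<phi> \<otimes>\<^bsub>invar_group G B\<^esub> \<psi> \<in> stab G B" by (auto simp: st mult)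
  qed (auto simp: st)
  moreover have "\<phi> \<otimes>\<^bsub>invar_group G B\<^esub> \<psi> \<otimes>\<^bsub>invar_group G B\<^esub> inv\<^bsub>invar_group G B\<^esub> \<phi> \<in> stab G B"
    if "\<phi> \<in> carrier (invar_group G B)" "\<psi> \<in> stab G B" for \<phi> \<psi>
    using that by (auto simp: st mult inv into)
  ultimately show ?thesis by (simp add: I.normal_inv_iff)
qed

lemma coset_action_eq:
  assumes "verts B \<subseteq> verts G" and "X \<in> carrier (block_aut_group G B)"
    and "\<phi> \<in> X" and "v \<in> verts B"
  shows "coset_action X v = \<phi> v"
proof -
  from assms(2) obtain \<theta> where \<theta>: "\<theta> \<in> carrier (invar_group G B)"
    and X: "X = stab G B #>\<^bsub>invar_group G B\<^esub> \<theta>"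
    by (auto simp: block_aut_group_def FactGroup_def RCOSETS_def)
  have "\<psi> v = \<theta> v" if "\<psi> \<in> X" for \<psi>
  proof -
    from that X obtain \<tau> where \<tau>: "\<tau> \<in> stab G B" "\<psi> = \<tau> \<otimes>\<^bsub>invar_group G B\<^esub> \<theta>"
      by (auto simp: r_coset_def)
    have "\<psi> v = \<tau> (\<theta> v)"
      using \<tau> \<theta> assms(1,4)
      by (auto simp: stab_def invar_group_def aut_group_def automorphisms_def BijGroup_def compose_eq)
    moreover have "\<theta> v \<in> verts B" using \<theta> assms(4) by (auto simp: invar_group_def)
    ultimately show ?thesis using \<tau>(1) by (simp add: stab_def)
  qed
  then have "\<psi> v = \<phi> v" if "\<psi> \<in> X" for \<psi> using that assms(3) by metis
  with assms(3) have "(\<lambda>\<psi>. \<psi> v) ` X = {\<phi> v}" by blast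
  then show ?thesis by (simp add: coset_action_def)
qed

end

theory Submission
  imports Defs "HOL-Complex_Analysis.Complex_Analysis" "HOL-Combinatorics.Permutations"
begin

text \<open>
  A set is determining iff it meets the set of moved vertices of every nonidentity automorphism.
  If the minimal sets of moved vertices satisfy the circuit elimination axiom, the minimal
  determining sets are the bases of a matroid and can be exchanged.

  Elimination at a vertex \<open>e\<close> holds for any two automorphisms with a common fixed vertex. Walking from
  that vertex along the blocks towards \<open>e\<close>, the two automorphisms either move a block away, and then
  swapping isomorphic branches eliminates \<open>e\<close>, or they act on a block as the same reflection, and then
  their quotient does. So a failure of elimination forces a block \<open>B\<close> at the center of the
  block-cutvertex tree on which the automorphism group acts faithfully, and the two automorphisms are
  reflections of \<open>B\<close> with different fixed vertices. A reflection fixing the vertex of \<open>B\<close> nearest to \<open>e\<close>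
  would eliminate \<open>e\<close>. Conversely a vertex moved by all reflections and a pair of vertices fixed by
  different reflections are minimal determining sets of different sizes.

  Outerplanarity enters through two consequences of the Jordan curve theorem: there are no three
  internally disjoint paths with common ends and with inner vertices, and chords of a cycle do not
  cross. They give each block with at least three vertices a Hamilton cycle whose edges are preserved by
  all automorphisms of the block.
\<close>

section \<open>Exchange from circuit elimination\<close>

text \<open>A set meets every circuit iff its complement is independent, so the minimal determining
  sets are the complements of bases, that is, the bases of the dual matroid. Elimination has to be
  shown only for two automorphisms whose moved sets are inclusion-minimal and distinct, and this
  minimality carries most of the case analysis. Whenever one of them acts inside a part of the graph
  that the other moves entirely, one moved set contains the other and they coincide. Hence on the
  way to \<open>e\<close> both automorphisms must treat each block alike: both keep it or both map
  it elsewhere, and both fix or both move its vertex nearest to \<open>e\<close>. Minimality also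
  explains why a failing pair leads to the center. Without a common fixed vertex no cutvertex is
  central, since a central one would be fixed by every automorphism. On the central block each of
  the two still fixes a vertex, because a minimal automorphism moving all vertices would have the
  other moved set inside its own.\<close>

locale circuit_clutter =
  fixes C :: "'a set set"
  assumes finite_circuit: "M \<in> C \<Longrightarrow> finite M"
    and antichain: "M \<in> C \<Longrightarrow> N \<in> C \<Longrightarrow> M \<subseteq> N \<Longrightarrow> M = N"
    and elimination:
      "M \<in> C \<Longrightarrow> N \<in> C \<Longrightarrow> M \<noteq> N \<Longrightarrow> e \<in> M \<Longrightarrow> e \<in> N \<Longrightarrow> \<exists>L\<in>C. L \<subseteq> M \<union> N - {e}"
begin

text \<open>If the weakly eliminated circuit \<open>P\<close> misses \<open>f\<close>, then
  \<open>N \<union> P\<close> misses \<open>f\<close> and is smaller than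
  \<open>M \<union> N\<close>. Eliminating there some \<open>g\<close> in \<open>P - M\<close> while
  keeping \<open>e\<close> yields \<open>Q\<close> without \<open>g\<close>; so
  \<open>M \<union> Q\<close> is smaller too, and \<open>e\<close> can be eliminated against
  \<open>Q\<close> while keeping \<open>f\<close>.\<close>

lemma strong_elimination:
  assumes "M \<in> C" "N \<in> C" "e \<in> M" "e \<in> N" "f \<in> M" "f \<notin> N"
  shows "\<exists>L\<in>C. f \<in> L \<and> L \<subseteq> M \<union> N - {e}"
  using assms
proof (induction "card (M \<union> N)" arbitrary: M N e f rule: less_induct)
  case less
  have fin: "finite (M \<union> N)" using less.prems finite_circuit by auto
  have "M \<noteq> N" using less.prems by auto
  then obtain P where P: "P \<in> C" "P \<subseteq> M \<union> N - {e}" using elimination less.prems by meson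
  show ?case
  proof (cases "f \<in> P")
    case True
    then show ?thesis using P by blast
  next
    case False
    obtain g where g: "g \<in> P" "g \<notin> M"
      using antichain[OF P(1) less.prems(1)] P less.prems(3) by blast
    then have gN: "g \<in> N" using P by blast
    have "card (N \<union> P) < card (M \<union> N)"
      by (rule psubset_card_mono[OF fin]) (use P less.prems False in auto)
    from less.hyps[OF this less.prems(2) P(1) gN g(1) less.prems(4)] P
    obtain Q where Q: "Q \<in> C" "e \<in> Q" "Q \<subseteq> N \<union> P - {g}" by blast
    have fQ: "f \<notin> Q" using Q less.prems False by auto
    have "card (M \<union> Q) < card (M \<union> N)"
      by (rule psubset_card_mono[OF fin]) (use P Q g gN in auto)
    from less.hyps[OF this less.prems(1) Q(1) less.prems(3) Q(2) less.prems(5) fQ]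
    obtain L where "L \<in> C" "f \<in> L" "L \<subseteq> M \<union> Q - {e}" by blast
    moreover have "M \<union> Q \<subseteq> M \<union> N" using P Q by auto
    ultimately show ?thesis by blast
  qed
qed

definition transversal :: "'a set \<Rightarrow> bool" where
  "transversal S \<longleftrightarrow> (\<forall>M\<in>C. M \<inter> S \<noteq> {})"

definition minimal_transversal :: "'a set \<Rightarrow> bool" where
  "minimal_transversal S \<longleftrightarrow> transversal S \<and> (\<forall>T. T \<subset> S \<longrightarrow> \<not> transversal T)"

lemma minimal_transversal_iff:
  "minimal_transversal S \<longleftrightarrow> transversal S \<and> (\<forall>s\<in>S. \<exists>M\<in>C. M \<inter> S = {s})"
proof
  assume m: "minimal_transversal S"
  have "\<exists>M\<in>C. M \<inter> S = {s}" if "s \<in> S" for s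
  proof -
    have "\<not> transversal (S - {s})" using m that unfolding minimal_transversal_def by blast
    then obtain M where "M \<in> C" "M \<inter> (S - {s}) = {}" unfolding transversal_def by blast
    moreover then have "M \<inter> S \<noteq> {}"
      using m unfolding minimal_transversal_def transversal_def by blast
    ultimately show ?thesis by blast
  qed
  with m show "transversal S \<and> (\<forall>s\<in>S. \<exists>M\<in>C. M \<inter> S = {s})"
    unfolding minimal_transversal_def by blast
next
  assume r: "transversal S \<and> (\<forall>s\<in>S. \<exists>M\<in>C. M \<inter> S = {s})"
  have "\<not> transversal T" if T: "T \<subset> S" for T
  proof -
    obtain s where s: "s \<in> S" "s \<notin> T" using T by blast
    then obtain M where "M \<in> C" "M \<inter> S = {s}" using r by blast
    then have "M \<inter> T = {}" using s T by auto
    then show ?thesis using \<open>M \<in> C\<close> unfolding transversal_def by blast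
  qed
  with r show "minimal_transversal S" unfolding minimal_transversal_def by blast
qed

text \<open>The complement of \<open>S\<close> is a basis, and the circuits meeting \<open>S\<close>
  in one point are its fundamental circuits. One of them passes through \<open>r\<close>, because
  each strong elimination that keeps \<open>r\<close> removes a point of \<open>M \<inter> S\<close>
  and adds none.\<close>

lemma fundamental_circuit:
  assumes S: "minimal_transversal S" and M: "M \<in> C" "r \<in> M" and r: "r \<notin> S"
  shows "\<exists>N\<in>C. r \<in> N \<and> (\<exists>s\<in>S. N \<inter> S = {s})"
  using M
proof (induction "card (M \<inter> S)" arbitrary: M rule: less_induct)
  case less
  obtain s where s: "s \<in> M" "s \<in> S"
    using S less.prems unfolding minimal_transversal_def transversal_def by blast
  then obtain N where N: "N \<in> C" "N \<inter> S = {s}" using S minimal_transversal_iff by blast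
  show ?case
  proof (cases "r \<in> N")
    case True
    then show ?thesis using N s by blast
  next
    case False
    have "s \<in> N" using N by blast
    from strong_elimination[OF less.prems(1) N(1) s(1) this less.prems(2) False]
    obtain L where L: "L \<in> C" "r \<in> L" "L \<subseteq> M \<union> N - {s}" by blast
    have "card (L \<inter> S) < card (M \<inter> S)"
      by (rule psubset_card_mono) (use finite_circuit less.prems L N s in auto)
    then show ?thesis using less.hyps L by blast
  qed
qed

theorem minimal_transversal_exchange:
  assumes S: "minimal_transversal S" and R: "minimal_transversal R" and r: "r \<in> R"
  shows "\<exists>s\<in>S. minimal_transversal ((S - {s}) \<union> {r})"
proof (cases "r \<in> S")
  case True
  then have "(S - {r}) \<union> {r} = S" by blast
  then show ?thesis using S True by metis
next
  case False
  obtain M where "M \<in> C" "r \<in> M" using R r minimal_transversal_iff by blast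
  then obtain N s where N: "N \<in> C" "r \<in> N" "s \<in> S" "N \<inter> S = {s}"
    using fundamental_circuit[OF S _ _ False] by blast
  \<comment> \<open>A second circuit meeting \<open>S\<close> only in \<open>s\<close> could be
    eliminated against \<open>N\<close> at \<open>s\<close>, which would leave a circuit missing
    \<open>S\<close>.\<close>
  have unique: "L = N" if L: "L \<in> C" "L \<inter> S \<subseteq> {s}" for L
  proof (rule ccontr)
    assume "L \<noteq> N"
    moreover have "s \<in> L" using S L unfolding minimal_transversal_def transversal_def by blast
    ultimately obtain P where "P \<in> C" "P \<subseteq> L \<union> N - {s}" using elimination L N by blast
    moreover from this(2) have "P \<inter> S = {}" using L N by auto
    ultimately show False using S unfolding minimal_transversal_def transversal_def by metis
  qed
  \<comment> \<open>A circuit avoiding the new set would meet \<open>S\<close> at most in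
    \<open>s\<close>, hence be \<open>N\<close>, which contains \<open>r\<close>.\<close>
  have "transversal ((S - {s}) \<union> {r})"
    unfolding transversal_def using unique N(2) by blast
  moreover have "\<exists>L\<in>C. L \<inter> ((S - {s}) \<union> {r}) = {t}" if t: "t \<in> (S - {s}) \<union> {r}" for t
  proof (cases "t = r")
    case True
    then show ?thesis using N by blast
  next
    case False
    then have t: "t \<in> S" "t \<noteq> s" using t by auto
    obtain L where L: "L \<in> C" "L \<inter> S = {t}" using S t minimal_transversal_iff by blast
    show ?thesis
    proof (cases "r \<in> L")
      case True
      \<comment> \<open>\<open>L\<close> contains \<open>r\<close> and so is no longer a private
        circuit of \<open>t\<close>; eliminating \<open>r\<close> against \<open>N\<close> repairs
        this. The result keeps \<open>t\<close>, for otherwise it would be \<open>N\<close> itself,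
        which contains \<open>r\<close>.\<close>
      have "L \<noteq> N" using L N t by blast
      then obtain P where P: "P \<in> C" "P \<subseteq> L \<union> N - {r}" using elimination L N True by blast
      have "t \<in> P"
      proof (rule ccontr)
        assume "t \<notin> P"
        then have "P \<inter> S \<subseteq> {s}" using P L N by auto
        then have "P = N" using unique P by simp
        then show False using P N by blast
      qed
      then have "P \<inter> ((S - {s}) \<union> {r}) = {t}" using P L N t by auto
      then show ?thesis using P by blast
    next
      case False
      then have "L \<inter> ((S - {s}) \<union> {r}) = {t}" using L t by auto
      then show ?thesis using L by blast
    qed
  qed
  ultimately have "minimal_transversal ((S - {s}) \<union> {r})" unfolding minimal_transversal_iff by blast
  then show ?thesis using N(3) by blast
qed

end

section \<open>Theta curves\<close>

definition theta :: "complex \<Rightarrow> complex \<Rightarrow> (real \<Rightarrow> complex) \<Rightarrow> (real \<Rightarrow> complex) \<Rightarrow> (real \<Rightarrow> complex) \<Rightarrow> bool" where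
  "theta a b c1 c2 c3 \<longleftrightarrow> a \<noteq> b \<and> (\<forall>c\<in>{c1, c2, c3}. arc c \<and> pathstart c = a \<and> pathfinish c = b) \<and>
     path_image c1 \<inter> path_image c2 = {a, b} \<and> path_image c1 \<inter> path_image c3 = {a, b} \<and>
     path_image c2 \<inter> path_image c3 = {a, b}"

lemma theta_commute: "theta a b c1 c2 c3 \<Longrightarrow> theta a b c2 c1 c3"
  and theta_rotate: "theta a b c1 c2 c3 \<Longrightarrow> theta a b c2 c3 c1"
  unfolding theta_def by auto

lemma theta_loop:
  assumes "theta a b c1 c2 c3"
  shows "simple_path (c1 +++ reversepath c2)"
    and "pathfinish (c1 +++ reversepath c2) = pathstart (c1 +++ reversepath c2)"
    and "path_image (c1 +++ reversepath c2) = path_image c1 \<union> path_image c2"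
  using assms
  by (auto simp: theta_def path_image_join intro!: simple_path_join_loop arc_reversepath)

lemma theta_Jordan:
  assumes "theta a b c1 c2 c3"
  defines "J \<equiv> path_image c1 \<union> path_image c2"
  shows "inside J \<noteq> {}" "open (inside J)" "Topological_Spaces.connected (inside J)"
    "frontier (inside J) = J"
  using Jordan_inside_outside[OF theta_loop(1,2)[OF assms(1)]] unfolding theta_loop(3)[OF assms(1)] J_def
  by auto

text \<open>The winding number of a simple closed curve is \<open>1\<close> or \<open>-1\<close>
  inside and \<open>0\<close> outside. The winding numbers of the single arcs need not be integers;
  only their differences are used.\<close>

lemma theta_loop_winding:
  assumes th: "theta a b c1 c2 c3" and z: "z \<notin> path_image c1" "z \<notin> path_image c2"
  shows "winding_number (c1 +++ reversepath c2) z = winding_number c1 z - winding_number c2 z"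
    and "winding_number c1 z \<noteq> winding_number c2 z \<longleftrightarrow> z \<in> inside (path_image c1 \<union> path_image c2)"
proof -
  show eq: "winding_number (c1 +++ reversepath c2) z = winding_number c1 z - winding_number c2 z"
    using th z by (subst winding_number_join)
      (auto simp: theta_def arc_imp_path winding_number_reversepath)
  let ?l = "c1 +++ reversepath c2"
  have sp: "simple_path ?l" "pathfinish ?l = pathstart ?l" using theta_loop[OF th] by auto
  have "z \<in> inside (path_image ?l) \<longleftrightarrow> winding_number ?l z \<noteq> 0"
  proof
    assume "z \<in> inside (path_image ?l)"
    then show "winding_number ?l z \<noteq> 0"
      using simple_closed_path_norm_winding_number_inside[OF sp(1)] by force
  next
    assume "winding_number ?l z \<noteq> 0"
    then have "z \<notin> outside (path_image ?l)"
      using winding_number_zero_in_outside sp simple_path_imp_path by blast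
    moreover have "z \<notin> path_image ?l" using theta_loop(3)[OF th] z by auto
    ultimately show "z \<in> inside (path_image ?l)" using inside_Un_outside by blast
  qed
  then show "winding_number c1 z \<noteq> winding_number c2 z \<longleftrightarrow> z \<in> inside (path_image c1 \<union> path_image c2)"
    unfolding eq theta_loop(3)[OF th] by simp
qed

text \<open>The inside of the first loop is connected and misses the second loop, so it lies inside
  the second loop as soon as the two insides share a point. The arc \<open>c2\<close> lies in its
  closure.\<close>

lemma theta_arc_inside_of_inside_meets:
  assumes th: "theta a b c1 c2 c3"
    and z: "z \<in> inside (path_image c1 \<union> path_image c2)" "z \<in> inside (path_image c1 \<union> path_image c3)"
    and c3: "path_image c3 \<inter> inside (path_image c1 \<union> path_image c2) = {}"
  shows "path_image c2 - {a, b} \<subseteq> inside (path_image c1 \<union> path_image c3)"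
proof -
  let ?I = "inside (path_image c1 \<union> path_image c2)" and ?J = "path_image c1 \<union> path_image c3"
  have th': "theta a b c1 c3 c2" using th theta_rotate theta_commute by blast
  have "?I \<inter> ?J = {}"
    using c3 inside_no_overlap[of "path_image c1 \<union> path_image c2"] by blast+
  then have "?I \<subseteq> inside ?J"
    using connected_Int_frontier[OF theta_Jordan(3)[OF th], of "inside ?J"] z
      theta_Jordan(4)[OF th'] by blast
  then have "closure ?I \<subseteq> closure (inside ?J)" by (rule closure_mono)
  moreover have "path_image c2 \<subseteq> closure ?I"
    using theta_Jordan(4)[OF th] unfolding frontier_def by blast
  moreover have "closure (inside ?J) \<subseteq> inside ?J \<union> ?J"
    using theta_Jordan(4)[OF th'] closure_Un_frontier[of "inside ?J"] by blast
  moreover have "path_image c2 \<inter> ?J = {a, b}" using th unfolding theta_def by blast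
  ultimately show ?thesis by blast
qed

text \<open>The winding numbers of the three loops add up to zero, so a point enclosed by the first
  loop is enclosed by a second one.\<close>

lemma theta_some_arc_enclosed:
  assumes th: "theta a b c1 c2 c3"
  shows "path_image c3 \<inter> inside (path_image c1 \<union> path_image c2) \<noteq> {} \<or>
    path_image c2 - {a, b} \<subseteq> inside (path_image c1 \<union> path_image c3) \<or>
    path_image c1 - {a, b} \<subseteq> inside (path_image c2 \<union> path_image c3)"
proof (rule ccontr)
  assume no: "\<not> ?thesis"
  then have c3: "path_image c3 \<inter> inside (path_image c1 \<union> path_image c2) = {}" by blast
  obtain z where z: "z \<in> inside (path_image c1 \<union> path_image c2)" using theta_Jordan(1)[OF th] by blast
  have off: "z \<notin> path_image c1" "z \<notin> path_image c2" "z \<notin> path_image c3"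
    using z c3 inside_no_overlap[of "path_image c1 \<union> path_image c2"] by blast+
  have th13: "theta a b c1 c3 c2" and th21: "theta a b c2 c1 c3" and th23: "theta a b c2 c3 c1"
    using th theta_rotate theta_commute by blast+
  have "winding_number c1 z \<noteq> winding_number c2 z"
    using theta_loop_winding(2)[OF th off(1,2)] z by simp
  then have "winding_number c1 z \<noteq> winding_number c3 z \<or> winding_number c2 z \<noteq> winding_number c3 z"
    by metis
  then have "z \<in> inside (path_image c1 \<union> path_image c3) \<or> z \<in> inside (path_image c2 \<union> path_image c3)"
    using theta_loop_winding(2)[OF th13 off(1,3)] theta_loop_winding(2)[OF th23 off(2,3)] by blast
  then show False
    using theta_arc_inside_of_inside_meets[OF th z _ c3]
      theta_arc_inside_of_inside_meets[OF th21, of z] z c3 no by (auto simp: Un_commute)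
qed

text \<open>The third arc becomes a crosscut as soon as it meets the inside of the loop formed by
  the other two, and a crosscut splits this inside into two parts.\<close>

lemma theta_enclosed_arc:
  assumes th: "theta a b c1 c2 c3"
    and meets: "path_image c3 \<inter> inside (path_image c1 \<union> path_image c2) \<noteq> {}"
  shows "path_image c3 - {a, b} \<subseteq> inside (path_image c1 \<union> path_image c2)"
    and "inside (path_image c1 \<union> path_image c2) - path_image c3 \<subseteq>
      inside (path_image c1 \<union> path_image c3) \<union> inside (path_image c2 \<union> path_image c3)"
    and "inside (path_image c1 \<union> path_image c3) \<union> inside (path_image c2 \<union> path_image c3) \<subseteq>
      inside (path_image c1 \<union> path_image c2)"
proof -
  obtain "inside (path_image c1 \<union> path_image c3) \<inter> inside (path_image c2 \<union> path_image c3) = {}"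
    "inside (path_image c1 \<union> path_image c3) \<union> inside (path_image c2 \<union> path_image c3) \<union>
       (path_image c3 - {a, b}) = inside (path_image c1 \<union> path_image c2)"
    using split_inside_simple_closed_curve[of c1 a b c2 c3] th meets
    unfolding theta_def by (auto simp: arc_imp_simple_path)
  then show "path_image c3 - {a, b} \<subseteq> inside (path_image c1 \<union> path_image c2)"
    "inside (path_image c1 \<union> path_image c2) - path_image c3 \<subseteq>
      inside (path_image c1 \<union> path_image c3) \<union> inside (path_image c2 \<union> path_image c3)"
    "inside (path_image c1 \<union> path_image c3) \<union> inside (path_image c2 \<union> path_image c3) \<subseteq>
      inside (path_image c1 \<union> path_image c2)"
    by blast+
qed

section \<open>Blocks and branches\<close>

lemma successively_split:
  "successively P (xs @ x # ys) \<longleftrightarrow> successively P (xs @ [x]) \<and> successively P (x # ys)"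
  by (auto simp: successively_append_iff)

lemma rtranclp_leaves_set:
  assumes "r\<^sup>*\<^sup>* x y" "x \<in> S" "y \<notin> S"
  shows "\<exists>u v. u \<in> S \<and> v \<notin> S \<and> r u v"
  using assms by (induction rule: rtranclp_induct) auto

lemma rtranclp_first_hit:
  assumes "r\<^sup>*\<^sup>* x d" "x \<notin> S" "d \<in> S"
  shows "\<exists>qs z. z \<in> S \<and> qs \<noteq> [] \<and> hd qs = x \<and> successively r (qs @ [z]) \<and> distinct qs \<and> set qs \<inter> S = {}"
  using assms
proof (induction rule: converse_rtranclp_induct)
  case base
  then show ?case by blast
next
  case (step x y)
  show ?case
  proof (cases "y \<in> S")
    case True
    then show ?thesis using step by (intro exI[of _ "[x]"] exI[of _ y]) auto
  next
    case False
    then obtain qs z where q: "z \<in> S" "qs \<noteq> []" "hd qs = y" "successively r (qs @ [z])" "distinct qs" "set qs \<inter> S = {}"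
      using step by blast
    show ?thesis
    proof (cases "x \<in> set qs")
      case True
      then obtain as bs where "qs = as @ x # bs" by (meson split_list)
      then show ?thesis using q successively_split[of r as x "bs @ [z]"]
        by (intro exI[of _ "x # bs"] exI[of _ z]) auto
    next
      case False
      then show ?thesis using q step by (intro exI[of _ "x # qs"] exI[of _ z]) (auto simp: successively_Cons)
    qed
  qed
qed

locale simple_graph =
  fixes V :: "'a set" and adj :: "'a \<Rightarrow> 'a \<Rightarrow> bool"
  assumes finite_V: "finite V"
    and adj_V: "adj x y \<Longrightarrow> x \<in> V \<and> y \<in> V"
    and adj_sym: "adj x y \<Longrightarrow> adj y x"
    and adj_irrefl: "\<not> adj x x"
begin

definition joined :: "'a set \<Rightarrow> 'a \<Rightarrow> 'a \<Rightarrow> bool" where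
  "joined X = (\<lambda>u v. adj u v \<and> u \<in> X \<and> v \<in> X)\<^sup>*\<^sup>*"

definition conn :: "'a set \<Rightarrow> bool" where
  "conn X \<longleftrightarrow> (\<forall>x\<in>X. \<forall>y\<in>X. joined X x y)"

text \<open>Blocks are handled as vertex sets; \<open>blocks_eq\<close> later shows that the blocks
  of the digraph are the subgraphs induced on them. The empty set counts as \<open>conn\<close>, so
  single vertices and single edges qualify.\<close>

definition nonsep :: "'a set \<Rightarrow> bool" where
  "nonsep X \<longleftrightarrow> X \<subseteq> V \<and> X \<noteq> {} \<and> conn X \<and> (\<forall>v. conn (X - {v}))"

definition block :: "'a set \<Rightarrow> bool" where
  "block X \<longleftrightarrow> nonsep X \<and> (\<forall>Y. nonsep Y \<longrightarrow> X \<subseteq> Y \<longrightarrow> Y = X)"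

lemma joined_trans: "joined X x y \<Longrightarrow> joined X y z \<Longrightarrow> joined X x z"
  unfolding joined_def by (rule rtranclp_trans)

lemma joined_sym: "joined X x y \<Longrightarrow> joined X y x"
  unfolding joined_def by (rule sympD[OF symp_rtranclp]) (auto intro: sympI adj_sym)

lemma joined_mono: "joined X x y \<Longrightarrow> X \<subseteq> Y \<Longrightarrow> joined Y x y"
  unfolding joined_def by (erule rtranclp_mono[THEN predicate2D, rotated]) auto

lemma joined_refl: "joined X x x"
  unfolding joined_def by simp

lemma joined_edge: "adj x y \<Longrightarrow> x \<in> X \<Longrightarrow> y \<in> X \<Longrightarrow> joined X x y"
  unfolding joined_def by auto

lemma conn_Un:
  assumes "conn X" "conn Y" "X \<inter> Y \<noteq> {}"
  shows "conn (X \<union> Y)"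
proof -
  obtain z where z: "z \<in> X" "z \<in> Y" using assms by auto
  have "joined (X \<union> Y) x z" if "x \<in> X \<union> Y" for x
    using that z assms(1,2) joined_mono[of X x z "X \<union> Y"] joined_mono[of Y x z "X \<union> Y"]
    unfolding conn_def by blast
  then show ?thesis unfolding conn_def using joined_trans joined_sym by blast
qed

lemma conn_path: "successively adj xs \<Longrightarrow> conn (set xs)"
proof (induction xs)
  case (Cons x xs)
  show ?case
  proof (cases xs)
    case Nil
    then show ?thesis by (simp add: conn_def joined_refl)
  next
    case (Cons y ys)
    then have "adj x y" "conn (set xs)" using Cons.prems Cons.IH by auto
    moreover from this have "conn {x, y}" unfolding conn_def
      by (auto intro: joined_refl joined_edge adj_sym)
    ultimately show ?thesis using conn_Un[of "{x, y}" "set xs"] Cons by (auto simp: insert_absorb)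
  qed
qed (simp add: conn_def)

lemma nonsep_edge: "adj x y \<Longrightarrow> nonsep {x, y}"
proof -
  assume a: "adj x y"
  have "conn ({x, y} - {v})" for v
    using a by (cases "v = x"; cases "v = y") (auto simp: conn_def joined_refl insert_Diff_if intro: joined_edge adj_sym)
  moreover have "conn {x, y}" using conn_path[of "[x, y]"] a by simp
  ultimately show ?thesis using a adj_V unfolding nonsep_def by auto
qed

lemma nonsep_Un:
  assumes "nonsep X" "nonsep Y" "a \<in> X \<inter> Y" "b \<in> X \<inter> Y" "a \<noteq> b"
  shows "nonsep (X \<union> Y)"
proof -
  have "conn (X \<union> Y - {v})" for v
  proof -
    have "(X - {v}) \<inter> (Y - {v}) \<noteq> {}" using assms(3-5) by (cases "v = a") auto
    then have "conn ((X - {v}) \<union> (Y - {v}))" using assms(1,2) conn_Un unfolding nonsep_def by blast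
    then show ?thesis by (simp add: Un_Diff)
  qed
  moreover have "conn (X \<union> Y)" using assms conn_Un unfolding nonsep_def by blast
  ultimately show ?thesis using assms unfolding nonsep_def by blast
qed

text \<open>Deleting a vertex of the ear leaves two pieces that hang on \<open>B\<close> at
  \<open>b\<close> and at \<open>c\<close>; deleting \<open>b\<close> leaves the whole ear hanging
  at \<open>c\<close>, and deleting any other vertex leaves it hanging at \<open>b\<close>.\<close>

lemma nonsep_ear:
  assumes B: "nonsep B" and p: "successively adj (b # ps @ [c])" "distinct ps" "set ps \<inter> B = {}"
    and bc: "b \<in> B" "c \<in> B" "b \<noteq> c"
  shows "nonsep (B \<union> set ps)"
proof -
  have s1: "successively adj (b # ps)" and s2: "successively adj (ps @ [c])"
    using p(1) successively_append_iff[of adj "b # ps" "[c]"] successively_append_iff[of adj "[b]" "ps @ [c]"]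
    by simp_all
  have "conn (B \<union> set ps - {v})" for v
  proof (cases "v \<in> set ps")
    case True
    then obtain p1 p2 where ps: "ps = p1 @ v # p2" by (meson split_list)
    have "successively adj (b # p1)" "successively adj (p2 @ [c])"
      using p(1) successively_split[of adj "b # p1" v "p2 @ [c]"] successively_append_iff[of adj "b # p1" "[v]"]
      unfolding ps by (auto simp: successively_Cons)
    then have "conn (set (b # p1))" "conn (set (p2 @ [c]))" using conn_path by blast+
    then have "conn (B \<union> set (b # p1) \<union> set (p2 @ [c]))"
      using B bc unfolding nonsep_def by (intro conn_Un) auto
    moreover have "B \<union> set (b # p1) \<union> set (p2 @ [c]) = B \<union> set ps - {v}"
      using ps p bc by auto
    ultimately show ?thesis by simp
  next
    case False
    show ?thesis
    proof (cases "v = b")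
      case True
      have "conn ((B - {v}) \<union> set (ps @ [c]))"
        using B bc conn_path[OF s2] True unfolding nonsep_def by (intro conn_Un) auto
      moreover have "(B - {v}) \<union> set (ps @ [c]) = B \<union> set ps - {v}" using False bc True by auto
      ultimately show ?thesis by simp
    next
      case v: False
      have "conn ((B - {v}) \<union> set (b # ps))"
        using B bc conn_path[OF s1] v unfolding nonsep_def by (intro conn_Un) auto
      moreover have "(B - {v}) \<union> set (b # ps) = B \<union> set ps - {v}" using False bc v by auto
      ultimately show ?thesis by simp
    qed
  qed
  moreover have "conn (B \<union> set (b # ps))" using B bc conn_path[OF s1] unfolding nonsep_def by (intro conn_Un) auto
  then have "conn (B \<union> set ps)" using bc by (simp add: insert_absorb)
  moreover have "set ps \<subseteq> V"
    using s2 by (induction ps) (auto simp: successively_Cons dest: adj_V split: if_splits)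
  ultimately show ?thesis using B unfolding nonsep_def by blast
qed

lemma block_nonsep: "block B \<Longrightarrow> nonsep B"
  and block_maximal: "block B \<Longrightarrow> nonsep Y \<Longrightarrow> B \<subseteq> Y \<Longrightarrow> Y = B"
  unfolding block_def by auto

lemma block_subset: "block B \<Longrightarrow> B \<subseteq> V"
  unfolding block_def nonsep_def by blast

lemma nonsep_extends_to_block:
  assumes "nonsep X"
  shows "\<exists>B. block B \<and> X \<subseteq> B"
proof -
  have "finite {Y. nonsep Y \<and> X \<subseteq> Y}"
    by (rule finite_subset[of _ "Pow V"]) (auto simp: nonsep_def finite_V)
  moreover have "X \<in> {Y. nonsep Y \<and> X \<subseteq> Y}" using assms by simp
  ultimately obtain B where "B \<in> {Y. nonsep Y \<and> X \<subseteq> Y}" "\<forall>Y\<in>{Y. nonsep Y \<and> X \<subseteq> Y}. B \<subseteq> Y \<longrightarrow> B = Y"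
    using finite_has_maximal2 by (metis (no_types, lifting))
  then show ?thesis unfolding block_def by (intro exI[of _ B]) auto
qed

lemma blocks_share_one_vertex:
  assumes "block B" "block B'" "B \<noteq> B'" "a \<in> B" "a \<in> B'" "b \<in> B" "b \<in> B'"
  shows "a = b"
proof (rule ccontr)
  assume "a \<noteq> b"
  then have "nonsep (B \<union> B')" using assms nonsep_Un block_nonsep by blast
  then show False using assms block_maximal by (metis Un_upper1 Un_upper2)
qed

text \<open>Reachability once the edges inside \<open>B\<close> are deleted. For a block of a
  connected graph each class meets \<open>B\<close> exactly once; the classes are the branches
  hanging at the vertices of \<open>B\<close>.\<close>

definition out :: "'a set \<Rightarrow> 'a \<Rightarrow> 'a \<Rightarrow> bool" where
  "out B = (\<lambda>u v. adj u v \<and> \<not> (u \<in> B \<and> v \<in> B))\<^sup>*\<^sup>*"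

lemma out_trans: "out B x y \<Longrightarrow> out B y z \<Longrightarrow> out B x z"
  unfolding out_def by (rule rtranclp_trans)

lemma out_sym: "out B x y \<Longrightarrow> out B y x"
  unfolding out_def by (rule sympD[OF symp_rtranclp]) (auto intro: sympI adj_sym)

lemma out_refl: "out B x x"
  unfolding out_def by simp

lemma out_edge: "adj x y \<Longrightarrow> \<not> (x \<in> B \<and> y \<in> B) \<Longrightarrow> out B x y"
  unfolding out_def by auto

text \<open>A path leaving \<open>B\<close> at \<open>b\<close> and returning at another vertex would be an ear enlarging \<open>B\<close>.\<close>

lemma out_unique:
  assumes B: "block B" and b: "b \<in> B" "out B b x"
  shows "x \<in> B \<longleftrightarrow> x = b"
proof -
  \<comment> \<open>The induction carries a path from \<open>b\<close> outside \<open>B\<close> that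
    repeats no vertex, since only such a path can serve as an ear.\<close>
  have "if x \<in> B then x = b
    else \<exists>qs. qs \<noteq> [] \<and> last qs = x \<and> successively adj (b # qs) \<and> distinct qs \<and> set qs \<inter> B = {}"
    using b(2) unfolding out_def
  proof (induction rule: rtranclp_induct)
    case base
    then show ?case using b by simp
  next
    case (step x y)
    show ?case
    proof (cases "x \<in> B")
      case True
      then have "x = b" "y \<notin> B" using step by auto
      then show ?thesis using step by (auto intro!: exI[of _ "[y]"])
    next
      case False
      then obtain qs where q: "qs \<noteq> []" "last qs = x" "successively adj (b # qs)" "distinct qs" "set qs \<inter> B = {}"
        using step.IH by auto
      have s: "successively adj (b # qs @ [y])"
        using q step by (auto simp: successively_append_iff successively_Cons)
      show ?thesis
      proof (cases "y \<in> B")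
        case True
        have "y = b"
        proof (rule ccontr)
          assume "y \<noteq> b"
          then have "nonsep (B \<union> set qs)"
            using nonsep_ear[OF block_nonsep[OF B] s q(4,5) b(1) True] by simp
          then show False using block_maximal[OF B, of "B \<union> set qs"] q by (cases qs) auto
        qed
        then show ?thesis using b by simp
      next
        case yB: False
        show ?thesis
        proof (cases "y \<in> set qs")
          case True
          then obtain as bs where "qs = as @ y # bs" by (meson split_list)
          then show ?thesis using q yB successively_split[of adj "b # as" y bs]
            by (auto intro!: exI[of _ "as @ [y]"])
        next
          case False
          then show ?thesis using q s yB by (auto intro!: exI[of _ "qs @ [y]"])
        qed
      qed
    qed
  qed
  then show ?thesis using b by auto
qed

definition root :: "'a set \<Rightarrow> 'a \<Rightarrow> 'a" where
  "root B x = (THE b. b \<in> B \<and> out B x b)"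

lemma root_eqI:
  assumes "block B" "b \<in> B" "out B x b"
  shows "root B x = b"
  unfolding root_def
proof (rule the_equality)
  show "c = b" if "c \<in> B \<and> out B x c" for c
    using out_unique[OF assms(1,2), of c] out_trans[OF out_sym[OF assms(3)], of c] that by blast
qed (use assms in auto)

lemma root_id: "block B \<Longrightarrow> b \<in> B \<Longrightarrow> root B b = b"
  by (rule root_eqI) (auto intro: out_refl)

end

locale connected_graph = simple_graph +
  assumes conn_V: "conn V"
begin

lemma root_props:
  assumes "block B" "x \<in> V"
  shows "root B x \<in> B" "out B x (root B x)"
proof -
  obtain b0 where b0: "b0 \<in> B" "b0 \<in> V" using assms(1) unfolding block_def nonsep_def by blast
  then have "joined V x b0" using conn_V assms(2) unfolding conn_def by blast
  then have "\<exists>b\<in>B. out B x b"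
    unfolding joined_def
  proof (induction rule: converse_rtranclp_induct)
    case base
    then show ?case using b0 out_refl by blast
  next
    case (step x y)
    then show ?case by (cases "x \<in> B") (use out_refl out_edge out_trans in blast)+
  qed
  then obtain b where "b \<in> B" "out B x b" by blast
  then show "root B x \<in> B" "out B x (root B x)" using root_eqI[OF assms(1)] by simp_all
qed

lemma root_V: "block B \<Longrightarrow> x \<in> V \<Longrightarrow> root B x \<in> V"
  using root_props(1) block_subset by blast

lemma root_out:
  assumes "block B" "y \<in> V" "out B x y"
  shows "root B x = root B y"
  using root_eqI[OF assms(1) root_props(1)[OF assms(1,2)] out_trans[OF assms(3) root_props(2)[OF assms(1,2)]]] .

lemma root_adj: "block B \<Longrightarrow> adj x y \<Longrightarrow> root B x = root B y \<or> x \<in> B \<and> y \<in> B"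
  using root_out out_edge adj_V by blast

text \<open>Two blocks share at most one vertex, so no edge of \<open>B'\<close> lies inside
  \<open>B\<close>, and all connections within \<open>B'\<close> survive the deletion behind
  \<open>out B\<close>.\<close>

lemma block_on_branch:
  assumes "block B" "block B'" "B \<noteq> B'" "x \<in> B'" "y \<in> B'"
  shows "root B x = root B y"
proof -
  have "joined B' x y" using assms block_nonsep unfolding nonsep_def conn_def by blast
  then have "out B x y" unfolding joined_def out_def
  proof (rule rtranclp_mono[THEN predicate2D, rotated], intro predicate2I)
    fix u v assume "adj u v \<and> u \<in> B' \<and> v \<in> B'"
    moreover from this have "u \<noteq> v" using adj_irrefl by blast
    ultimately show "adj u v \<and> \<not> (u \<in> B \<and> v \<in> B)"
      using blocks_share_one_vertex[OF assms(1-3), of u v] by blast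
  qed
  then show ?thesis using root_out assms block_subset by blast
qed

text \<open>The connection from \<open>x\<close> to \<open>root B x\<close> stays in a branch of
  \<open>B\<close> other than the one at \<open>a\<close>, whereas all of \<open>B'\<close> lies in
  the branch at \<open>a\<close>. So it uses no edge of \<open>B'\<close>, and \<open>B\<close>
  itself hangs on \<open>B'\<close> at \<open>a\<close>.\<close>

lemma branches_disjoint:
  assumes "block B" "block B'" "B \<noteq> B'" "a \<in> B" "a \<in> B'" "x \<in> V" "root B x \<noteq> a"
  shows "root B' x = a"
proof -
  have B'a: "root B y = a" if "y \<in> B'" for y
    using block_on_branch[OF assms(1-3) that assms(5)] root_id assms by simp
  have "out B x y \<Longrightarrow> out B' x y" for y
    unfolding out_def
  proof (induction rule: rtranclp_induct)
    case (step y z)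
    have "y \<in> V" using step adj_V by blast
    moreover have "out B x y" using step(1) by (simp add: out_def)
    ultimately have "root B y = root B x" using root_out[OF assms(1)] by simp
    then have "y \<notin> B'" using B'a assms(7) by auto
    then have "adj y z \<and> \<not> (y \<in> B' \<and> z \<in> B')" using step by blast
    with step.IH show ?case by (rule rtranclp.rtrancl_into_rtrancl)
  qed simp
  then have "root B' x = root B' (root B x)"
    using root_out[OF assms(2) root_V] root_props assms by blast
  also have "\<dots> = root B' a"
    using block_on_branch[OF assms(2,1) _ root_props(1) assms(4)] assms by blast
  finally show ?thesis using root_id assms by simp
qed

text \<open>A walk from \<open>a\<close> enters some block at \<open>a\<close>. Each further edge
  either keeps the root or lies inside this block, where a vertex is its own root; a return to
  \<open>a\<close> restarts the choice.\<close>

lemma exists_block_towards: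
  assumes "a \<in> V" "e \<in> V" "e \<noteq> a"
  shows "\<exists>B. block B \<and> a \<in> B \<and> root B e \<noteq> a"
proof -
  have "joined V a e" using assms conn_V unfolding conn_def by blast
  then have "e \<noteq> a \<longrightarrow> (\<exists>B. block B \<and> a \<in> B \<and> root B e \<noteq> a)"
    unfolding joined_def
  proof (induction rule: rtranclp_induct)
    case (step e f)
    show ?case
    proof (cases "e = a")
      case True
      obtain B where "block B" "{a, f} \<subseteq> B" using nonsep_extends_to_block[OF nonsep_edge] step True by blast
      then show ?thesis using root_id[of B f] by auto
    next
      case False
      then obtain B where "block B" "a \<in> B" "root B e \<noteq> a" using step by blast
      then show ?thesis using root_adj[of B e f] root_id[of B f] step by metis
    qed
  qed simp
  then show ?thesis using assms by blast
qed

end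

section \<open>Outerplanar drawings\<close>

fun path_trace :: "('a set \<Rightarrow> real \<Rightarrow> complex) \<Rightarrow> 'a list \<Rightarrow> complex set" where
  "path_trace \<gamma> (u # v # xs) = path_image (\<gamma> {u, v}) \<union> path_trace \<gamma> (v # xs)"
| "path_trace \<gamma> _ = {}"

lemma trace_append: "path_trace \<gamma> (xs @ x # ys) = path_trace \<gamma> (xs @ [x]) \<union> path_trace \<gamma> (x # ys)"
proof (induction xs)
  case Nil
  then show ?case by (cases ys) auto
next
  case (Cons a xs)
  then show ?case by (cases xs) auto
qed

lemma trace_rev: "path_trace \<gamma> (rev xs) = path_trace \<gamma> xs"
proof (induction \<gamma> xs rule: path_trace.induct)
  case (1 \<gamma> u v xs)
  have "path_trace \<gamma> (rev (u # v # xs)) = path_trace \<gamma> (rev xs @ [v]) \<union> path_trace \<gamma> [v, u]"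
    using trace_append[of \<gamma> "rev xs" v "[u]"] by simp
  then show ?case using 1 by (auto simp: insert_commute)
qed auto

lemma in_trace_edge:
  "z \<in> path_trace \<gamma> xs \<Longrightarrow> \<exists>ys u v zs. xs = ys @ u # v # zs \<and> z \<in> path_image (\<gamma> {u, v})"
proof (induction \<gamma> xs rule: path_trace.induct)
  case (1 \<gamma> u v xs)
  from 1(2) consider "z \<in> path_image (\<gamma> {u, v})" | "z \<in> path_trace \<gamma> (v # xs)" by auto
  then show ?case
  proof cases
    case 1
    then show ?thesis by (intro exI[of _ "[]"]) auto
  next
    case 2
    then obtain ys u' v' zs where "v # xs = ys @ u' # v' # zs" "z \<in> path_image (\<gamma> {u', v'})"
      using 1 by blast
    then show ?thesis by (intro exI[of _ "u # ys"]) auto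
  qed
qed auto

locale outerplanar_drawing =
  fixes G :: "('a, 'b) pre_digraph" and p :: "'a \<Rightarrow> complex" and \<gamma> :: "'a set \<Rightarrow> real \<Rightarrow> complex"
  assumes graph: "graph G"
    and drawing: "plane_drawing G p \<gamma>"
    and outer: "p ` verts G \<subseteq> frontier (outside (drawing_points G p \<gamma>))"
begin

abbreviation adj :: "'a \<Rightarrow> 'a \<Rightarrow> bool" where "adj u v \<equiv> u \<rightarrow>\<^bsub>G\<^esub> v"

lemma adj_verts: "adj u v \<Longrightarrow> u \<in> verts G \<and> v \<in> verts G"
proof -
  interpret graph G by (rule graph)
  show "adj u v \<Longrightarrow> u \<in> verts G \<and> v \<in> verts G" using adj_in_verts by blast
qed

lemma adj_sym: "adj u v \<Longrightarrow> adj v u"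
proof -
  interpret graph G by (rule graph)
  show "adj u v \<Longrightarrow> adj v u" by (rule arcs_ends_symmetric[OF sym_arcs])
qed

lemma p_eq_iff: "u \<in> verts G \<Longrightarrow> v \<in> verts G \<Longrightarrow> p u = p v \<longleftrightarrow> u = v"
  using drawing unfolding plane_drawing_def by (auto dest: inj_onD)

lemma edge_ends: "adj u v \<Longrightarrow> p u \<in> path_image (\<gamma> {u, v}) \<and> p v \<in> path_image (\<gamma> {u, v})"
  using drawing unfolding plane_drawing_def by blast

lemma edge_Int:
  "adj u v \<Longrightarrow> adj x y \<Longrightarrow> {u, v} \<noteq> {x, y} \<Longrightarrow>
    path_image (\<gamma> {u, v}) \<inter> path_image (\<gamma> {x, y}) = p ` ({u, v} \<inter> {x, y})"
  using drawing unfolding plane_drawing_def by blast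

lemma edge_arc:
  assumes "adj u v"
  obtains g where "arc g" "pathstart g = p u" "pathfinish g = p v" "path_image g = path_image (\<gamma> {u, v})"
proof -
  have a: "arc (\<gamma> {u, v})" and e: "{pathstart (\<gamma> {u, v}), pathfinish (\<gamma> {u, v})} = {p u, p v}"
    using drawing assms unfolding plane_drawing_def by blast+
  from e consider "pathstart (\<gamma> {u, v}) = p u" "pathfinish (\<gamma> {u, v}) = p v"
    | "pathstart (\<gamma> {u, v}) = p v" "pathfinish (\<gamma> {u, v}) = p u"
    by (auto simp: doubleton_eq_iff)
  then show ?thesis
  proof cases
    case 1
    then show ?thesis using that[of "\<gamma> {u, v}"] a by blast
  next
    case 2
    then show ?thesis using that[of "reversepath (\<gamma> {u, v})"] a by (auto simp: arc_reversepath)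
  qed
qed

lemma trace_subset: "successively adj xs \<Longrightarrow> path_trace \<gamma> xs \<subseteq> drawing_points G p \<gamma>"
  by (induction \<gamma> xs rule: path_trace.induct) (auto simp: drawing_points_def)

lemma vertex_in_trace: "successively adj xs \<Longrightarrow> length xs \<ge> 2 \<Longrightarrow> w \<in> set xs \<Longrightarrow> p w \<in> path_trace \<gamma> xs"
proof (induction xs)
  case (Cons u xs)
  then obtain v ys where xs: "xs = v # ys" by (cases xs) auto
  show ?case
  proof (cases "w = u \<or> w = v")
    case True
    then show ?thesis using Cons.prems edge_ends[of u v] xs by auto
  next
    case False
    then have "w \<in> set xs" "length xs \<ge> 2" using Cons.prems xs by (cases ys; auto)+
    then show ?thesis using Cons xs by auto
  qed
qed auto

section \<open>Paths of the graph drawn as arcs\<close>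

lemma arc_of_path:
  assumes "successively adj xs" "distinct xs" "length xs \<ge> 2"
  shows "\<exists>g. arc g \<and> pathstart g = p (hd xs) \<and> pathfinish g = p (last xs) \<and> path_image g = path_trace \<gamma> xs"
  using assms
proof (induction xs)
  case (Cons u xs)
  then obtain v ys where xs: "xs = v # ys" by (cases xs) auto
  have uv: "adj u v" using Cons.prems xs by auto
  obtain g where g: "arc g" "pathstart g = p u" "pathfinish g = p v" "path_image g = path_image (\<gamma> {u, v})"
    using edge_arc[OF uv] .
  show ?case
  proof (cases "ys = []")
    case True
    then show ?thesis using g xs by auto
  next
    case False
    then have "successively adj xs" "distinct xs" "length xs \<ge> 2" using Cons.prems xs by (cases ys; auto)+
    from Cons.IH[OF this] obtain h where h: "arc h" "pathstart h = p v" "pathfinish h = p (last xs)"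
      "path_image h = path_trace \<gamma> xs" using xs by auto
    have "path_image g \<inter> path_image h \<subseteq> {p v}"
    proof
      fix z assume z: "z \<in> path_image g \<inter> path_image h"
      then obtain as x y bs where e: "xs = as @ x # y # bs" "z \<in> path_image (\<gamma> {x, y})"
        using in_trace_edge h(4) by blast
      have xy: "adj x y" using e(1) \<open>successively adj xs\<close> by (auto simp: successively_append_iff)
      have u: "u \<notin> {x, y}" using e(1) Cons.prems by auto
      then have "z \<in> p ` ({u, v} \<inter> {x, y})" using edge_Int[OF uv xy] z g(4) e(2) by auto
      then show "z \<in> {p v}" using u by auto
    qed
    then have "arc (g +++ h)" using g h by (intro arc_join) auto
    then show ?thesis using g h xs
      by (intro exI[of _ "g +++ h"]) (auto simp: path_image_join)
  qed
qed auto

text \<open>Drawn edges meet only in common ends, so any further common point needs a common edge.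
  Its ends would be \<open>a\<close> and \<open>b\<close>, but the first path does not use that edge
  because \<open>us \<noteq> []\<close>.\<close>

lemma trace_Int:
  assumes xs: "successively adj (a # us @ [b])" "distinct (a # us @ [b])"
    and ys: "successively adj (a # vs @ [b])" "distinct (a # vs @ [b])"
    and us: "us \<noteq> []" and disj: "set us \<inter> set vs = {}"
  shows "path_trace \<gamma> (a # us @ [b]) \<inter> path_trace \<gamma> (a # vs @ [b]) = {p a, p b}"
proof
  show "{p a, p b} \<subseteq> path_trace \<gamma> (a # us @ [b]) \<inter> path_trace \<gamma> (a # vs @ [b])"
    using vertex_in_trace[OF xs(1)] vertex_in_trace[OF ys(1)] by auto
next
  show "path_trace \<gamma> (a # us @ [b]) \<inter> path_trace \<gamma> (a # vs @ [b]) \<subseteq> {p a, p b}"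
  proof
    fix z assume z: "z \<in> path_trace \<gamma> (a # us @ [b]) \<inter> path_trace \<gamma> (a # vs @ [b])"
    obtain as u v bs where e: "a # us @ [b] = as @ u # v # bs" "z \<in> path_image (\<gamma> {u, v})"
      using z in_trace_edge by blast
    obtain as' u' v' bs' where e': "a # vs @ [b] = as' @ u' # v' # bs'" "z \<in> path_image (\<gamma> {u', v'})"
      using z in_trace_edge by blast
    have uv: "adj u v" using xs(1) e(1) by (auto simp: successively_append_iff)
    have uv': "adj u' v'" using ys(1) e'(1) by (auto simp: successively_append_iff)
    have m: "{u, v} \<subseteq> insert a (insert b (set us))"
      using arg_cong[OF e(1), of set] by auto
    have m': "{u', v'} \<subseteq> insert a (insert b (set vs))"
      using arg_cong[OF e'(1), of set] by auto
    have sub: "{u, v} \<inter> {u', v'} \<subseteq> {a, b}" using m m' disj by blast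
    have "{u, v} \<noteq> {u', v'}"
    proof
      assume "{u, v} = {u', v'}"
      then have ab: "u \<in> {a, b}" "v \<in> {a, b}" using sub by auto
      have d: "distinct (as @ u # v # bs)" using e(1) xs(2) by metis
      have "as = []"
      proof (rule ccontr)
        assume "as \<noteq> []"
        then have "a = hd as" using e(1) by (cases as) auto
        then have "a \<notin> {u, v}" using d \<open>as \<noteq> []\<close> by (cases as) auto
        then have "u = v" using ab by blast
        then show False using d by auto
      qed
      then have "u = a" "us @ [b] = v # bs" using e(1) by auto
      moreover from this have "v = b" using ab d by auto
      ultimately show False using us xs(2) by (cases us) auto
    qed
    then have "z \<in> p ` ({u, v} \<inter> {u', v'})" using edge_Int[OF uv uv'] e(2) e'(2) by auto
    then show "z \<in> {p a, p b}" using sub by blast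
  qed
qed

lemma theta_of_paths:
  assumes us: "successively adj (a # us @ [b])" "distinct (a # us @ [b])" "us \<noteq> []"
    and vs: "successively adj (a # vs @ [b])" "distinct (a # vs @ [b])" "vs \<noteq> []"
    and ws: "successively adj (a # ws @ [b])" "distinct (a # ws @ [b])"
    and disj: "set us \<inter> set vs = {}" "set us \<inter> set ws = {}" "set vs \<inter> set ws = {}"
  obtains c1 c2 c3 where "theta (p a) (p b) c1 c2 c3" "path_image c1 = path_trace \<gamma> (a # us @ [b])"
    "path_image c2 = path_trace \<gamma> (a # vs @ [b])" "path_image c3 = path_trace \<gamma> (a # ws @ [b])"
proof -
  obtain c1 where c1: "arc c1" "pathstart c1 = p a" "pathfinish c1 = p b" "path_image c1 = path_trace \<gamma> (a # us @ [b])"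
    using arc_of_path[OF us(1,2)] by auto
  obtain c2 where c2: "arc c2" "pathstart c2 = p a" "pathfinish c2 = p b" "path_image c2 = path_trace \<gamma> (a # vs @ [b])"
    using arc_of_path[OF vs(1,2)] by auto
  obtain c3 where c3: "arc c3" "pathstart c3 = p a" "pathfinish c3 = p b" "path_image c3 = path_trace \<gamma> (a # ws @ [b])"
    using arc_of_path[OF ws] by auto
  have "p a \<noteq> p b" using arc_distinct_ends[OF c1(1)] c1 by auto
  then have "theta (p a) (p b) c1 c2 c3"
    unfolding theta_def using c1 c2 c3 trace_Int[OF us(1,2) vs(1,2) us(3) disj(1)]
      trace_Int[OF us(1,2) ws us(3) disj(2)] trace_Int[OF vs(1,2) ws vs(3) disj(3)] by simp
  then show ?thesis using that c1 c2 c3 by blast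
qed

text \<open>A vertex lies on the boundary of the outside of the drawing, so every neighbourhood of
  it contains outside points; the inside of a part \<open>J\<close> of the drawing contains
  none.\<close>

lemma vertex_not_enclosed:
  assumes "w \<in> verts G" "J \<subseteq> drawing_points G p \<gamma>" "open (inside J)"
  shows "p w \<notin> inside J"
proof
  assume w: "p w \<in> inside J"
  have "p w \<in> closure (outside (drawing_points G p \<gamma>))"
    using outer assms(1) unfolding frontier_def by auto
  then have "inside J \<inter> outside (drawing_points G p \<gamma>) \<noteq> {}"
    using w assms(3) open_Int_closure_eq_empty by blast
  then show False using outside_mono[OF assms(2)] inside_Int_outside by blast
qed

text \<open>One of the three arcs is enclosed by the other two, and an enclosed arc carries no inner
  vertex. The first two paths have inner vertices, so it must be the third, which is then a single
  edge.\<close>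

lemma third_path_enclosed:
  assumes us: "successively adj (a # us @ [b])" "distinct (a # us @ [b])" "us \<noteq> []"
    and vs: "successively adj (a # vs @ [b])" "distinct (a # vs @ [b])" "vs \<noteq> []"
    and ws: "successively adj (a # ws @ [b])" "distinct (a # ws @ [b])"
    and disj: "set us \<inter> set vs = {}" "set us \<inter> set ws = {}" "set vs \<inter> set ws = {}"
  shows "ws = []"
    and "\<exists>c1 c2 c3. theta (p a) (p b) c1 c2 c3 \<and> path_image c1 = path_trace \<gamma> (a # us @ [b]) \<and>
      path_image c2 = path_trace \<gamma> (a # vs @ [b]) \<and> path_image c3 = path_trace \<gamma> (a # ws @ [b]) \<and>
      path_image c3 \<inter> inside (path_image c1 \<union> path_image c2) \<noteq> {}"
proof -
  obtain c1 c2 c3 where th: "theta (p a) (p b) c1 c2 c3" and im: "path_image c1 = path_trace \<gamma> (a # us @ [b])"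
    "path_image c2 = path_trace \<gamma> (a # vs @ [b])" "path_image c3 = path_trace \<gamma> (a # ws @ [b])"
    using theta_of_paths[OF assms] .
  have th13: "theta (p a) (p b) c1 c3 c2" and th23: "theta (p a) (p b) c2 c3 c1"
    using th theta_rotate theta_commute by blast+
  have no: "\<not> path_image c - {p a, p b} \<subseteq> inside (path_image d \<union> path_image d')"
    if that: "theta (p a) (p b) d d' d''" "path_image c = path_trace \<gamma> (a # xs @ [b])" and ne: "xs \<noteq> []"
      and xs: "successively adj (a # xs @ [b])" "distinct (a # xs @ [b])"
      and sub: "path_image d \<union> path_image d' \<subseteq> drawing_points G p \<gamma>" for c d d' d'' xs
  proof -
    obtain x where x: "x \<in> set xs" using ne by (cases xs) auto
    have "x \<in> verts G" "a \<in> verts G" "b \<in> verts G"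
      using xs(1) x by (auto simp: successively_append_iff successively_Cons dest!: split_list adj_verts)
    then have "p x \<noteq> p a" "p x \<noteq> p b" using xs(2) x p_eq_iff by auto
    moreover have "p x \<in> path_image c" using vertex_in_trace[OF xs(1)] that(2) x by auto
    moreover have "p x \<notin> inside (path_image d \<union> path_image d')"
      by (rule vertex_not_enclosed[OF \<open>x \<in> verts G\<close> sub theta_Jordan(2)[OF that(1)]])
    ultimately show ?thesis by blast
  qed
  have sub: "path_image c1 \<subseteq> drawing_points G p \<gamma>" "path_image c2 \<subseteq> drawing_points G p \<gamma>"
    "path_image c3 \<subseteq> drawing_points G p \<gamma>"
    unfolding im using trace_subset us vs ws by blast+
  have meets: "path_image c3 \<inter> inside (path_image c1 \<union> path_image c2) \<noteq> {}"
    using theta_some_arc_enclosed[OF th] no[OF th13 im(2) vs(3,1,2)] no[OF th23 im(1) us(3,1,2)] sub by blast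
  then show "\<exists>c1 c2 c3. theta (p a) (p b) c1 c2 c3 \<and> path_image c1 = path_trace \<gamma> (a # us @ [b]) \<and>
      path_image c2 = path_trace \<gamma> (a # vs @ [b]) \<and> path_image c3 = path_trace \<gamma> (a # ws @ [b]) \<and>
      path_image c3 \<inter> inside (path_image c1 \<union> path_image c2) \<noteq> {}"
    using th im by blast
  show "ws = []"
    using theta_enclosed_arc(1)[OF th meets] no[OF th im(3) _ ws] sub by blast
qed

text \<open>Both chords are enclosed by the cycle that the two paths form. The chord from
  \<open>a\<close> to \<open>b\<close> cuts the inside into two halves with \<open>x\<close> and
  \<open>y\<close> on different sides, and the chord from \<open>x\<close> to \<open>y\<close>
  cannot change sides.\<close>

lemma no_crossing_chords:
  assumes us: "successively adj (a # us @ [b])" "distinct (a # us @ [b])"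
    and vs: "successively adj (a # vs @ [b])" "distinct (a # vs @ [b])"
    and disj: "set us \<inter> set vs = {}"
    and ab: "adj a b" and x: "x \<in> set us" and y: "y \<in> set vs"
  shows "\<not> adj x y"
proof
  assume xy: "adj x y"
  have ne: "us \<noteq> []" "vs \<noteq> []" using x y by auto
  have abp: "successively adj (a # [] @ [b])" "distinct (a # [] @ [b])" using ab us(2) by auto
  have nil: "A \<inter> set [] = {}" for A :: "'a set" by simp
  have edge_trace: "path_trace \<gamma> (u # [] @ [v]) = path_image (\<gamma> {u, v})" for u v by simp
  obtain c1 c2 c3 where th: "theta (p a) (p b) c1 c2 c3" and im: "path_image c1 = path_trace \<gamma> (a # us @ [b])"
    "path_image c2 = path_trace \<gamma> (a # vs @ [b])" "path_image c3 = path_image (\<gamma> {a, b})"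
    and meets: "path_image c3 \<inter> inside (path_image c1 \<union> path_image c2) \<noteq> {}"
    using third_path_enclosed(2)[OF us ne(1) vs ne(2) abp disj nil nil] unfolding edge_trace by blast
  obtain u1 u2 where u: "us = u1 @ x # u2" using x by (meson split_list)
  obtain v1 v2 where v: "vs = v1 @ y # v2" using y by (meson split_list)
  let ?J = "path_image c1 \<union> path_image c2"
  \<comment> \<open>The same cycle cut open at \<open>x\<close> and \<open>y\<close> instead: one
    path runs through \<open>a\<close>, the other through \<open>b\<close>.\<close>
  let ?q1 = "x # (rev u1 @ a # v1) @ [y]" and ?q2 = "x # (u2 @ b # rev v2) @ [y]"
  have succ_rev: "successively adj (rev zs) = successively adj zs" for zs
    unfolding successively_rev by (rule successively_cong) (auto intro: adj_sym)
  have s1: "successively adj (a # u1 @ [x])" "successively adj (x # u2 @ [b])"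
    using us(1) successively_split[of adj "a # u1" x "u2 @ [b]"] unfolding u by simp_all
  have s2: "successively adj (a # v1 @ [y])" "successively adj (y # v2 @ [b])"
    using vs(1) successively_split[of adj "a # v1" y "v2 @ [b]"] unfolding v by simp_all
  have r1: "successively adj (x # rev u1 @ [a])" using succ_rev[of "a # u1 @ [x]"] s1(1) by simp
  have r2: "successively adj (b # rev v2 @ [y])" using succ_rev[of "y # v2 @ [b]"] s2(2) by simp
  have q1: "successively adj ?q1"
    using r1 s2(1) successively_split[of adj "x # rev u1" a "v1 @ [y]"] by simp
  have q2: "successively adj ?q2"
    using r2 s1(2) successively_split[of adj "x # u2" b "rev v2 @ [y]"] by simp
  have d: "distinct ?q1" "distinct ?q2" using us(2) vs(2) disj unfolding u v by auto
  have dj: "set (rev u1 @ a # v1) \<inter> set (u2 @ b # rev v2) = {}" using us(2) vs(2) disj unfolding u v by auto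
  have xyp: "successively adj (x # [] @ [y])" "distinct (x # [] @ [y])" using xy d by auto
  obtain d1 d2 d3 where th': "theta (p x) (p y) d1 d2 d3" and im': "path_image d1 = path_trace \<gamma> ?q1"
    "path_image d2 = path_trace \<gamma> ?q2" "path_image d3 = path_image (\<gamma> {x, y})"
    and meets': "path_image d3 \<inter> inside (path_image d1 \<union> path_image d2) \<noteq> {}"
    using third_path_enclosed(2)[OF q1 d(1) _ q2 d(2) _ xyp dj nil nil] unfolding edge_trace by blast
  have t: "path_trace \<gamma> (x # rev u1 @ [a]) = path_trace \<gamma> (a # u1 @ [x])" "path_trace \<gamma> (b # rev v2 @ [y]) = path_trace \<gamma> (y # v2 @ [b])"
    using trace_rev[of \<gamma> "a # u1 @ [x]"] trace_rev[of \<gamma> "y # v2 @ [b]"] by simp_all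
  have J: "path_image d1 \<union> path_image d2 = ?J"
    unfolding im im' u v
    using trace_append[of \<gamma> "x # rev u1" a "v1 @ [y]"] trace_append[of \<gamma> "x # u2" b "rev v2 @ [y]"]
      trace_append[of \<gamma> "a # u1" x "u2 @ [b]"] trace_append[of \<gamma> "a # v1" y "v2 @ [b]"] t by auto
  have ins: "path_image d3 - {p x, p y} \<subseteq> inside ?J"
    using theta_enclosed_arc(1)[OF th' meets'] unfolding J .
  have "{x, y} \<inter> {a, b} = {}" using us(2) vs(2) x y by auto
  then have cd: "path_image c3 \<inter> path_image d3 = {}"
    using edge_Int[OF ab xy] unfolding im im' by auto
  obtain z where z: "z \<in> path_image d3" "z \<in> inside ?J" using meets' J by auto
  have pxy: "p x \<in> path_image c1" "p y \<in> path_image c2"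
    using vertex_in_trace[OF us(1), of x] vertex_in_trace[OF vs(1), of y] x y unfolding im by auto
  have zn: "z \<noteq> p x" "z \<noteq> p y" using z pxy inside_no_overlap[of ?J] by blast+
  have half: "Topological_Spaces.connected (path_image g - {pathstart g})" if "arc g" for g :: "real \<Rightarrow> complex"
  proof -
    have "path_image g - {pathstart g} = g ` ({0..1} - {0})"
      using that inj_on_image_set_diff[of g "{0..1}" "{0..1}" "{0}"]
      by (simp add: arc_def path_image_def pathstart_def)
    moreover have "{0..1} - {0} = {0<..1::real}" by auto
    moreover have "continuous_on {0<..1} g"
      using that unfolding arc_def path_def by (auto intro: continuous_on_subset)
    ultimately show ?thesis by (simp add: connected_continuous_image)
  qed
  have "p x \<notin> {p a, p b}" "p y \<notin> {p a, p b}"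
    using x y us(2) vs(2) p_eq_iff adj_verts[OF ab] adj_verts[OF xy] by auto
  then have pn: "p x \<notin> path_image c2" "p y \<notin> path_image c1"
    using pxy th unfolding theta_def by blast+
  have dJ: "path_image d3 \<inter> ?J \<subseteq> {p x, p y}" using th' unfolding J[symmetric] theta_def by blast
  \<comment> \<open>Without its starting point the chord misses the boundary of the half bounded by
    \<open>c\<close> and \<open>c3\<close>. Being connected and containing \<open>z\<close>, it lies
    in this half together with its end \<open>t\<close>; but \<open>t\<close> is on the cycle and
    hence not inside it.\<close>
  have key: False
    if c: "theta (p a) (p b) c c3 c'" "path_image c \<subseteq> ?J" and sub: "inside (path_image c \<union> path_image c3) \<subseteq> inside ?J"
      and zc: "z \<in> inside (path_image c \<union> path_image c3)"
      and g: "arc g" "path_image g = path_image d3" and st: "{pathstart g, t} = {p x, p y}"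
      and t: "t \<notin> path_image c" "t \<in> ?J" for c c' g t
  proof -
    let ?T = "path_image g - {pathstart g}"
    have "?T \<inter> (path_image c \<union> path_image c3) = {}" using dJ cd g st t(1) c(2) by blast
    moreover have "z \<in> ?T" using z zn st g by auto
    ultimately have "?T \<subseteq> inside (path_image c \<union> path_image c3)"
      using connected_Int_frontier[OF half[OF g(1)], of "inside (path_image c \<union> path_image c3)"]
        theta_Jordan(4)[OF c(1)] zc by blast
    moreover have "t \<in> ?T"
      using g(2) st edge_ends[OF xy] arc_distinct_ends[of d3] th' unfolding im'(3) theta_def doubleton_eq_iff by auto
    ultimately show False using sub t(2) inside_no_overlap[of ?J] by blast
  qed
  have d3: "arc d3" "pathstart d3 = p x" "pathfinish d3 = p y" using th' unfolding theta_def by auto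
  have th13: "theta (p a) (p b) c1 c3 c2" and th23: "theta (p a) (p b) c2 c3 c1"
    using th theta_rotate theta_commute by blast+
  have "z \<in> inside (path_image c1 \<union> path_image c3) \<or> z \<in> inside (path_image c2 \<union> path_image c3)"
    using theta_enclosed_arc(2)[OF th meets] z cd by blast
  then show False
    using key[OF th13 _ _ _ d3(1), of "p y"] key[OF th23 _ _ _ arc_reversepath[OF d3(1)], of "p x"]
      theta_enclosed_arc(3)[OF th meets] pn pxy d3 by (auto simp: insert_commute)
qed

end

section \<open>Hamilton cycles of blocks\<close>

locale outerplanar_graph = connected_graph +
  assumes no_theta:
    "\<lbrakk>successively adj (a # us @ [b]); distinct (a # us @ [b]); us \<noteq> [];
      successively adj (a # vs @ [b]); distinct (a # vs @ [b]); vs \<noteq> [];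
      successively adj (a # ws @ [b]); distinct (a # ws @ [b]); ws \<noteq> [];
      set us \<inter> set vs = {}; set us \<inter> set ws = {}; set vs \<inter> set ws = {}\<rbrakk> \<Longrightarrow> False"
    and no_crossing:
    "\<lbrakk>successively adj (a # us @ [b]); distinct (a # us @ [b]);
      successively adj (a # vs @ [b]); distinct (a # vs @ [b]);
      set us \<inter> set vs = {}; adj a b; x \<in> set us; y \<in> set vs\<rbrakk> \<Longrightarrow> \<not> adj x y"
begin

section \<open>Cycles and ears\<close>

definition cycle :: "'a list \<Rightarrow> bool" where
  "cycle xs \<longleftrightarrow> length xs \<ge> 3 \<and> distinct xs \<and> successively adj xs \<and> adj (last xs) (hd xs)"

lemma successively_rev_adj: "successively adj (rev xs) \<longleftrightarrow> successively adj xs"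
  unfolding successively_rev by (rule successively_cong) (auto intro: adj_sym)

lemma cycle_rotate: "cycle xs \<Longrightarrow> cycle (rotate k xs)"
proof (induction k)
  case (Suc k)
  then obtain x ys where xs: "rotate k xs = x # ys" "cycle (x # ys)"
    by (cases "rotate k xs") (auto simp: cycle_def)
  then have "ys \<noteq> []" by (auto simp: cycle_def)
  then have "cycle (ys @ [x])" using xs(2)
    by (auto simp: cycle_def successively_append_iff successively_Cons)
  then show ?case using xs by simp
qed simp

lemma cycle_through:
  assumes "cycle xs" "c \<in> set xs"
  obtains ys where "cycle (c # ys)" "set (c # ys) = set xs"
proof -
  obtain as bs where xs: "xs = as @ c # bs" using assms(2) by (meson split_list)
  then have "rotate (length as) xs = c # bs @ as" by (simp add: rotate_append)
  then show ?thesis using that[of "bs @ as"] cycle_rotate[OF assms(1), of "length as"] xs by auto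
qed

lemma cycle_two_paths:
  assumes "cycle (c # as @ d # bs)"
  shows "successively adj (c # as @ [d])" "distinct (c # as @ [d])"
    "successively adj (c # rev bs @ [d])" "distinct (c # rev bs @ [d])" "set as \<inter> set (rev bs) = {}"
proof -
  have s: "successively adj (c # as @ [d])" "successively adj (d # bs)"
    using assms successively_split[of adj "c # as" d bs] by (auto simp: cycle_def)
  then show "successively adj (c # as @ [d])" by simp
  have "successively adj (d # bs @ [c])"
    using s(2) assms successively_append_iff[of adj "d # bs" "[c]"] by (auto simp: cycle_def)
  then show "successively adj (c # rev bs @ [d])" using successively_rev_adj[of "d # bs @ [c]"] by simp
qed (use assms in \<open>auto simp: cycle_def\<close>)

text \<open>A vertex \<open>u\<close> has two neighbours in \<open>B\<close>, because deleting one
  of them leaves \<open>u\<close> connected to a third vertex. A path between the two in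
  \<open>B - {u}\<close> closes up to a cycle.\<close>

lemma nonsep_has_cycle:
  assumes B: "nonsep B" and card: "card B \<ge> 3"
  shows "\<exists>xs. cycle xs \<and> set xs \<subseteq> B"
proof -
  have fin: "finite B" using B finite_V finite_subset unfolding nonsep_def by blast
  obtain u where u: "u \<in> B" using B unfolding nonsep_def by blast
  have nbr: "\<exists>v\<in>B. adj u v \<and> v \<noteq> w" if w: "w \<noteq> u" for w
  proof -
    have "\<not> B \<subseteq> {u, w}" using card card_mono[of "{u, w}" B] card_insert_le_m1[of 2 "{w}" u] by auto
    then obtain z where z: "z \<in> B" "z \<noteq> u" "z \<noteq> w" by blast
    have "joined (B - {w}) u z" using B u w z unfolding nonsep_def conn_def by blast
    then show ?thesis using rtranclp_leaves_set[of _ u z "{u}"] z unfolding joined_def by blast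
  qed
  obtain z where "z \<in> B" "z \<noteq> u" using card u fin
    by (metis card_le_Suc0_iff_eq numeral_3_eq_3 not_less_eq_eq le_SucI)
  from nbr[OF this(2)] obtain v where v: "v \<in> B" "adj u v" by blast
  then have "v \<noteq> u" using adj_irrefl by blast
  from nbr[OF this] obtain v' where v': "v' \<in> B" "adj u v'" "v' \<noteq> v" by blast
  have "joined (B - {u}) v v'"
    using B v v' adj_irrefl unfolding nonsep_def conn_def by blast
  from rtranclp_first_hit[OF this[unfolded joined_def], of "{v'}"] v'
  obtain qs where q: "qs \<noteq> []" "hd qs = v" "distinct qs" "v' \<notin> set qs"
    "successively (\<lambda>x y. adj x y \<and> x \<in> B - {u} \<and> y \<in> B - {u}) (qs @ [v'])" by auto
  have s: "successively adj (qs @ [v'])" by (rule successively_mono[OF q(5)]) auto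
  have sub: "set qs \<subseteq> B - {u}"
    using q(5) by (induction qs) (auto simp: successively_Cons split: if_splits)
  have "cycle (u # qs @ [v'])"
    using q s sub v v' \<open>v \<noteq> u\<close> adj_irrefl adj_sym
    by (cases qs) (auto simp: cycle_def successively_Cons)
  then show ?thesis using sub u v' by (intro exI[of _ "u # qs @ [v']"]) auto
qed

text \<open>Some edge leaves the cycle at a vertex \<open>c\<close>. Deleting \<open>c\<close> does
  not disconnect \<open>B\<close>, so a path from the other end of this edge returns to the cycle at
  a vertex \<open>d\<close> different from \<open>c\<close>.\<close>

lemma ear_of_cycle:
  assumes B: "nonsep B" and xs: "cycle xs" "set xs \<subset> B"
  obtains c as d bs qs where "cycle (c # as @ d # bs)" "set (c # as @ d # bs) = set xs"
    "successively adj (c # qs @ [d])" "distinct qs" "qs \<noteq> []" "set qs \<subseteq> B" "set qs \<inter> set xs = {}"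
proof -
  obtain x where x: "x \<in> B" "x \<notin> set xs" using xs by blast
  have ne: "hd xs \<in> set xs" "last xs \<in> set xs" "hd xs \<noteq> last xs"
    using xs by (cases xs; auto simp: cycle_def; fail)+
  have "joined B (hd xs) x" using B x xs ne unfolding nonsep_def conn_def by blast
  then obtain c y where c: "c \<in> set xs" "y \<notin> set xs" "adj c y" "y \<in> B"
    using rtranclp_leaves_set[of _ "hd xs" x "set xs"] ne x unfolding joined_def by blast
  obtain d0 where d0: "d0 \<in> set xs" "d0 \<noteq> c" using ne by metis
  have "joined (B - {c}) y d0" using B c d0 xs unfolding nonsep_def conn_def by blast
  from rtranclp_first_hit[OF this[unfolded joined_def], of "set xs"] c d0
  obtain qs d where q: "qs \<noteq> []" "hd qs = y" "distinct qs" "d \<in> set xs" "set qs \<inter> set xs = {}"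
    "successively (\<lambda>x y. adj x y \<and> x \<in> B - {c} \<and> y \<in> B - {c}) (qs @ [d])" by blast
  have s: "successively adj (qs @ [d])" by (rule successively_mono[OF q(6)]) auto
  have sub: "set qs \<subseteq> B"
    using q(6) by (induction qs) (auto simp: successively_Cons split: if_splits)
  have dc: "d \<noteq> c"
    using q(6,1) by (cases qs rule: rev_cases) (auto simp: successively_append_iff)
  obtain ys where ys: "cycle (c # ys)" "set (c # ys) = set xs" using cycle_through[OF xs(1) c(1)] .
  then obtain as bs where "ys = as @ d # bs" using q(4) dc by (metis set_ConsD split_list)
  moreover have "successively adj (c # qs @ [d])" using s q c by (cases qs) auto
  ultimately show ?thesis using that[of c as d bs qs] ys q sub by auto
qed

text \<open>A longest cycle has no ear: an ear between consecutive vertices would lengthen the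
  cycle, and any other ear would form, with the two arcs of the cycle, three internally disjoint
  paths with inner vertices.\<close>

lemma block_hamiltonian:
  assumes B: "nonsep B" and card: "card B \<ge> 3"
  shows "\<exists>xs. cycle xs \<and> set xs = B"
proof -
  have fin: "finite B" using B finite_V finite_subset unfolding nonsep_def by blast
  let ?P = "\<lambda>xs. cycle xs \<and> set xs \<subseteq> B"
  have bound: "\<forall>xs. ?P xs \<longrightarrow> length xs \<le> card B"
    using fin by (auto simp: cycle_def distinct_card[symmetric] intro: card_mono)
  obtain xs where xs: "?P xs" and max: "\<And>ys. ?P ys \<Longrightarrow> length ys \<le> length xs"
    using ex_has_greatest_nat[of ?P _ length "Suc (card B)"] nonsep_has_cycle[OF assms] bound
    by (metis (no_types, lifting) less_Suc_eq_le)
  have "set xs = B"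
  proof (rule ccontr)
    assume "set xs \<noteq> B"
    then have "set xs \<subset> B" using xs by blast
    with ear_of_cycle[OF B] xs obtain c as d bs qs where
      e: "cycle (c # as @ d # bs)" "set (c # as @ d # bs) = set xs"
      "successively adj (c # qs @ [d])" "distinct qs" "qs \<noteq> []" "set qs \<subseteq> B" "set qs \<inter> set xs = {}" by blast
    note p = cycle_two_paths[OF e(1)]
    have len: "length xs = Suc (Suc (length as + length bs))"
      using e(1,2) xs distinct_card[of xs] distinct_card[of "c # as @ d # bs"] by (simp add: cycle_def)
    have dq: "distinct (c # qs @ [d])" "set as \<inter> set qs = {}" "set bs \<inter> set qs = {}"
      using e p(2) by auto
    consider "as = []" | "bs = []" | "as \<noteq> []" "bs \<noteq> []" by blast
    then show False
    proof cases
      case 1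
      have "successively adj ((c # qs) @ d # bs)"
        using e(1,3) successively_split[of adj "c # qs" d bs] 1 by (auto simp: cycle_def)
      then have "cycle (c # qs @ d # bs)" using e dq 1 by (auto simp: cycle_def)
      moreover have "set (c # qs @ d # bs) \<subseteq> B" using e xs by auto
      ultimately show False using max[of "c # qs @ d # bs"] len 1 e(5) by simp
    next
      case 2
      have r: "successively adj (d # rev qs @ [c])" using successively_rev_adj[of "c # qs @ [d]"] e(3) by simp
      then have "successively adj (d # rev qs)" "adj (hd qs) c"
        using e(5) successively_append_iff[of adj "d # rev qs" "[c]"] by (auto simp: last_rev)
      moreover have "distinct (c # as @ d # rev qs)" using p(2) dq e(4) by auto
      moreover have "length qs \<ge> 1" using e(5) by (cases qs) auto
      ultimately have "cycle (c # as @ d # rev qs)"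
        using p(1) e(5) successively_split[of adj "c # as" d "rev qs"]
        unfolding cycle_def by (simp add: last_rev)
      moreover have "set (c # as @ d # rev qs) \<subseteq> B" using e xs by auto
      ultimately show False using max[of "c # as @ d # rev qs"] len 2 e(5) by simp
    next
      case 3
      then show False
        using no_theta[where a = c and us = as and b = d and vs = "rev bs" and ws = qs]
          p e(3,5) dq by simp
    qed
  qed
  then show ?thesis using xs by blast
qed

text \<open>Since chords of a Hamilton cycle do not cross, its edges are recognised inside the block
  without reference to the cycle.\<close>

definition rim_edge :: "'a set \<Rightarrow> 'a \<Rightarrow> 'a \<Rightarrow> bool" where
  "rim_edge B x y \<longleftrightarrow> x \<in> B \<and> y \<in> B \<and> adj x y \<and> conn (B - {x, y})"

text \<open>Deleting two consecutive vertices of the cycle leaves a path. Deleting the ends of a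
  chord leaves two nonempty arcs, and an edge between them would cross the chord.\<close>

lemma rim_edge_iff_neighbour:
  assumes c: "cycle (x # ys)"
  shows "rim_edge (set (x # ys)) x y \<longleftrightarrow> y = hd ys \<or> y = last ys"
proof
  assume r: "rim_edge (set (x # ys)) x y"
  then have "y \<in> set ys" using adj_irrefl by (auto simp: rim_edge_def)
  then obtain as bs where ys: "ys = as @ y # bs" by (meson split_list)
  note p = cycle_two_paths[OF c[unfolded ys]]
  have "as = [] \<or> bs = []"
  proof (rule ccontr)
    assume "\<not> ?thesis"
    then have ne: "hd as \<in> set as" "hd bs \<in> set bs" by auto
    have eq: "set (x # ys) - {x, y} = set as \<union> set bs" using c ys by (auto simp: cycle_def)
    then have "joined (set as \<union> set bs) (hd as) (hd bs)"
      using r ne unfolding rim_edge_def conn_def by auto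
    moreover have "hd bs \<notin> set as" using p(5) ne by auto
    ultimately obtain u v where "u \<in> set as" "v \<in> set bs" "adj u v"
      using rtranclp_leaves_set[of _ "hd as" "hd bs" "set as"] ne unfolding joined_def by blast
    then show False using no_crossing[OF p, of u v] r by (auto simp: rim_edge_def)
  qed
  then show "y = hd ys \<or> y = last ys" using ys by auto
next
  have s: "length ys \<ge> 2" "successively adj (x # ys)" "adj (last ys) x" "distinct (x # ys)"
    using c by (auto simp: cycle_def split: if_splits)
  assume "y = hd ys \<or> y = last ys"
  then show "rim_edge (set (x # ys)) x y"
  proof
    assume "y = hd ys"
    then obtain zs where ys: "ys = y # zs" using s(1) by (cases ys) auto
    have "set (x # ys) - {x, y} = set zs" "successively adj zs" using s ys by (auto simp: successively_Cons)
    then show ?thesis using conn_path[of zs] s ys by (auto simp: rim_edge_def)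
  next
    assume "y = last ys"
    then obtain zs where ys: "ys = zs @ [y]" using s(1) by (cases ys rule: rev_cases) auto
    have "set (x # ys) - {x, y} = set zs" "successively adj zs"
      using s ys by (auto simp: successively_Cons successively_append_iff)
    then show ?thesis using conn_path[of zs] s ys adj_sym by (auto simp: rim_edge_def)
  qed
qed

lemma rim_edge_nth:
  assumes c: "cycle ws" and i: "i < length ws"
  shows "rim_edge (set ws) (ws ! i) y \<longleftrightarrow>
    y = ws ! ((i + 1) mod length ws) \<or> y = ws ! ((i + (length ws - 1)) mod length ws)"
proof -
  let ?r = "rotate i ws"
  have len: "length ws \<ge> 3" using c by (simp add: cycle_def)
  obtain x ys where r: "?r = x # ys" using len by (cases ?r) auto
  have l: "length ys = length ws - 1" using arg_cong[OF r, of length] by simp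
  have nth: "(x # ys) ! j = ws ! ((i + j) mod length ws)" if "j < length ws" for j
    using nth_rotate[of j ws i] that r by simp
  have "x = ws ! i" using nth[of 0] i by (cases ws) auto
  moreover have "hd ys = ws ! ((i + 1) mod length ws)" using nth[of 1] l len by (cases ys) auto
  moreover have "last ys = ws ! ((i + (length ws - 1)) mod length ws)"
  proof -
    have "last ys = last (x # ys)" using l len by auto
    also have "\<dots> = (x # ys) ! (length ws - 1)" using last_conv_nth[of "x # ys"] l by simp
    also have "\<dots> = ws ! ((i + (length ws - 1)) mod length ws)" by (rule nth) (use len in simp)
    finally show ?thesis .
  qed
  moreover have "set (x # ys) = set ws" using r by (metis set_rotate)
  ultimately show ?thesis using rim_edge_iff_neighbour[of x ys y] cycle_rotate[OF c, of i] r by metis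
qed

text \<open>The image of \<open>ws ! (i + 2)\<close> is a rim neighbour of the image of
  \<open>ws ! (i + 1)\<close> and, by injectivity, not the image of \<open>ws ! i\<close>. So the
  map is determined by its value at \<open>ws ! 1\<close>, for which there are two choices.\<close>

lemma fixing_rim_vertex:
  assumes c: "cycle ws"
    and rim: "\<And>x y. rim_edge (set ws) x y \<Longrightarrow> rim_edge (set ws) (f x) (f y)"
    and inj: "inj_on f (set ws)" and f0: "f (ws ! 0) = ws ! 0"
  shows "(\<forall>i<length ws. f (ws ! i) = ws ! i) \<or>
    (\<forall>i<length ws. f (ws ! i) = ws ! ((length ws - i) mod length ws))"
proof -
  let ?n = "length ws"
  have n: "?n \<ge> 3" and d: "distinct ws" using c by (auto simp: cycle_def)
  have nx: "rim_edge (set ws) (ws ! i) (ws ! (i + 1))" if "i + 1 < ?n" for i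
    using rim_edge_nth[OF c, of i] that by auto
  have inj': "f (ws ! i) \<noteq> f (ws ! j)" if "i < ?n" "j < ?n" "i \<noteq> j" for i j
    using inj d that by (metis inj_onD nth_eq_iff_index_eq nth_mem)
  have step: "f (ws ! (i + 2)) = ws ! ((k + 1) mod ?n) \<or> f (ws ! (i + 2)) = ws ! ((k + (?n - 1)) mod ?n)"
    if "i + 2 < ?n" "f (ws ! (i + 1)) = ws ! k" "k < ?n" for i k
    using rim[OF nx[of "i + 1"]] that rim_edge_nth[OF c that(3)] by (simp add: numeral_2_eq_2)
  have "f (ws ! 1) = ws ! 1 \<or> f (ws ! 1) = ws ! (?n - 1)"
  proof -
    have "0 < ?n" "(0 + 1) mod ?n = 1" "(0 + (?n - 1)) mod ?n = ?n - 1" using n by auto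
    then show ?thesis using rim[OF nx[of 0]] f0 rim_edge_nth[OF c, of 0] n by simp
  qed
  then show ?thesis
  proof
    assume f1: "f (ws ! 1) = ws ! 1"
    have "f (ws ! i) = ws ! i" if "i < ?n" for i
      using that
    proof (induction i rule: less_induct)
      case (less i)
      show ?case
      proof (cases "i < 2")
        case True
        then show ?thesis using f0 f1 by (auto simp: less_2_cases_iff)
      next
        case False
        then obtain j where j: "i = j + 2" by (metis add.commute le_Suc_ex not_less)
        \<comment> \<open>\<open>?n - 1\<close> stands for \<open>-1\<close> modulo
          \<open>?n\<close>: the neighbour of position \<open>j + 1\<close> excluded by injectivity
          is position \<open>j\<close>.\<close>
        have "j + 1 + (?n - 1) = j + ?n" using n by simp
        then have "(j + 1 + (?n - 1)) mod ?n = j" using less.prems j by simp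
        then have "f (ws ! i) \<noteq> ws ! ((j + 1 + (?n - 1)) mod ?n)"
          using less.IH[of j] inj'[of i j] less.prems j by auto
        then show ?thesis using step[of j "j + 1"] less.IH[of "j + 1"] less.prems j by auto
      qed
    qed
    then show ?thesis by blast
  next
    assume f1: "f (ws ! 1) = ws ! (?n - 1)"
    have "f (ws ! i) = ws ! ((?n - i) mod ?n)" if "i < ?n" for i
      using that
    proof (induction i rule: less_induct)
      case (less i)
      show ?case
      proof (cases "i < 2")
        case True
        then show ?thesis using f0 f1 n by (auto simp: less_2_cases_iff)
      next
        case False
        then obtain j where j: "i = j + 2" by (metis add.commute le_Suc_ex not_less)
        let ?k = "?n - (j + 1)"
        have k: "f (ws ! (j + 1)) = ws ! ?k" "?k < ?n" using less.IH[of "j + 1"] less.prems j by auto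
        \<comment> \<open>Positions now run backwards, so the neighbour excluded by injectivity is
          the successor of \<open>?k\<close>.\<close>
        have "(?k + 1) mod ?n = (?n - j) mod ?n" using less.prems j by (simp add: Suc_diff_Suc)
        then have "f (ws ! i) \<noteq> ws ! ((?k + 1) mod ?n)"
          using less.IH[of j] inj'[of i j] less.prems j by auto
        moreover have "(?k + (?n - 1)) mod ?n = (?n - i) mod ?n"
        proof -
          have "?k + (?n - 1) = (?n - i) + ?n" using less.prems j n by linarith
          then show ?thesis by simp
        qed
        ultimately show ?thesis using step[of j ?k] k less.prems j by auto
      qed
    qed
    then show ?thesis by blast
  qed
qed

end

section \<open>Automorphisms and elimination\<close>

context simple_graph begin

text \<open>Encoded as a permutation that is the identity off \<open>V\<close>, so that composition
  and inverse are the ordinary ones; \<open>automorphisms_iff\<close> later relates this to the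
  extensional maps in \<open>automorphisms\<close>.\<close>

definition aut :: "('a \<Rightarrow> 'a) \<Rightarrow> bool" where
  "aut \<phi> \<longleftrightarrow> \<phi> permutes V \<and> (\<forall>u v. adj (\<phi> u) (\<phi> v) \<longleftrightarrow> adj u v)"

definition moved :: "('a \<Rightarrow> 'a) \<Rightarrow> 'a set" where
  "moved \<phi> = {v. \<phi> v \<noteq> v}"

lemma aut_adj: "aut \<phi> \<Longrightarrow> adj (\<phi> u) (\<phi> v) \<longleftrightarrow> adj u v"
  unfolding aut_def by blast

lemma aut_permutes: "aut \<phi> \<Longrightarrow> \<phi> permutes V"
  unfolding aut_def by blast

lemma aut_inj: "aut \<phi> \<Longrightarrow> inj \<phi>"
  using aut_permutes permutes_inj by blast

lemma aut_eq_iff: "aut \<phi> \<Longrightarrow> \<phi> x = \<phi> y \<longleftrightarrow> x = y"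
  using aut_inj by (auto dest: injD)

lemma aut_V: "aut \<phi> \<Longrightarrow> \<phi> x \<in> V \<longleftrightarrow> x \<in> V"
  using aut_permutes permutes_in_image by metis

lemma aut_id: "aut id"
  unfolding aut_def by (simp add: permutes_id)

lemma aut_comp: "aut \<phi> \<Longrightarrow> aut \<psi> \<Longrightarrow> aut (\<phi> \<circ> \<psi>)"
  unfolding aut_def by (simp add: permutes_compose)

lemma aut_inv_simps:
  assumes "aut \<phi>"
  shows "\<phi> (Hilbert_Choice.inv \<phi> x) = x" "Hilbert_Choice.inv \<phi> (\<phi> x) = x"
  using permutes_inverses[OF aut_permutes[OF assms]] by auto

lemma aut_inv: "aut \<phi> \<Longrightarrow> aut (Hilbert_Choice.inv \<phi>)"
  using aut_adj[of \<phi>] aut_inv_simps[of \<phi>] permutes_inv aut_permutes unfolding aut_def by metis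

lemma moved_subset: "aut \<phi> \<Longrightarrow> moved \<phi> \<subseteq> V"
  using aut_permutes permutes_not_in unfolding moved_def by fastforce

lemma moved_empty_iff: "moved \<phi> = {} \<longleftrightarrow> \<phi> = id"
  unfolding moved_def by auto

lemma aut_joined:
  assumes "aut \<phi>" "joined X x y"
  shows "joined (\<phi> ` X) (\<phi> x) (\<phi> y)"
  using assms(2) unfolding joined_def
proof (induction rule: rtranclp_induct)
  case (step y z)
  then have "adj (\<phi> y) (\<phi> z) \<and> \<phi> y \<in> \<phi> ` X \<and> \<phi> z \<in> \<phi> ` X" using aut_adj[OF assms(1)] by blast
  with step.IH show ?case by (rule rtranclp.rtrancl_into_rtrancl)
qed simp

lemma aut_conn: "aut \<phi> \<Longrightarrow> conn X \<Longrightarrow> conn (\<phi> ` X)"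
  unfolding conn_def using aut_joined by blast

lemma aut_nonsep:
  assumes "aut \<phi>" "nonsep X"
  shows "nonsep (\<phi> ` X)"
proof -
  have "conn (\<phi> ` X - {v})" for v
  proof -
    have "\<phi> ` X - {v} = \<phi> ` (X - {Hilbert_Choice.inv \<phi> v})"
      using aut_inv_simps[OF assms(1)] aut_eq_iff[OF assms(1)] by (auto simp: image_iff)
    then show ?thesis using assms aut_conn unfolding nonsep_def by simp
  qed
  then show ?thesis using assms aut_conn aut_V unfolding nonsep_def by auto
qed

lemma aut_block:
  assumes "aut \<phi>" "block B"
  shows "block (\<phi> ` B)"
  unfolding block_def
proof (intro conjI allI impI)
  show "nonsep (\<phi> ` B)" using aut_nonsep assms block_nonsep by blast
  fix Y assume Y: "nonsep Y" "\<phi> ` B \<subseteq> Y"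
  have "B \<subseteq> Hilbert_Choice.inv \<phi> ` Y" using Y(2) aut_inv_simps(2)[OF assms(1)]
    by (metis image_eqI image_subset_iff subsetI)
  then have "Hilbert_Choice.inv \<phi> ` Y = B" using block_maximal[OF assms(2)] aut_nonsep[OF aut_inv[OF assms(1)] Y(1)] by blast
  then show "Y = \<phi> ` B" using aut_inv_simps(1)[OF assms(1)] by (force simp: image_image)
qed

lemma aut_out:
  assumes "aut \<phi>" "out B x y"
  shows "out (\<phi> ` B) (\<phi> x) (\<phi> y)"
  using assms(2) unfolding out_def
proof (induction rule: rtranclp_induct)
  case (step y z)
  then have "adj (\<phi> y) (\<phi> z) \<and> \<not> (\<phi> y \<in> \<phi> ` B \<and> \<phi> z \<in> \<phi> ` B)"
    using aut_adj[OF assms(1)] inj_image_mem_iff[OF aut_inj[OF assms(1)]] by simp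
  with step.IH show ?case by (rule rtranclp.rtrancl_into_rtrancl)
qed simp

text \<open>This condition permits local surgery: an automorphism fixing \<open>a\<close> can be cut
  down to \<open>K\<close> if \<open>K\<close> is invariant (\<open>restr\<close>), or turned into
  an exchange of \<open>K\<close> with its image if the two are disjoint
  (\<open>swap\<close>).\<close>

definition attached :: "'a set \<Rightarrow> 'a \<Rightarrow> bool" where
  "attached K a \<longleftrightarrow> K \<subseteq> V \<and> (\<forall>x\<in>K. \<forall>y. adj x y \<longrightarrow> y \<in> K \<or> y = a)"

definition restr :: "('a \<Rightarrow> 'a) \<Rightarrow> 'a set \<Rightarrow> 'a \<Rightarrow> 'a" where
  "restr \<phi> K = (\<lambda>x. if x \<in> K then \<phi> x else x)"

definition swap :: "('a \<Rightarrow> 'a) \<Rightarrow> 'a set \<Rightarrow> 'a \<Rightarrow> 'a" where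
  "swap \<phi> K = (\<lambda>x. if x \<in> K then \<phi> x else if x \<in> \<phi> ` K then Hilbert_Choice.inv \<phi> x else x)"

lemma aut_restr:
  assumes "aut \<phi>" "attached K a" "\<phi> ` K = K" "\<phi> a = a"
  shows "aut (restr \<phi> K)"
proof -
  have "bij_betw (restr \<phi> K) K K"
    using assms(3) inj_on_subset[OF aut_inj[OF assms(1)], of K]
    by (auto simp: bij_betw_def restr_def inj_on_def)
  then have "restr \<phi> K permutes K" by (rule bij_imp_permutes) (simp add: restr_def)
  then have "restr \<phi> K permutes V" using assms(2) permutes_subset unfolding attached_def by blast
  moreover have "adj (restr \<phi> K u) (restr \<phi> K v) \<longleftrightarrow> adj u v" for u v
  proof -
    have one: "adj (\<phi> u) v \<longleftrightarrow> adj u v" if "u \<in> K" "v \<notin> K" for u v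
    proof -
      have "\<phi> u \<in> K" using that assms(3) by blast
      then have "adj (\<phi> u) v \<longleftrightarrow> v = a \<and> adj (\<phi> u) (\<phi> a)"
        using that assms(2,4) unfolding attached_def by auto
      also have "\<dots> \<longleftrightarrow> adj u v"
        using aut_adj[OF assms(1)] that assms(2) unfolding attached_def by auto
      finally show ?thesis .
    qed
    show ?thesis
      using one[of u v] one[of v u] aut_adj[OF assms(1)] adj_sym unfolding restr_def by auto
  qed
  ultimately show ?thesis unfolding aut_def by blast
qed

lemma swap_props:
  assumes "aut \<phi>" "attached K a" "\<phi> ` K \<inter> K = {}" "\<phi> a = a" "a \<notin> K"
  shows "aut (swap \<phi> K)" "swap \<phi> K (swap \<phi> K x) = x" "moved (swap \<phi> K) = K \<union> \<phi> ` K"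
proof -
  let ?s = "swap \<phi> K"
  note inv = aut_inv_simps[OF assms(1)]
  have sK: "?s x = \<phi> x" if "x \<in> K" for x using that by (simp add: swap_def)
  have sL: "?s (\<phi> x) = x" if "x \<in> K" for x
  proof -
    have "\<phi> x \<notin> K" using that assms(3) by blast
    then show ?thesis using that inv by (simp add: swap_def)
  qed
  have sO: "?s x = x" if "x \<notin> K" "x \<notin> \<phi> ` K" for x using that by (simp add: swap_def)
  show inv2: "?s (?s x) = x" for x
  proof -
    consider "x \<in> K" | y where "y \<in> K" "x = \<phi> y" | "x \<notin> K" "x \<notin> \<phi> ` K" by blast
    then show ?thesis by cases (simp_all add: sK sL sO)
  qed
  have KV: "K \<subseteq> V" "\<phi> ` K \<subseteq> V" using assms(2) aut_V[OF assms(1)] unfolding attached_def by auto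
  have "?s x = x" if "x \<notin> V" for x using that KV sO by blast
  moreover have "\<exists>!x. ?s x = y" for y using inv2 by metis
  ultimately have perm: "?s permutes V" unfolding permutes_def by blast
  have aO: "?s a = a"
    using assms(4,5) inj_image_mem_iff[OF aut_inj[OF assms(1)], of a K] sO[of a] by simp
  have one: "adj (?s u) (?s v)" if uv: "adj u v" and u: "u \<in> K \<or> u \<in> \<phi> ` K" for u v
  proof (cases "u \<in> K")
    case True
    then have "v \<in> K \<or> v = a" using uv assms(2) unfolding attached_def by blast
    then show ?thesis using sK[OF True] sK[of v] aO assms(4) uv aut_adj[OF assms(1)] by metis
  next
    case False
    then obtain u' where u': "u' \<in> K" "u = \<phi> u'" using u by blast
    then have "adj u' (Hilbert_Choice.inv \<phi> v)" using uv inv aut_adj[OF assms(1)] by metis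
    then have "Hilbert_Choice.inv \<phi> v \<in> K \<or> Hilbert_Choice.inv \<phi> v = a" using u' assms(2) unfolding attached_def by blast
    then have "?s v = Hilbert_Choice.inv \<phi> v" using sL[of "Hilbert_Choice.inv \<phi> v"] inv aO assms(4) by metis
    then show ?thesis using sL[OF u'(1)] u' \<open>adj u' (Hilbert_Choice.inv \<phi> v)\<close> by simp
  qed
  have two: "adj (?s u) (?s v)" if "adj u v" for u v
  proof (cases "u \<in> K \<or> u \<in> \<phi> ` K")
    case True
    then show ?thesis using one that by blast
  next
    case u: False
    show ?thesis
    proof (cases "v \<in> K \<or> v \<in> \<phi> ` K")
      case True
      then show ?thesis using one[of v u] that adj_sym by blast
    next
      case False
      then show ?thesis using u sO that by simp
    qed
  qed
  have "adj (?s u) (?s v) \<longleftrightarrow> adj u v" for u v using two[of u v] two[of "?s u" "?s v"] inv2 by auto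
  then show "aut ?s" using perm unfolding aut_def by blast
  have "x \<in> moved ?s" if "x \<in> K \<union> \<phi> ` K" for x
    using that sK sL assms(3) unfolding moved_def by fastforce
  then show "moved ?s = K \<union> \<phi> ` K" using sO unfolding moved_def by auto
qed

lemma moved_image:
  assumes "\<phi> ` K \<inter> K = {}"
  shows "K \<subseteq> moved \<phi>"
  using assms unfolding moved_def by force

definition minaut :: "('a \<Rightarrow> 'a) \<Rightarrow> bool" where
  "minaut \<phi> \<longleftrightarrow> aut \<phi> \<and> \<phi> \<noteq> id \<and>
     (\<forall>\<psi>. aut \<psi> \<longrightarrow> \<psi> \<noteq> id \<longrightarrow> moved \<psi> \<subseteq> moved \<phi> \<longrightarrow> moved \<psi> = moved \<phi>)"

lemma minautD:
  assumes "minaut \<phi>"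
  shows "aut \<phi>" "\<phi> \<noteq> id" "aut \<psi> \<Longrightarrow> \<psi> \<noteq> id \<Longrightarrow> moved \<psi> \<subseteq> moved \<phi> \<Longrightarrow> moved \<psi> = moved \<phi>"
  using assms unfolding minaut_def by blast+

text \<open>\<open>restr \<phi> K\<close> still moves \<open>e\<close> and moves nothing that
  \<open>\<phi>\<close> fixes, so by minimality it moves everything that \<open>\<phi>\<close>
  moves.\<close>

lemma minaut_moved_subset:
  assumes "minaut \<phi>" "attached K a" "\<phi> ` K = K" "\<phi> a = a" "e \<in> K" "e \<in> moved \<phi>"
  shows "moved \<phi> \<subseteq> K"
proof -
  have "aut (restr \<phi> K)" using aut_restr assms minautD(1) by blast
  moreover have "restr \<phi> K e \<noteq> e" using assms(5,6) by (simp add: restr_def moved_def)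
  then have "restr \<phi> K \<noteq> id" by auto
  moreover have "moved (restr \<phi> K) \<subseteq> moved \<phi>" by (auto simp: restr_def moved_def)
  ultimately have "moved (restr \<phi> K) = moved \<phi>" using minautD(3)[OF assms(1)] by blast
  moreover have "moved (restr \<phi> K) \<subseteq> K" by (auto simp: restr_def moved_def)
  ultimately show ?thesis by simp
qed

lemma exists_minaut:
  assumes "aut \<phi>" "\<phi> \<noteq> id"
  shows "\<exists>\<psi>. minaut \<psi> \<and> moved \<psi> \<subseteq> moved \<phi>"
  using assms
proof (induction "card (moved \<phi>)" arbitrary: \<phi> rule: less_induct)
  case less
  show ?case
  proof (cases "minaut \<phi>")
    case False
    then obtain \<psi> where p: "aut \<psi>" "\<psi> \<noteq> id" "moved \<psi> \<subset> moved \<phi>" using less.prems unfolding minaut_def by blast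
    have "finite (moved \<phi>)" using moved_subset[OF less.prems(1)] finite_V finite_subset by blast
    then have "card (moved \<psi>) < card (moved \<phi>)" using p(3) psubset_card_mono by blast
    then show ?thesis using less.hyps p by blast
  qed blast
qed

end

section \<open>Automorphisms acting on the branches of a block\<close>

context connected_graph begin

text \<open>For \<open>a\<close> in \<open>B\<close> this is what is seen from \<open>a\<close>
  through \<open>B\<close>: the complement of the branch at \<open>a\<close>.\<close>

definition beyond :: "'a set \<Rightarrow> 'a \<Rightarrow> 'a set" where
  "beyond B a = {x \<in> V. root B x \<noteq> a}"

definition branch :: "'a set \<Rightarrow> 'a \<Rightarrow> 'a set" where
  "branch B b = {x \<in> V. root B x = b}"

lemma attached_beyond:
  assumes "block B" "a \<in> B"
  shows "attached (beyond B a) a"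
  unfolding attached_def
proof (intro conjI ballI allI impI)
  fix x y assume x: "x \<in> beyond B a" and xy: "adj x y"
  have "y \<in> V" using xy adj_V by blast
  moreover have "root B y \<noteq> a \<or> y = a"
    using root_adj[OF assms(1) xy] root_id[OF assms(1), of y] x unfolding beyond_def by auto
  ultimately show "y \<in> beyond B a \<or> y = a" unfolding beyond_def by blast
qed (auto simp: beyond_def)

lemma attached_branch:
  assumes "block B" "b \<in> B"
  shows "attached (branch B b - {b}) b"
  unfolding attached_def
proof (intro conjI ballI allI impI)
  fix x y assume x: "x \<in> branch B b - {b}" and xy: "adj x y"
  have "y \<in> V" using xy adj_V by blast
  moreover have "root B y = b"
    using root_adj[OF assms(1) xy] root_id[OF assms(1), of x] x unfolding branch_def by auto
  ultimately show "y \<in> branch B b - {b} \<or> y = b" unfolding branch_def by blast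
qed (auto simp: branch_def)

lemma aut_root:
  assumes "aut \<phi>" "block B" "x \<in> V"
  shows "root (\<phi> ` B) (\<phi> x) = \<phi> (root B x)"
  using root_eqI[OF aut_block[OF assms(1,2)]] aut_out[OF assms(1) root_props(2)[OF assms(2,3)]]
    root_props(1)[OF assms(2,3)] by blast

lemma aut_beyond:
  assumes "aut \<phi>" "block B"
  shows "\<phi> ` beyond B a = beyond (\<phi> ` B) (\<phi> a)"
proof (intro Set.set_eqI iffI)
  fix y assume y: "y \<in> beyond (\<phi> ` B) (\<phi> a)"
  have "Hilbert_Choice.inv \<phi> y \<in> V" "\<phi> (Hilbert_Choice.inv \<phi> y) = y"
    using y aut_V[OF assms(1), of "Hilbert_Choice.inv \<phi> y"] aut_inv_simps[OF assms(1)] by (auto simp: beyond_def)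
  moreover then have "root B (Hilbert_Choice.inv \<phi> y) \<noteq> a" using y aut_root[OF assms, of "Hilbert_Choice.inv \<phi> y"] by (auto simp: beyond_def)
  ultimately show "y \<in> \<phi> ` beyond B a" unfolding beyond_def by force
next
  fix y assume "y \<in> \<phi> ` beyond B a"
  then show "y \<in> beyond (\<phi> ` B) (\<phi> a)"
    using aut_root[OF assms] aut_V[OF assms(1)] aut_eq_iff[OF assms(1)] by (auto simp: beyond_def)
qed

lemma aut_branch_in:
  assumes "aut \<phi>" "block B" "\<phi> ` B = B" "x \<in> branch B b"
  shows "\<phi> x \<in> branch B (\<phi> b)"
  using aut_root[OF assms(1,2), of x] assms(3,4) aut_V[OF assms(1)] by (auto simp: branch_def)

text \<open>The branch at \<open>b\<close> goes into the branch at \<open>\<phi> b\<close>, which is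
  disjoint from it.\<close>

lemma branch_moved:
  assumes "aut \<phi>" "block B" "\<phi> ` B = B" "\<phi> b \<noteq> b"
  shows "branch B b \<subseteq> moved \<phi>"
  using aut_branch_in[OF assms(1-3)] assms(4) unfolding branch_def moved_def by fastforce

lemma aut_branch:
  assumes "aut \<phi>" "block B" "\<phi> ` B = B" "\<phi> b = b"
  shows "\<phi> ` (branch B b - {b}) = branch B b - {b}"
proof -
  have sub: "\<psi> ` (branch B b - {b}) \<subseteq> branch B b - {b}" if "aut \<psi>" "\<psi> ` B = B" "\<psi> b = b" for \<psi>
    using aut_branch_in[OF that(1) assms(2) that(2), of _ b] aut_eq_iff[OF that(1), of _ b] that(3) by auto
  have "Hilbert_Choice.inv \<phi> ` B = B" "Hilbert_Choice.inv \<phi> b = b"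
    using assms aut_inv_simps[OF assms(1)] by (metis image_inv_f_f aut_inj, metis)
  then have "Hilbert_Choice.inv \<phi> ` (branch B b - {b}) \<subseteq> branch B b - {b}" using sub aut_inv assms by blast
  then have "\<phi> ` Hilbert_Choice.inv \<phi> ` (branch B b - {b}) \<subseteq> \<phi> ` (branch B b - {b})" by blast
  then have "branch B b - {b} \<subseteq> \<phi> ` (branch B b - {b})"
    using aut_inv_simps[OF assms(1)] by (simp add: image_image)
  then show ?thesis using sub[OF assms(1,3,4)] by blast
qed

end

section \<open>Reflections of a block and elimination at a vertex\<close>

context outerplanar_graph begin

lemma aut_rim_edge:
  assumes "aut \<phi>" "\<phi> ` B = B" "rim_edge B x y"
  shows "rim_edge B (\<phi> x) (\<phi> y)"
proof -
  have "\<phi> ` (B - {x, y}) = \<phi> ` B - {\<phi> x, \<phi> y}"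
    by (simp add: image_set_diff[OF aut_inj[OF assms(1)]])
  then have "B - {\<phi> x, \<phi> y} = \<phi> ` (B - {x, y})" using assms(2) by simp
  then show ?thesis
    using assms aut_adj[OF assms(1)] aut_conn[OF assms(1), of "B - {x, y}"] unfolding rim_edge_def by auto
qed

text \<open>The list \<open>ws\<close> is a Hamilton cycle started at \<open>a\<close> and chosen
  before \<open>\<phi>\<close>. All automorphisms in question therefore act by one and the same
  index map, which makes any two of them agree on \<open>B\<close>.\<close>

lemma block_reflection:
  assumes B: "block B" "a \<in> B" "card B \<ge> 3"
  shows "\<exists>ws. cycle ws \<and> set ws = B \<and>
    (\<forall>\<phi>. aut \<phi> \<and> \<phi> ` B = B \<and> \<phi> a = a \<and> (\<exists>b\<in>B. \<phi> b \<noteq> b) \<longrightarrow>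
      (\<forall>i<length ws. \<phi> (ws ! i) = ws ! ((length ws - i) mod length ws)))"
proof -
  obtain xs where xs: "cycle xs" "set xs = B" using block_hamiltonian[OF block_nonsep[OF B(1)] B(3)] by blast
  then obtain ys where ys: "cycle (a # ys)" "set (a # ys) = B" using cycle_through B(2) by metis
  have "\<phi> ((a # ys) ! i) = (a # ys) ! ((length (a # ys) - i) mod length (a # ys))"
    if p: "aut \<phi>" "\<phi> ` B = B" "\<phi> a = a" "\<exists>b\<in>B. \<phi> b \<noteq> b" "i < length (a # ys)" for \<phi> i
  proof -
    have "\<not> (\<forall>i<length (a # ys). \<phi> ((a # ys) ! i) = (a # ys) ! i)"
      using p(4) ys(2) in_set_conv_nth[of _ "a # ys"] by metis
    moreover have "rim_edge (set (a # ys)) (\<phi> x) (\<phi> y)" if "rim_edge (set (a # ys)) x y" for x y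
      using aut_rim_edge[OF p(1,2)] that unfolding ys(2) .
    moreover have "inj_on \<phi> (set (a # ys))" using aut_inj[OF p(1)] by (rule inj_on_subset) simp
    moreover have "\<phi> ((a # ys) ! 0) = (a # ys) ! 0" using p(3) by simp
    ultimately show ?thesis using fixing_rim_vertex[OF ys(1), of \<phi>] p(5) by blast
  qed
  then show ?thesis using ys by blast
qed

lemma card_block_ge_3:
  assumes "block B" "a \<in> B" "aut \<phi>" "\<phi> ` B = B" "\<phi> a = a" "b \<in> B" "\<phi> b \<noteq> b"
  shows "card B \<ge> 3"
proof -
  have "\<phi> b \<noteq> a" "b \<noteq> a" using aut_eq_iff[OF assms(3), of b a] assms by auto
  then have "card {a, b, \<phi> b} = 3" using assms(7) by auto
  moreover have "{a, b, \<phi> b} \<subseteq> B" "finite B"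
    using assms finite_subset[OF block_subset finite_V] by auto
  ultimately show ?thesis using card_mono by metis
qed

lemma reflections_agree:
  assumes "block B" "a \<in> B"
    and "aut \<phi>" "\<phi> ` B = B" "\<phi> a = a" "b \<in> B" "\<phi> b \<noteq> b"
    and "aut \<psi>" "\<psi> ` B = B" "\<psi> a = a" "c \<in> B" "\<psi> c \<noteq> c"
    and "x \<in> B"
  shows "\<phi> x = \<psi> x"
proof -
  obtain ws where ws: "set ws = B"
    "\<forall>\<phi>. aut \<phi> \<and> \<phi> ` B = B \<and> \<phi> a = a \<and> (\<exists>b\<in>B. \<phi> b \<noteq> b) \<longrightarrow>
      (\<forall>i<length ws. \<phi> (ws ! i) = ws ! ((length ws - i) mod length ws))"
    using block_reflection[OF assms(1,2) card_block_ge_3[OF assms(1-7)]] by blast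
  obtain i where "i < length ws" "x = ws ! i" using assms(13) ws(1) by (metis in_set_conv_nth)
  moreover have "\<phi> (ws ! i) = ws ! ((length ws - i) mod length ws)" "\<psi> (ws ! i) = ws ! ((length ws - i) mod length ws)"
    using ws(2) assms \<open>i < length ws\<close> by blast+
  ultimately show ?thesis by simp
qed

text \<open>By minimality each automorphism moves exactly the part \<open>K\<close> beyond
  \<open>B\<close> and the image of \<open>K\<close>. As the moved sets differ, \<open>K\<close> and
  its two images are pairwise disjoint.\<close>

lemma elimination_swap:
  assumes phi: "minaut \<phi>" and psi: "minaut \<psi>" and ne: "moved \<phi> \<noteq> moved \<psi>"
    and B: "block B" "a \<in> B" and fixed: "\<phi> a = a" "\<psi> a = a" and e: "e \<in> beyond B a"
    and nB: "\<phi> ` B \<noteq> B" "\<psi> ` B \<noteq> B"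
  shows "\<exists>\<theta>. aut \<theta> \<and> \<theta> \<noteq> id \<and> moved \<theta> \<subseteq> moved \<phi> \<union> moved \<psi> - {e}"
proof -
  let ?K = "beyond B a"
  have disj: "beyond C a \<inter> beyond C' a = {}" if "block C" "block C'" "a \<in> C" "a \<in> C'" "C \<noteq> C'" for C C'
    using branches_disjoint[OF that(1,2,5,3,4)] unfolding beyond_def by blast
  have ap: "aut \<phi>" and aq: "aut \<psi>" using phi psi minautD by blast+
  have aB: "a \<in> \<phi> ` B" "a \<in> \<psi> ` B" using B fixed by (metis imageI)+
  have K: "\<phi> ` ?K = beyond (\<phi> ` B) a" "\<psi> ` ?K = beyond (\<psi> ` B) a" using aut_beyond ap aq B fixed by metis+
  have d: "\<phi> ` ?K \<inter> ?K = {}" "\<psi> ` ?K \<inter> ?K = {}"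
    using disj[OF aut_block[OF ap B(1)] B(1) aB(1) B(2)] disj[OF aut_block[OF aq B(1)] B(1) aB(2) B(2)] nB K by auto
  have aK: "a \<notin> ?K" using root_id[OF B] unfolding beyond_def by simp
  note sp = swap_props[OF ap attached_beyond[OF B] d(1) fixed(1) aK]
  note sq = swap_props[OF aq attached_beyond[OF B] d(2) fixed(2) aK]
  have "\<eta> ` ?K \<subseteq> moved \<eta>" if "aut \<eta>" "\<eta> ` ?K \<inter> ?K = {}" for \<eta>
    using moved_image[OF that(2)] aut_eq_iff[OF that(1)] unfolding moved_def by auto
  then have sub: "?K \<union> \<phi> ` ?K \<subseteq> moved \<phi>" "?K \<union> \<psi> ` ?K \<subseteq> moved \<psi>"
    using moved_image d ap aq by auto
  have "moved (swap \<phi> ?K) \<noteq> {}" "moved (swap \<psi> ?K) \<noteq> {}" using sp(3) sq(3) e by auto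
  then have "swap \<phi> ?K \<noteq> id" "swap \<psi> ?K \<noteq> id" unfolding moved_empty_iff .
  then have mp: "moved \<phi> = ?K \<union> \<phi> ` ?K" and mq: "moved \<psi> = ?K \<union> \<psi> ` ?K"
    using minautD(3)[OF phi sp(1)] minautD(3)[OF psi sq(1)] sp(3) sq(3) sub by simp_all
  then have "\<phi> ` B \<noteq> \<psi> ` B" using ne K by metis
  then have d2: "\<phi> ` ?K \<inter> \<psi> ` ?K = {}"
    using disj[OF aut_block[OF ap B(1)] aut_block[OF aq B(1)] aB] K by simp
  \<comment> \<open>Conjugating \<open>\<psi>\<close> by the exchange \<open>?s\<close> replaces
    \<open>e\<close> by its partner in the image of \<open>K\<close> under \<open>\<phi>\<close>,
    and \<open>\<psi>\<close> fixes this partner.\<close>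
  let ?s = "swap \<phi> ?K" and ?t = "swap \<phi> ?K \<circ> \<psi> \<circ> swap \<phi> ?K"
  have "?s e \<in> \<phi> ` ?K" using e by (simp add: swap_def)
  then have "?s e \<notin> moved \<psi>" using d(1) d2 mq by auto
  then have te: "?t e = e" using sp(2) by (simp add: moved_def)
  moreover have "aut ?t" using aut_comp sp(1) aq by blast
  moreover have "?t \<noteq> id"
  proof
    assume t: "?t = id"
    have "\<psi> x = x" for x
      using sp(2)[of "\<psi> (?s (?s x))"] sp(2)[of x] fun_cong[OF t, of "?s x"] by simp
    then show False using minautD(2)[OF psi] by auto
  qed
  moreover have "moved ?t \<subseteq> moved \<phi> \<union> moved \<psi>"
  proof
    fix x assume x: "x \<in> moved ?t"
    show "x \<in> moved \<phi> \<union> moved \<psi>"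
    proof (rule ccontr)
      assume "x \<notin> moved \<phi> \<union> moved \<psi>"
      then have "x \<notin> moved ?s" "\<psi> x = x" using sp(3) mp by (auto simp: moved_def)
      then show False using x by (simp add: moved_def)
    qed
  qed
  ultimately show ?thesis by (intro exI[of _ ?t]) (auto simp: moved_def)
qed

text \<open>\<open>\<phi>\<close> moves only vertices beyond \<open>B\<close>, and
  \<open>\<psi>\<close> moves all of these, so minimality of \<open>\<psi>\<close> forces equality.
  For distinct moved sets this situation cannot occur.\<close>

lemma minaut_moved_beyond:
  assumes phi: "minaut \<phi>" and psi: "minaut \<psi>"
    and B: "block B" "a \<in> B" and fixed: "\<phi> a = a" "\<psi> a = a" and e: "e \<in> beyond B a" "e \<in> moved \<phi>"
    and inv: "\<phi> ` B = B" "\<psi> ` B \<noteq> B"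
  shows "moved \<phi> = moved \<psi>"
proof -
  have ap: "aut \<phi>" and aq: "aut \<psi>" using phi psi minautD by blast+
  have "\<phi> ` beyond B a = beyond B a" using aut_beyond[OF ap B(1)] fixed inv by metis
  then have "moved \<phi> \<subseteq> beyond B a"
    using minaut_moved_subset[OF phi attached_beyond[OF B] _ fixed(1) e] by blast
  moreover have "\<psi> ` beyond B a \<inter> beyond B a = {}"
  proof -
    have "a \<in> \<psi> ` B" using B(2) fixed by (metis imageI)
    then show ?thesis
      using branches_disjoint[OF aut_block[OF aq B(1)] B(1) inv(2) _ B(2)] aut_beyond[OF aq B(1)] fixed(2)
      unfolding beyond_def by auto
  qed
  then have "beyond B a \<subseteq> moved \<psi>" by (rule moved_image)
  ultimately show ?thesis using minautD(3)[OF psi] phi minautD by blast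
qed

text \<open>The same argument inside an invariant block: \<open>\<phi>\<close> moves only vertices
  of the branch at \<open>b\<close>, and \<open>\<psi>\<close> moves this branch entirely.\<close>

lemma minaut_moved_branch:
  assumes phi: "minaut \<phi>" and psi: "minaut \<psi>"
    and B: "block B" "b \<in> B" and e: "e \<in> branch B b" "e \<in> moved \<phi>"
    and inv: "\<phi> ` B = B" "\<psi> ` B = B" and b: "\<phi> b = b" "\<psi> b \<noteq> b"
  shows "moved \<phi> = moved \<psi>"
proof -
  have ap: "aut \<phi>" and aq: "aut \<psi>" using phi psi minautD by blast+
  have "e \<in> branch B b - {b}" using e b by (auto simp: moved_def)
  then have "moved \<phi> \<subseteq> branch B b - {b}"
    using minaut_moved_subset[OF phi attached_branch[OF B] aut_branch[OF ap B(1) inv(1) b(1)] b(1)] e by blast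
  then show ?thesis
    using branch_moved[OF aq B(1) inv(2) b(2)] minautD(3)[OF psi] phi minautD by blast
qed

lemma elimination_common_fixed_vertex:
  assumes phi: "minaut \<phi>" and psi: "minaut \<psi>" and ne: "moved \<phi> \<noteq> moved \<psi>"
    and e: "e \<in> moved \<phi>" "e \<in> moved \<psi>" and a: "a \<in> V" "\<phi> a = a" "\<psi> a = a"
  shows "\<exists>\<theta>. aut \<theta> \<and> \<theta> \<noteq> id \<and> moved \<theta> \<subseteq> moved \<phi> \<union> moved \<psi> - {e}"
proof -
  have ap: "aut \<phi>" and aq: "aut \<psi>" using phi psi minautD by blast+
  have eV: "e \<in> V" using e moved_subset ap by blast
  have main: ?thesis if "block B" "a \<in> B" "root B e \<noteq> a" "\<phi> a = a" "\<psi> a = a" for a B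
    using that
  proof (induction "card (beyond B a)" arbitrary: a B rule: less_induct)
    case less
    note B = less.prems(1,2) and fixed = less.prems(4,5)
    have eK: "e \<in> beyond B a" using less.prems eV by (simp add: beyond_def)
    consider "\<phi> ` B \<noteq> B" "\<psi> ` B \<noteq> B" | "\<phi> ` B = B" "\<psi> ` B \<noteq> B" | "\<phi> ` B \<noteq> B" "\<psi> ` B = B"
      | "\<phi> ` B = B" "\<psi> ` B = B" by blast
    then show ?case
    proof cases
      case 1
      then show ?thesis using elimination_swap[OF phi psi ne B fixed eK] by blast
    next
      case 2
      then show ?thesis using minaut_moved_beyond[OF phi psi B fixed eK e(1)] ne by blast
    next
      case 3
      then show ?thesis using minaut_moved_beyond[OF psi phi B fixed(2,1) eK e(2)] ne by metis
    next
      case 4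
      let ?b = "root B e"
      have b: "?b \<in> B" "e \<in> branch B ?b" using root_props(1)[OF B(1) eV] eV by (auto simp: branch_def)
      consider "\<phi> ?b = ?b" "\<psi> ?b = ?b" | "\<phi> ?b = ?b" "\<psi> ?b \<noteq> ?b" | "\<phi> ?b \<noteq> ?b" "\<psi> ?b = ?b"
        | "\<phi> ?b \<noteq> ?b" "\<psi> ?b \<noteq> ?b" by blast
      then show ?thesis
      proof cases
        case 1
        \<comment> \<open>\<open>?b\<close> becomes the new common fixed vertex. The part beyond the
          next block is strictly smaller, since it lies in the old one and no longer contains
          \<open>?b\<close>.\<close>
        have bV: "?b \<in> V" using root_V B(1) eV by blast
        have "e \<noteq> ?b" using 1 e by (auto simp: moved_def)
        then obtain B' where B': "block B'" "?b \<in> B'" "root B' e \<noteq> ?b"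
          using exists_block_towards[OF bV eV] by blast
        then have "B' \<noteq> B" by auto
        then have "beyond B' ?b \<subseteq> beyond B a"
          using branches_disjoint[OF B'(1) B(1) _ B'(2) b(1)] less.prems(3) unfolding beyond_def by auto
        moreover have "?b \<in> beyond B a" "?b \<notin> beyond B' ?b"
          using root_id[OF B(1) b(1)] root_id[OF B'(1,2)] less.prems(3) bV unfolding beyond_def by auto
        moreover have "finite (beyond B a)" using finite_V unfolding beyond_def by simp
        ultimately have "card (beyond B' ?b) < card (beyond B a)" by (intro psubset_card_mono) auto
        then show ?thesis using less.hyps[OF _ B' 1] by blast
      next
        case 2
        then show ?thesis using minaut_moved_branch[OF phi psi B(1) b e(1)] 4 ne by blast
      next
        case 3
        then show ?thesis using minaut_moved_branch[OF psi phi B(1) b e(2)] 4 ne by metis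
      next
        case both: 4
        \<comment> \<open>Both act on \<open>B\<close> as the same reflection, so \<open>?u\<close>
          fixes \<open>B\<close> pointwise. Cutting it down to the complement of the branch that
          contains \<open>e\<close> makes it fix \<open>e\<close>.\<close>
        let ?u = "Hilbert_Choice.inv \<psi> \<circ> \<phi>" and ?K = "beyond B ?b"
        let ?t = "restr ?u ?K"
        have agree: "\<phi> x = \<psi> x" if "x \<in> B" for x
          using reflections_agree[OF B ap 4(1) fixed(1) b(1) both(1) aq 4(2) fixed(2) b(1) both(2) that] .
        have at0: "aut ?u" using aut_comp[OF aut_inv[OF aq] ap] .
        have t0B: "?u x = x" if "x \<in> B" for x using agree[OF that] aut_inv_simps[OF aq] by simp
        then have "?u ` B = B" using image_cong[OF refl, of B ?u "\<lambda>x. x"] by simp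
        then have "?u ` ?K = ?K" using aut_beyond[OF at0 B(1), of ?b] t0B[OF b(1)] by simp
        then have at: "aut ?t" using aut_restr[OF at0 attached_beyond[OF B(1) b(1)]] t0B[OF b(1)] by blast
        have t0: "?u x = x \<longleftrightarrow> \<phi> x = \<psi> x" for x using aut_inv_simps[OF aq] unfolding comp_apply by metis
        show ?thesis
        proof (cases "?t = id")
          case False
          moreover have "moved ?t \<subseteq> moved \<phi> \<union> moved \<psi> - {e}"
          proof
            fix x assume "x \<in> moved ?t"
            then have r: "?t x \<noteq> x" by (simp only: moved_def mem_Collect_eq not_False_eq_True)
            have xK: "x \<in> ?K"
            proof (rule ccontr)
              assume "x \<notin> ?K"
              then have "?t x = x" unfolding restr_def by (rule if_not_P)
              then show False using r by contradiction
            qed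
            then have "?t x = ?u x" unfolding restr_def by (rule if_P)
            then have "\<phi> x \<noteq> \<psi> x" using r t0[of x] by metis
            moreover have "x \<noteq> e" using xK unfolding beyond_def by blast
            ultimately show "x \<in> moved \<phi> \<union> moved \<psi> - {e}" unfolding moved_def by auto
          qed
          ultimately show ?thesis using at by blast
        next
          case True
          \<comment> \<open>If nothing is left, \<open>\<phi>\<close> and \<open>\<psi>\<close>
            agree off the branch at \<open>?b\<close>, and both move the whole branch, so their
            moved sets would be equal.\<close>
          have eq: "\<phi> x = \<psi> x" if "x \<in> ?K" for x
          proof -
            have "?u x = x" using fun_cong[OF True, of x] that unfolding restr_def by simp
            then show ?thesis using t0 by blast
          qed
          have mv: "branch B ?b \<subseteq> moved \<phi>" "branch B ?b \<subseteq> moved \<psi>"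
            using branch_moved[OF ap B(1) 4(1) both(1)] branch_moved[OF aq B(1) 4(2) both(2)] by auto
          have "x \<in> moved \<phi> \<longleftrightarrow> x \<in> moved \<psi>" if "x \<in> V" for x
          proof (cases "x \<in> ?K")
            case True
            then show ?thesis using eq[of x] by (simp add: moved_def)
          next
            case False
            then have "x \<in> branch B ?b" using that by (simp add: beyond_def branch_def)
            then show ?thesis using mv by blast
          qed
          then have "moved \<phi> = moved \<psi>" using moved_subset[OF ap] moved_subset[OF aq] by blast
          then show ?thesis using ne by contradiction
        qed
      qed
    qed
  qed
  have "e \<noteq> a" using e a by (auto simp: moved_def)
  then obtain B where "block B" "a \<in> B" "root B e \<noteq> a" using exists_block_towards[OF a(1) eV] by blast
  then show ?thesis using main a by blast
qed

end

section \<open>Centers of graphs\<close>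

context wf_digraph begin

lemma awalk_cost_one: "awalk_cost (\<lambda>_. 1) p = length p"
  by (induction p) auto

lemma distance_le: "awalk u p v \<Longrightarrow> distance G u v \<le> ereal (length p)"
  using min_cost_le_walk_cost[of u p v "\<lambda>_. 1"] by (simp add: distance_def awalk_cost_one)

lemma le_distance: "(\<And>p. awalk u p v \<Longrightarrow> r \<le> ereal (length p)) \<Longrightarrow> r \<le> distance G u v"
  unfolding distance_def \<mu>_def by (rule INF_greatest) (simp add: awalk_cost_one)

lemma awalk_avoiding:
  assumes f: "\<And>u v. u \<rightarrow>\<^bsub>G\<^esub> v \<Longrightarrow> u \<noteq> w \<Longrightarrow> v \<noteq> w \<Longrightarrow> f u = f v"
  shows "awalk x p v \<Longrightarrow> w \<notin> set (awalk_verts x p) \<Longrightarrow> f x = f v"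
proof (induction p arbitrary: x)
  case Nil
  then show ?case by (simp add: awalk_Nil_iff)
next
  case (Cons a p)
  then have a: "a \<in> arcs G" "tail G a = x" "awalk (head G a) p v" by (auto simp: awalk_Cons_iff)
  have w: "w \<noteq> x" "w \<notin> set (awalk_verts (head G a) p)" using Cons.prems(2) a(2) by auto
  have "head G a \<in> set (awalk_verts (head G a) p)" using a(3) hd_in_awalk_verts(1) by blast
  then have "f x = f (head G a)" using f[of x "head G a"] a w by (metis arc_to_ends_def dominatesI)
  then show ?case using Cons.IH[OF a(3) w(2)] by simp
qed

text \<open>\<open>f\<close> is a labelling constant on the components that remain after removing
  \<open>w\<close>. A walk between different labels must pass \<open>w\<close>, and it does so at
  least one step after its start.\<close>

lemma distance_through:
  assumes f: "\<And>u v. u \<rightarrow>\<^bsub>G\<^esub> v \<Longrightarrow> u \<noteq> w \<Longrightarrow> v \<noteq> w \<Longrightarrow> f u = f v"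
    and sep: "f x \<noteq> f v \<or> v = w" and xw: "x \<noteq> w"
  shows "distance G w v + 1 \<le> distance G x v"
proof (rule le_distance)
  fix p assume p: "awalk x p v"
  have "w \<in> set (awalk_verts x p)"
  proof (rule ccontr)
    assume n: "w \<notin> set (awalk_verts x p)"
    then have "f x = f v" using awalk_avoiding[of w f] f p by blast
    then have "v = w" using sep by blast
    moreover have "awlast x p = v" using p by (rule awalkE)
    then have "v \<in> set (awalk_verts x p)" using last_in_set[OF awalk_verts_non_Nil, of x p] by simp
    ultimately show False using n by simp
  qed
  then obtain q r where q: "p = q @ r" "awalk x q w" "awalk w r v" using awalk_decomp[OF p] by blast
  have "q \<noteq> []" using q(2) xw by (auto simp: awalk_Nil_iff)
  then have "length r + 1 \<le> length p" using q(1) by (cases q) auto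
  have "distance G w v + 1 \<le> ereal (length r) + 1" using distance_le[OF q(3)] by (rule add_right_mono)
  also have "\<dots> = ereal (real (length r + 1))" by (simp add: one_ereal_def)
  also have "\<dots> \<le> ereal (length p)" using \<open>length r + 1 \<le> length p\<close> by (simp del: of_nat_add)
  finally show "distance G w v + 1 \<le> ereal (length p)" .
qed

lemma eccentricity_map:
  assumes h: "\<And>u v. u \<rightarrow>\<^bsub>G\<^esub> v \<Longrightarrow> h u \<rightarrow>\<^bsub>G\<^esub> h v" "h ` verts G = verts G" and u: "u \<in> verts G"
  shows "eccentricity G (h u) \<le> eccentricity G u"
proof -
  have walk: "\<exists>q. awalk (h u) q (h v) \<and> length q = length p" if "awalk u p v" for u p v
    using that
  proof (induction p arbitrary: u)
    case Nil
    then show ?case using h(2) by (intro exI[of _ "[]"]) (auto simp: awalk_Nil_iff)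
  next
    case (Cons a p)
    then have a: "a \<in> arcs G" "tail G a = u" "awalk (head G a) p v" by (auto simp: awalk_Cons_iff)
    then have "h u \<rightarrow>\<^bsub>G\<^esub> h (head G a)" using h(1) by (metis arc_to_ends_def dominatesI)
    then obtain b where "b \<in> arcs G" "tail G b = h u" "head G b = h (head G a)" by blast
    moreover obtain q where "awalk (h (head G a)) q (h v)" "length q = length p" using Cons.IH[OF a(3)] by blast
    ultimately show ?case by (intro exI[of _ "b # q"]) (auto simp: awalk_Cons_iff)
  qed
  have "distance G (h u) (h v) \<le> distance G u v" for v
    by (rule le_distance) (metis walk distance_le)
  then have "distance G (h u) (h v) \<le> eccentricity G u" if "v \<in> verts G" for v
    using that unfolding eccentricity_def by (meson SUP_upper order_trans)
  then show ?thesis unfolding eccentricity_def[of G "h u"] using h(2) by (intro SUP_least) (metis imageE)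
qed

lemma graph_center_map:
  assumes h: "\<And>u v. u \<rightarrow>\<^bsub>G\<^esub> v \<Longrightarrow> h u \<rightarrow>\<^bsub>G\<^esub> h v" "h ` verts G = verts G" and u: "u \<in> graph_center G"
  shows "h u \<in> graph_center G"
  using eccentricity_map[OF h, of u] u h(2) unfolding graph_center_def by (auto intro: order_trans)

end

context fin_digraph begin

lemma graph_center_nonempty: "verts G \<noteq> {} \<Longrightarrow> graph_center G \<noteq> {}"
  using arg_min_if_finite[of "verts G" "eccentricity G"] finite_verts
  unfolding graph_center_def by (auto simp: not_less)

text \<open>Every walk from one of \<open>x\<close>, \<open>y\<close> to a given vertex passes through \<open>w\<close>, which is therefore
  strictly more central.\<close>

lemma graph_center_not_separated:
  assumes reach: "\<And>u v. u \<in> verts G \<Longrightarrow> v \<in> verts G \<Longrightarrow> u \<rightarrow>\<^sup>*\<^bsub>G\<^esub> v"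
    and xy: "x \<in> graph_center G" "y \<in> graph_center G" and w: "w \<in> verts G" "w \<noteq> x" "w \<noteq> y"
    and f: "\<And>u v. u \<rightarrow>\<^bsub>G\<^esub> v \<Longrightarrow> u \<noteq> w \<Longrightarrow> v \<noteq> w \<Longrightarrow> f u = f v" and fxy: "f x \<noteq> f y"
  shows False
proof -
  have V: "x \<in> verts G" "y \<in> verts G" and ecc: "eccentricity G x = eccentricity G y" "eccentricity G x \<le> eccentricity G w"
    using xy w(1) unfolding graph_center_def by (auto intro: antisym)
  have "distance G w v < eccentricity G x" if v: "v \<in> verts G" for v
  proof -
    have "f x \<noteq> f v \<or> f y \<noteq> f v" using fxy by auto
    then have "distance G w v + 1 \<le> distance G x v \<or> distance G w v + 1 \<le> distance G y v"
      using distance_through[of w f x v] distance_through[of w f y v] f w(2,3) by blast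
    moreover have "distance G u v \<le> eccentricity G u" for u
      unfolding eccentricity_def using v by (rule SUP_upper)
    ultimately have le: "distance G w v + 1 \<le> eccentricity G x" using ecc(1) by (metis order_trans)
    \<comment> \<open>Reachability makes the distance finite. In \<open>ereal\<close> only this
      turns the additional step into a strict inequality.\<close>
    obtain p where "awalk w p v" using reach[OF w(1) v] reachable_awalk by blast
    from distance_le[OF this] have "distance G w v \<noteq> \<infinity>" by auto
    moreover have "0 \<le> distance G w v" by (rule le_distance) simp
    ultimately have "distance G w v < distance G w v + 1" by (cases "distance G w v") auto
    then show ?thesis using le by simp
  qed
  then have "eccentricity G w < eccentricity G x"
    unfolding eccentricity_def[of G w] using w(1) by (subst finite_Sup_less_iff) auto
  then show False using ecc(2) by simp
qed

end

section \<open>The block-cutvertex tree\<close>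

locale bc_graph = graph +
  assumes connected_G: "Digraph_Component.connected G"
begin

lemma reachable_G: "u \<in> verts G \<Longrightarrow> v \<in> verts G \<Longrightarrow> u \<rightarrow>\<^sup>*\<^bsub>G\<^esub> v"
  using symmetric_connected_imp_strongly_connected[OF sym_arcs connected_G] unfolding strongly_connected_def by blast

lemma verts_nonempty: "verts G \<noteq> {}"
  using symmetric_connected_imp_strongly_connected[OF sym_arcs connected_G] unfolding strongly_connected_def by blast

sublocale S: simple_graph "verts G" "\<lambda>u v. u \<rightarrow>\<^bsub>G\<^esub> v"
proof
  show "x \<rightarrow>\<^bsub>G\<^esub> y \<Longrightarrow> x \<in> verts G \<and> y \<in> verts G" for x y using adj_in_verts by blast
  show "x \<rightarrow>\<^bsub>G\<^esub> y \<Longrightarrow> y \<rightarrow>\<^bsub>G\<^esub> x" for x y by (rule arcs_ends_symmetric[OF sym_arcs])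
  show "\<not> x \<rightarrow>\<^bsub>G\<^esub> x" for x using adj_not_same by blast
qed simp

lemma reachable_subgraph_joined:
  assumes "subgraph H G" "x \<rightarrow>\<^sup>*\<^bsub>H\<^esub> y"
  shows "S.joined (verts H) x y"
  using assms(2) unfolding reachable_def
proof (induction rule: rtrancl_on_induct)
  case base
  show ?case by (rule S.joined_refl)
next
  case (step y z)
  have "y \<rightarrow>\<^bsub>G\<^esub> z" using assms(1) step(2) unfolding subgraph_def compatible_def arcs_ends_conv by auto
  then show ?case using step S.joined_edge S.joined_trans by blast
qed

lemma joined_reachable:
  assumes "S.joined X x y" "x \<in> X"
  shows "x \<rightarrow>\<^sup>*\<^bsub>G \<restriction> X\<^esub> y"
  using assms unfolding S.joined_def
proof (induction rule: rtranclp_induct)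
  case base
  then show ?case by (simp add: reachable_def)
next
  case (step y z)
  then have "(y, z) \<in> arcs_ends (G \<restriction> X)" unfolding arcs_ends_conv by auto
  then show ?case using step unfolding reachable_def by (auto intro: rtrancl_on_into_rtrancl_on)
qed

sublocale S: connected_graph "verts G" "\<lambda>u v. u \<rightarrow>\<^bsub>G\<^esub> v"
proof
  show "S.conn (verts G)"
    unfolding S.conn_def using reachable_subgraph_joined[of G] reachable_G wf_digraph
    by (auto simp: subgraph_def compatible_def)
qed

lemma subgraph_induced: "X \<subseteq> verts G \<Longrightarrow> subgraph (G \<restriction> X) G"
  by (rule subgraph_induce_subgraphI)

lemma del_vert_eq: "wf_digraph H \<Longrightarrow> pre_digraph.del_vert H v = H \<restriction> (verts H - {v})"
  unfolding pre_digraph.del_vert_def induce_subgraph_def by (auto simp: wf_digraph_def)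

lemma graph_induced: "X \<subseteq> verts G \<Longrightarrow> graph (G \<restriction> X)"
proof -
  assume X: "X \<subseteq> verts G"
  have ind: "induced_subgraph (G \<restriction> X) G" using X by (rule induced_induce)
  interpret H: sym_digraph "G \<restriction> X" using ind by (rule induced_graph_imp_graph)
  show ?thesis
  proof
    show "finite (verts (G \<restriction> X))" using X finite_subset[OF _ finite_verts] by auto
    show "finite (arcs (G \<restriction> X))" by simp
  qed (auto intro: no_multi_arcs dest: no_loops)
qed

lemma nonseparable_nonsep:
  assumes H: "subgraph H G" "nonseparable H"
  shows "S.nonsep (verts H)"
proof -
  interpret H: graph H using H unfolding nonseparable_def by blast
  have sc: "strongly_connected H"
    using H.symmetric_connected_imp_strongly_connected[OF H.sym_arcs] H(2) unfolding nonseparable_def by blast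
  then have all: "x \<rightarrow>\<^sup>*\<^bsub>H\<^esub> y" if "x \<in> verts H" "y \<in> verts H" for x y using that unfolding strongly_connected_def by blast
  have c: "S.conn (verts H)" unfolding S.conn_def using all reachable_subgraph_joined[OF H(1)] by blast
  have "S.conn (verts H - {v})" for v
  proof (cases "v \<in> verts H")
    case True
    have sub: "subgraph (pre_digraph.del_vert H v) G"
      using H.subgraph_del_vert[of v] H(1) subgraph_trans by blast
    have "x \<rightarrow>\<^sup>*\<^bsub>pre_digraph.del_vert H v\<^esub> y" if "x \<in> verts H - {v}" "y \<in> verts H - {v}" for x y
      using H(2) True that all[of x y] unfolding nonseparable_def cutvertex_def by blast
    then show ?thesis
      using reachable_subgraph_joined[OF sub] unfolding S.conn_def by (simp add: H.verts_del_vert)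
  qed (simp add: c)
  then show ?thesis using c sc H(1) unfolding S.nonsep_def strongly_connected_def subgraph_def by blast
qed

lemma cutvertex_induced:
  assumes "X \<subseteq> verts G" "S.conn X"
  shows "cutvertex (G \<restriction> X) v \<longleftrightarrow> v \<in> X \<and> \<not> S.conn (X - {v})"
proof -
  have wf: "wf_digraph (G \<restriction> X)" by (rule wellformed_induce_subgraph)
  have "(G \<restriction> X) \<restriction> (X - {v}) = G \<restriction> (X - {v})" by (auto simp: induce_subgraph_def)
  then have del: "pre_digraph.del_vert (G \<restriction> X) v = G \<restriction> (X - {v})" using del_vert_eq[OF wf, of v] by simp
  have r1: "x \<rightarrow>\<^sup>*\<^bsub>G \<restriction> (X - {v})\<^esub> y \<longleftrightarrow> S.joined (X - {v}) x y" if "x \<in> X - {v}" for x y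
    using joined_reachable[OF _ that] reachable_subgraph_joined[OF subgraph_induced, of "X - {v}" x y] assms(1) by auto
  have r2: "x \<rightarrow>\<^sup>*\<^bsub>G \<restriction> X\<^esub> y" if "x \<in> X" "y \<in> X" for x y
    using joined_reachable[of X x y] that assms(2) unfolding S.conn_def by blast
  show ?thesis unfolding cutvertex_def del S.conn_def using r1 r2 by auto
qed

lemma nonsep_nonseparable:
  assumes "S.nonsep X"
  shows "nonseparable (G \<restriction> X)"
proof -
  have X: "X \<subseteq> verts G" "X \<noteq> {}" "S.conn X" "\<And>v. S.conn (X - {v})" using assms unfolding S.nonsep_def by auto
  have "(x, y) \<in> rtrancl_on X ((arcs_ends (G \<restriction> X))\<^sup>s)" if "x \<in> X" "y \<in> X" for x y
  proof -
    have "x \<rightarrow>\<^sup>*\<^bsub>G \<restriction> X\<^esub> y" using joined_reachable[of X x y] that X(3) unfolding S.conn_def by blast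
    then show ?thesis unfolding reachable_def
      by (rule rtrancl_on_mono[rotated 2]) (auto simp: symcl_def)
  qed
  then have "Digraph_Component.connected (G \<restriction> X)" unfolding connected_conv using X by simp
  then show ?thesis unfolding nonseparable_def using graph_induced[OF X(1)] cutvertex_induced[OF X(1,3)] X(4) by blast
qed

lemma induced_mono: "X \<subseteq> Y \<Longrightarrow> Y \<subseteq> verts G \<Longrightarrow> subgraph (G \<restriction> X) (G \<restriction> Y)"
  by (rule subgraphI) (auto simp: compatible_def)

text \<open>Nonseparability passes from a subgraph to the subgraph induced on its vertices, since
  further arcs only add connections. So maximal nonseparable subgraphs are induced, and maximality
  may be tested on vertex sets.\<close>

lemma blocks_eq: "blocks G = (\<lambda>X. G \<restriction> X) ` {X. S.block X}"
proof (intro Set.set_eqI iffI)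
  fix B assume "B \<in> blocks G"
  then have B: "subgraph B G" "nonseparable B"
    and max: "\<And>H. subgraph B H \<Longrightarrow> subgraph H G \<Longrightarrow> nonseparable H \<Longrightarrow> H = B"
    unfolding blocks_def max_subgraph_def by blast+
  have ns: "S.nonsep (verts B)" by (rule nonseparable_nonsep[OF B])
  then have sub: "verts B \<subseteq> verts G" unfolding S.nonsep_def by blast
  have "subgraph B (G \<restriction> verts B)"
    using B(1) by (intro subgraphI) (auto simp: subgraph_def compatible_def wf_digraph_def)
  then have eq: "G \<restriction> verts B = B" using max subgraph_induced[OF sub] nonsep_nonseparable[OF ns] by blast
  have "S.block (verts B)"
    unfolding S.block_def
  proof (intro conjI allI impI ns)
    fix Y assume Y: "S.nonsep Y" "verts B \<subseteq> Y"
    then have YG: "Y \<subseteq> verts G" unfolding S.nonsep_def by blast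
    have "G \<restriction> Y = B"
      using max[of "G \<restriction> Y"] induced_mono[OF Y(2) YG] eq subgraph_induced[OF YG] nonsep_nonseparable[OF Y(1)] by simp
    then show "Y = verts B" by (metis induce_subgraph_verts)
  qed
  then show "B \<in> (\<lambda>X. G \<restriction> X) ` {X. S.block X}" using eq by (metis image_eqI mem_Collect_eq)
next
  fix B assume "B \<in> (\<lambda>X. G \<restriction> X) ` {X. S.block X}"
  then obtain X where X: "B = G \<restriction> X" "S.block X" by blast
  have sub: "subgraph B G" using X S.block_subset subgraph_induced by blast
  have "H = B" if H: "subgraph B H" "subgraph H G" "nonseparable H" for H
  proof -
    have "X \<subseteq> verts H" using H(1) X(1) unfolding subgraph_def by simp
    then have v: "verts H = X" using S.block_maximal[OF X(2) nonseparable_nonsep[OF H(2,3)]] by blast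
    have "arcs H \<subseteq> arcs B"
      using H(2) v X(1) unfolding subgraph_def compatible_def wf_digraph_def by auto
    then have a: "arcs H = arcs B" using H(1) unfolding subgraph_def by blast
    show ?thesis
      using v a H(2) X(1) by (intro pre_digraph.equality) (auto simp: subgraph_def compatible_def)
  qed
  then show "B \<in> blocks G"
    using sub nonsep_nonseparable[OF S.block_nonsep[OF X(2)]] X(1) unfolding blocks_def max_subgraph_def by blast
qed

lemma cutvertex_iff: "cutvertex G c \<longleftrightarrow> c \<in> verts G \<and> \<not> S.conn (verts G - {c})"
proof -
  have "G \<restriction> verts G = G" by (intro pre_digraph.equality) auto
  then show ?thesis using cutvertex_induced[of "verts G" c] S.conn_V by simp
qed

lemma joined_stays_attached:
  assumes "S.attached K c" "S.joined X x y" "x \<in> K" "c \<notin> X"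
  shows "y \<in> K"
  using assms(2) unfolding S.joined_def
proof (induction rule: rtranclp_induct)
  case (step y z)
  then show ?case using assms(1,4) unfolding S.attached_def by blast
qed (rule assms)

lemma block_two_vertices:
  assumes "S.block X" "c \<in> X" "verts G \<noteq> {c}"
  shows "\<exists>x\<in>X. x \<noteq> c"
proof (rule ccontr)
  assume "\<not> ?thesis"
  then have X: "X = {c}" using assms(2) by blast
  have "c \<in> verts G" using assms(1,2) S.block_subset by blast
  then obtain y where y: "y \<in> verts G" "y \<noteq> c" using assms(3) by blast
  have "S.joined (verts G) c y" using S.conn_V \<open>c \<in> verts G\<close> y unfolding S.conn_def by blast
  then obtain n where n: "c \<rightarrow>\<^bsub>G\<^esub> n" "n \<noteq> c"
    using rtranclp_leaves_set[of _ c y "{c}"] y unfolding S.joined_def by blast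
  have "{c, n} = X" using S.block_maximal[OF assms(1) S.nonsep_edge[OF n(1)]] X by blast
  then show False using X n by blast
qed

lemma distinct_blocks_two_vertices:
  assumes "S.block X" "S.block Y" "X \<noteq> Y" "c \<in> X"
  shows "\<exists>x\<in>X. x \<noteq> c"
proof (rule block_two_vertices[OF assms(1,4)])
  have sub: "X \<subseteq> verts G" "Y \<subseteq> verts G" using assms S.block_subset by blast+
  have "Y \<noteq> {}" using S.block_nonsep[OF assms(2)] unfolding S.nonsep_def by simp
  then show "verts G \<noteq> {c}"
    using sub assms(3,4) by (metis empty_iff subset_singletonD)
qed

text \<open>A path from the branch at \<open>c\<close> to \<open>x\<close> that avoids
  \<open>c\<close> could not leave the branch, whose only exit is \<open>c\<close>.\<close>

lemma branch_cutvertex: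
  assumes "S.block B" "c \<in> B" "x \<in> B" "x \<noteq> c" "y \<in> S.branch B c" "y \<noteq> c"
  shows "cutvertex G c"
proof -
  have "x \<in> verts G" "c \<in> verts G" using assms S.block_subset by blast+
  moreover have "y \<in> verts G" using assms unfolding S.branch_def by blast
  moreover have "\<not> S.joined (verts G - {c}) y x"
  proof
    assume "S.joined (verts G - {c}) y x"
    then have "x \<in> S.branch B c - {c}"
      using joined_stays_attached[OF S.attached_branch[OF assms(1,2)]] assms(5,6) by blast
    then show False using S.root_id[OF assms(1,3)] assms(4) unfolding S.branch_def by simp
  qed
  ultimately show ?thesis unfolding cutvertex_iff S.conn_def using assms(4,6) by blast
qed

lemma shared_cutvertex:
  assumes "S.block X" "S.block Y" "X \<noteq> Y" "v \<in> X" "v \<in> Y"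
  shows "cutvertex G v"
proof -
  obtain x where x: "x \<in> X" "x \<noteq> v" using distinct_blocks_two_vertices assms by blast
  obtain y where y: "y \<in> Y" "y \<noteq> v" using distinct_blocks_two_vertices assms by metis
  have "y \<in> S.branch X v"
    using S.block_on_branch[OF assms(1-3) y(1) assms(5)] S.root_id[OF assms(1,4)] y S.block_subset[OF assms(2)]
    unfolding S.branch_def by auto
  then show ?thesis using branch_cutvertex[OF assms(1,4) x] y by blast
qed

section \<open>The block-cutvertex tree and its center\<close>

abbreviation bct :: "(('a, 'b) pre_digraph + 'a, (('a, 'b) pre_digraph + 'a) \<times> (('a, 'b) pre_digraph + 'a)) pre_digraph" where
  "bct \<equiv> with_proj (bc_tree G)"

lemma verts_bct: "verts bct = (\<lambda>X. Inl (G \<restriction> X)) ` {X. S.block X} \<union> Inr ` {c. cutvertex G c}"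
  by (auto simp: bc_tree_def Let_def blocks_eq)

lemma arcs_bct: "arcs_ends bct = {(Inl (G \<restriction> X), Inr c) | X c. S.block X \<and> cutvertex G c \<and> c \<in> X} \<union>
    {(Inr c, Inl (G \<restriction> X)) | X c. S.block X \<and> cutvertex G c \<and> c \<in> X}"
  by (auto simp: bc_tree_def Let_def blocks_eq)

lemma bct_edgeE:
  assumes "s \<rightarrow>\<^bsub>bct\<^esub> t"
  obtains X c where "S.block X" "cutvertex G c" "c \<in> X" "s = Inl (G \<restriction> X)" "t = Inr c"
    | X c where "S.block X" "cutvertex G c" "c \<in> X" "t = Inl (G \<restriction> X)" "s = Inr c"
  using assms unfolding arcs_bct by blast

lemma bct_edges: "S.block X \<Longrightarrow> cutvertex G c \<Longrightarrow> c \<in> X \<Longrightarrow> Inl (G \<restriction> X) \<rightarrow>\<^bsub>bct\<^esub> Inr c"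
    "S.block X \<Longrightarrow> cutvertex G c \<Longrightarrow> c \<in> X \<Longrightarrow> Inr c \<rightarrow>\<^bsub>bct\<^esub> Inl (G \<restriction> X)"
  unfolding arcs_bct by blast+

sublocale T: fin_digraph bct
proof
  have "finite {X. S.block X}" by (rule finite_subset[of _ "Pow (verts G)"]) (auto dest: S.block_subset)
  moreover have "finite {c. cutvertex G c}" by (rule finite_subset[of _ "verts G"]) (auto simp: cutvertex_iff)
  ultimately show fin: "finite (verts bct)" unfolding verts_bct by blast
  show "tail bct e \<in> verts bct" "head bct e \<in> verts bct" if "e \<in> arcs bct" for e
    using that unfolding verts_bct by (auto simp: bc_tree_def Let_def blocks_eq)
  then have "arcs bct \<subseteq> verts bct \<times> verts bct" by (auto simp: subset_iff)
  then show "finite (arcs bct)" using fin finite_subset by blast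
qed

lemma induced_eq_iff: "G \<restriction> X = G \<restriction> Y \<longleftrightarrow> X = Y"
  by (metis induce_subgraph_verts)

lemma bct_blocks_reachable:
  assumes X: "S.block X" "u \<in> X" and uv: "S.joined (verts G) u v"
  shows "S.block Y \<Longrightarrow> v \<in> Y \<Longrightarrow> Inl (G \<restriction> X) \<rightarrow>\<^sup>*\<^bsub>bct\<^esub> Inl (G \<restriction> Y)"
  using uv unfolding S.joined_def
proof (induction arbitrary: Y rule: rtranclp_induct)
  case base
  have meet: "Inl (G \<restriction> X) \<rightarrow>\<^sup>*\<^bsub>bct\<^esub> Inl (G \<restriction> Y)"
    if "S.block X" "S.block Y" "v \<in> X" "v \<in> Y" for X Y v
  proof (cases "X = Y")
    case True
    have "Inl (G \<restriction> X) \<in> verts bct" using that unfolding verts_bct by blast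
    then show ?thesis using True T.reachable_refl by blast
  next
    case False
    then have "cutvertex G v" using shared_cutvertex that by blast
    then show ?thesis using bct_edges that T.reachable_adjI T.reachable_trans by meson
  qed
  then show ?case using X base by blast
next
  case (step v w)
  obtain Z where Z: "S.block Z" "{v, w} \<subseteq> Z" using S.nonsep_extends_to_block[OF S.nonsep_edge] step by blast
  have 1: "Inl (G \<restriction> X) \<rightarrow>\<^sup>*\<^bsub>bct\<^esub> Inl (G \<restriction> Z)" using step.IH Z by blast
  show ?case
  proof (cases "Y = Z")
    case False
    then have "cutvertex G w" using shared_cutvertex[of Y Z w] step Z by blast
    then have "Inl (G \<restriction> Z) \<rightarrow>\<^sup>*\<^bsub>bct\<^esub> Inl (G \<restriction> Y)" using bct_edges step Z T.reachable_adjI T.reachable_trans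
      by (meson insert_subset)
    then show ?thesis using 1 T.reachable_trans by blast
  qed (use 1 in simp)
qed

lemma bct_reachable:
  assumes "s \<in> verts bct" "t \<in> verts bct"
  shows "s \<rightarrow>\<^sup>*\<^bsub>bct\<^esub> t"
proof -
  have near: "\<exists>X. S.block X \<and> s \<rightarrow>\<^sup>*\<^bsub>bct\<^esub> Inl (G \<restriction> X) \<and> Inl (G \<restriction> X) \<rightarrow>\<^sup>*\<^bsub>bct\<^esub> s" if "s \<in> verts bct" for s
  proof -
    from that consider X where "S.block X" "s = Inl (G \<restriction> X)" | c where "cutvertex G c" "s = Inr c"
      unfolding verts_bct by blast
    then show ?thesis
    proof cases
      case 1
      then show ?thesis using that by blast
    next
      case 2
      then have c: "c \<in> verts G" by (simp add: cutvertex_iff)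
      have "S.nonsep {c}" using c S.conn_path[of "[c]"] S.conn_path[of "[]"] unfolding S.nonsep_def
        by (auto simp: insert_Diff_if)
      then obtain X where "S.block X" "c \<in> X" using S.nonsep_extends_to_block by blast
      then show ?thesis using bct_edges 2 T.reachable_adjI by metis
    qed
  qed
  obtain X where X: "S.block X" "s \<rightarrow>\<^sup>*\<^bsub>bct\<^esub> Inl (G \<restriction> X)" using near[OF assms(1)] by blast
  obtain Y where Y: "S.block Y" "Inl (G \<restriction> Y) \<rightarrow>\<^sup>*\<^bsub>bct\<^esub> t" using near[OF assms(2)] by blast
  obtain u where u: "u \<in> X" using S.block_nonsep[OF X(1)] unfolding S.nonsep_def by auto
  obtain v where v: "v \<in> Y" using S.block_nonsep[OF Y(1)] unfolding S.nonsep_def by auto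
  have "S.joined (verts G) u v"
    using S.conn_V u v S.block_subset[OF X(1)] S.block_subset[OF Y(1)] unfolding S.conn_def by blast
  then have "Inl (G \<restriction> X) \<rightarrow>\<^sup>*\<^bsub>bct\<^esub> Inl (G \<restriction> Y)"
    using bct_blocks_reachable[OF X(1) u _ Y(1) v] by blast
  then show ?thesis using X Y T.reachable_trans by blast
qed

text \<open>Otherwise the cutvertex at which \<open>Y\<close> hangs on \<open>X\<close> separates
  the two nodes in the tree and would be strictly more central.\<close>

lemma center_one_block:
  assumes X: "S.block X" "Inl (G \<restriction> X) \<in> graph_center bct" and Y: "S.block Y" "Inl (G \<restriction> Y) \<in> graph_center bct"
  shows "X = Y"
proof (rule ccontr)
  assume ne: "X \<noteq> Y"
  obtain y where y: "y \<in> Y" using Y(1) unfolding S.block_def S.nonsep_def by blast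
  define c where "c = S.root X y"
  have c: "c \<in> X" unfolding c_def using S.root_props(1)[OF X(1)] y S.block_subset[OF Y(1)] by blast
  have Yc: "z \<in> S.branch X c" if "z \<in> Y" for z
    using S.block_on_branch[OF X(1) Y(1) ne that y] that S.block_subset[OF Y(1)] unfolding c_def S.branch_def by blast
  obtain x where x: "x \<in> X" "x \<noteq> c" using distinct_blocks_two_vertices[OF X(1) Y(1) ne c] by blast
  obtain z where z: "z \<in> Y" "z \<noteq> c"
  proof (cases "c \<in> Y")
    case True
    then show ?thesis using distinct_blocks_two_vertices[OF Y(1) X(1)] ne that by metis
  next
    case False
    then show ?thesis using that y by blast
  qed
  have cut: "cutvertex G c" using branch_cutvertex[OF X(1) c x Yc[OF z(1)] z(2)] .
  \<comment> \<open>This labels the side of a node. For a block the vertex \<open>c\<close> is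
    disregarded, because blocks on both sides may contain it.\<close>
  define f where "f s = (case s of Inl H \<Rightarrow> verts H \<inter> (S.branch X c - {c}) \<noteq> {} | Inr d \<Rightarrow> d \<in> S.branch X c)"
    for s :: "('a, 'b) pre_digraph + 'a"
  have edge: "f (Inl (G \<restriction> Z)) = f (Inr d)" if Z: "S.block Z" "d \<in> Z" "d \<noteq> c" for Z d
  proof
    assume "f (Inr d)"
    then show "f (Inl (G \<restriction> Z))" using Z by (auto simp: f_def)
  next
    assume "f (Inl (G \<restriction> Z))"
    then obtain z where "z \<in> Z" "z \<in> S.branch X c - {c}" by (auto simp: f_def)
    moreover from this have "S.joined (Z - {c}) z d" using S.block_nonsep[OF Z(1)] Z(2,3) unfolding S.nonsep_def S.conn_def by blast
    ultimately show "f (Inr d)" using joined_stays_attached[OF S.attached_branch[OF X(1) c]] by (auto simp: f_def)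
  qed
  have "f s = f t" if "s \<rightarrow>\<^bsub>bct\<^esub> t" "s \<noteq> Inr c" "t \<noteq> Inr c" for s t
    using that(1) by (rule bct_edgeE) (use edge that(2,3) in auto)
  moreover have "\<not> f (Inl (G \<restriction> X))" using S.root_id[OF X(1)] by (auto simp: f_def S.branch_def)
  moreover have "f (Inl (G \<restriction> Y))" using Yc[OF z(1)] z by (auto simp: f_def)
  moreover have "Inr c \<in> verts bct" using cut unfolding verts_bct by blast
  ultimately show False using T.graph_center_not_separated[OF bct_reachable X(2) Y(2), of "Inr c" f] by blast
qed

text \<open>Here the separating node is the block at \<open>c\<close> in the direction of
  \<open>d\<close>.\<close>

lemma center_one_cutvertex:
  assumes c: "Inr c \<in> graph_center bct" and d: "Inr d \<in> graph_center bct"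
  shows "c = d"
proof (rule ccontr)
  assume ne: "c \<noteq> d"
  have "cutvertex G c" "cutvertex G d" using c d unfolding graph_center_def verts_bct by auto
  then have V: "c \<in> verts G" "d \<in> verts G" by (auto simp: cutvertex_iff)
  obtain B where B: "S.block B" "c \<in> B" "S.root B d \<noteq> c" using S.exists_block_towards[OF V ne[symmetric]] by blast
  \<comment> \<open>A node is labelled by the branch of \<open>B\<close> in which it lies. A block
    other than \<open>B\<close> lies in a single branch, so an arbitrary vertex of it gives the
    label.\<close>
  define f where "f s = S.root B (case s of Inl H \<Rightarrow> SOME v. v \<in> verts H | Inr e \<Rightarrow> e)"
    for s :: "('a, 'b) pre_digraph + 'a"
  have edge: "f (Inl (G \<restriction> Z)) = f (Inr e)" if Z: "S.block Z" "e \<in> Z" "Z \<noteq> B" for Z e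
    using S.block_on_branch[OF B(1) Z(1) Z(3)[symmetric], of "SOME v. v \<in> Z" e] someI[of "\<lambda>v. v \<in> Z" e] Z(2)
    by (simp add: f_def)
  have "f s = f t" if "s \<rightarrow>\<^bsub>bct\<^esub> t" "s \<noteq> Inl (G \<restriction> B)" "t \<noteq> Inl (G \<restriction> B)" for s t
    using that(1) by (rule bct_edgeE) (use edge that(2,3) in \<open>auto simp: induced_eq_iff\<close>)
  moreover have "f (Inr c) \<noteq> f (Inr d)" using B S.root_id[OF B(1,2)] by (simp add: f_def)
  moreover have "Inl (G \<restriction> B) \<in> verts bct" using B(1) unfolding verts_bct by blast
  ultimately show False using T.graph_center_not_separated[OF bct_reachable c d, of "Inl (G \<restriction> B)" f] by blast
qed

lemma aut_cutvertex:
  assumes "S.aut \<phi>" "cutvertex G c"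
  shows "cutvertex G (\<phi> c)"
proof -
  let ?i = "Hilbert_Choice.inv \<phi>"
  note inv = S.aut_inv_simps[OF assms(1)]
  have "?i ` (verts G - {\<phi> c}) = verts G - {c}"
    using image_set_diff[OF S.aut_inj[OF S.aut_inv[OF assms(1)]], of "verts G" "{\<phi> c}"]
      permutes_image[OF S.aut_permutes[OF S.aut_inv[OF assms(1)]]] inv by simp
  then show ?thesis
    using assms S.aut_conn[OF S.aut_inv[OF assms(1)], of "verts G - {\<phi> c}"] S.aut_V[OF assms(1)]
    unfolding cutvertex_iff by auto
qed

lemma aut_graph_center:
  assumes phi: "S.aut \<phi>" and u: "u \<in> graph_center bct"
  shows "map_sum (\<lambda>H. G \<restriction> (\<phi> ` verts H)) \<phi> u \<in> graph_center bct"
proof (rule T.graph_center_map[OF _ _ u])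
  fix s t assume "s \<rightarrow>\<^bsub>bct\<^esub> t"
  then show "map_sum (\<lambda>H. G \<restriction> (\<phi> ` verts H)) \<phi> s \<rightarrow>\<^bsub>bct\<^esub> map_sum (\<lambda>H. G \<restriction> (\<phi> ` verts H)) \<phi> t"
  proof (cases rule: bct_edgeE)
    case (1 X c)
    have "Inl (G \<restriction> (\<phi> ` X)) \<rightarrow>\<^bsub>bct\<^esub> Inr (\<phi> c)"
      by (rule bct_edges(1)[OF S.aut_block[OF phi 1(1)] aut_cutvertex[OF phi 1(2)] imageI[OF 1(3)]])
    then show ?thesis using 1(4,5) by simp
  next
    case (2 X c)
    have "Inr (\<phi> c) \<rightarrow>\<^bsub>bct\<^esub> Inl (G \<restriction> (\<phi> ` X))"
      by (rule bct_edges(2)[OF S.aut_block[OF phi 2(1)] aut_cutvertex[OF phi 2(2)] imageI[OF 2(3)]])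
    then show ?thesis using 2(4,5) by simp
  qed
next
  let ?h = "\<lambda>\<phi>. map_sum (\<lambda>H. G \<restriction> (\<phi> ` verts H)) \<phi>"
  have sub: "?h \<psi> s \<in> verts bct" if "S.aut \<psi>" "s \<in> verts bct" for \<psi> s
    using that S.aut_block[OF that(1)] aut_cutvertex[OF that(1)] unfolding verts_bct by auto
  have "s \<in> ?h \<phi> ` verts bct" if s: "s \<in> verts bct" for s
  proof -
    have "?h \<phi> (?h (Hilbert_Choice.inv \<phi>) s) = s"
      using s S.aut_inv_simps[OF phi] unfolding verts_bct by (auto simp: image_image)
    then show ?thesis using sub[OF S.aut_inv[OF phi] s] by (metis image_eqI)
  qed
  then show "?h \<phi> ` verts bct = verts bct" using sub[OF phi] by blast
qed

lemma central_block_invariant: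
  assumes "central_block G B"
  shows "\<exists>X. S.block X \<and> B = G \<restriction> X \<and> (\<forall>\<phi>. S.aut \<phi> \<longrightarrow> \<phi> ` X = X)"
proof -
  have c: "graph_center bct = {Inl B}" using assms unfolding central_block_def .
  then have "Inl B \<in> verts bct" unfolding graph_center_def by blast
  then obtain X where X: "S.block X" "B = G \<restriction> X" unfolding verts_bct by blast
  have "\<phi> ` X = X" if "S.aut \<phi>" for \<phi>
    using aut_graph_center[OF that, of "Inl B"] X c by (simp add: induced_eq_iff)
  then show ?thesis using X by blast
qed

text \<open>Uniqueness in the center is available only within each of the two kinds of nodes, and
  this suffices: a cutvertex in the center is fixed by every automorphism whether or not a block is
  in the center too, and without a cutvertex exactly one block remains.\<close>

lemma fixed_vertex_or_central_block:
  "(\<exists>c\<in>verts G. \<forall>\<phi>. S.aut \<phi> \<longrightarrow> \<phi> c = c) \<or> (\<exists>B. central_block G B)"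
proof (cases "\<exists>c. Inr c \<in> graph_center bct")
  case True
  then obtain c where c: "Inr c \<in> graph_center bct" by blast
  then have "c \<in> verts G" unfolding graph_center_def verts_bct by (auto simp: cutvertex_iff)
  moreover have "\<phi> c = c" if "S.aut \<phi>" for \<phi>
    by (rule center_one_cutvertex[OF _ c]) (use aut_graph_center[OF that c] in simp)
  ultimately show ?thesis by blast
next
  case False
  obtain u where "u \<in> verts G" using verts_nonempty by blast
  then have "S.nonsep {u}" using S.conn_path[of "[u]"] S.conn_path[of "[]"] unfolding S.nonsep_def
    by (auto simp: insert_Diff_if)
  then obtain X0 where "S.block X0" using S.nonsep_extends_to_block by blast
  then have "verts bct \<noteq> {}" unfolding verts_bct by blast
  then obtain s where s: "s \<in> graph_center bct" using T.graph_center_nonempty by blast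
  then obtain X where X: "S.block X" "s = Inl (G \<restriction> X)"
    using False unfolding graph_center_def verts_bct by auto
  have "graph_center bct = {Inl (G \<restriction> X)}"
  proof -
    have "t = Inl (G \<restriction> X)" if t: "t \<in> graph_center bct" for t
    proof -
      have "t \<in> verts bct" using t unfolding graph_center_def by blast
      then obtain Y where "S.block Y" "t = Inl (G \<restriction> Y)" using False t unfolding verts_bct by blast
      then show ?thesis using center_one_block[OF X(1) _ _] s X(2) t by metis
    qed
    then show ?thesis using s X(2) by blast
  qed
  then show ?thesis unfolding central_block_def by blast
qed

end

section \<open>Determining sets of outerplanar graphs\<close>

locale outerplanar_bc_graph = bc_graph +
  assumes outerplanar_G: "outerplanar G"
begin

sublocale S: outerplanar_graph "verts G" "\<lambda>u v. u \<rightarrow>\<^bsub>G\<^esub> v"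
proof -
  obtain p \<gamma> where "plane_drawing G p \<gamma>" "p ` verts G \<subseteq> frontier (outside (drawing_points G p \<gamma>))"
    using outerplanar_G unfolding outerplanar_def by blast
  moreover have "graph G" by unfold_locales
  ultimately interpret D: outerplanar_drawing G p \<gamma> by unfold_locales
  show "outerplanar_graph (verts G) (\<lambda>u v. u \<rightarrow>\<^bsub>G\<^esub> v)"
  proof
    fix a us b vs ws
    assume "successively (\<lambda>u v. u \<rightarrow>\<^bsub>G\<^esub> v) (a # us @ [b])" "distinct (a # us @ [b])" "us \<noteq> []"
      "successively (\<lambda>u v. u \<rightarrow>\<^bsub>G\<^esub> v) (a # vs @ [b])" "distinct (a # vs @ [b])" "vs \<noteq> []"
      "successively (\<lambda>u v. u \<rightarrow>\<^bsub>G\<^esub> v) (a # ws @ [b])" "distinct (a # ws @ [b])" and ws: "ws \<noteq> []"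
      and "set us \<inter> set vs = {}" "set us \<inter> set ws = {}" "set vs \<inter> set ws = {}"
    then have "ws = []" by (intro D.third_path_enclosed(1)[of a us b vs ws])
    then show False using ws by contradiction
  next
    fix a us b vs x y
    assume "successively (\<lambda>u v. u \<rightarrow>\<^bsub>G\<^esub> v) (a # us @ [b])" "distinct (a # us @ [b])"
      "successively (\<lambda>u v. u \<rightarrow>\<^bsub>G\<^esub> v) (a # vs @ [b])" "distinct (a # vs @ [b])"
      "set us \<inter> set vs = {}" "a \<rightarrow>\<^bsub>G\<^esub> b" "x \<in> set us" "y \<in> set vs"
    then show "\<not> x \<rightarrow>\<^bsub>G\<^esub> y" by (rule D.no_crossing_chords)
  qed
qed

section \<open>Determining sets as sets meeting all circuits\<close>

lemma automorphisms_iff: "\<phi> \<in> automorphisms G \<longleftrightarrow> (\<exists>\<psi>. S.aut \<psi> \<and> \<phi> = restrict \<psi> (verts G))"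
proof
  assume a: "\<phi> \<in> automorphisms G"
  let ?p = "\<lambda>x. if x \<in> verts G then \<phi> x else x"
  have b: "bij_betw \<phi> (verts G) (verts G)" and ext: "\<phi> \<in> extensional (verts G)"
    using a by (auto simp: automorphisms_def Bij_def)
  have "bij_betw ?p (verts G) (verts G)" using b by (auto simp: bij_betw_def inj_on_def)
  then have perm: "?p permutes verts G" by (rule bij_imp_permutes) simp
  have "?p u \<rightarrow>\<^bsub>G\<^esub> ?p v \<longleftrightarrow> u \<rightarrow>\<^bsub>G\<^esub> v" for u v
  proof (cases "u \<in> verts G \<and> v \<in> verts G")
    case True
    then show ?thesis using a unfolding automorphisms_def by auto
  next
    case False
    then have "\<not> (?p u \<in> verts G \<and> ?p v \<in> verts G)"
      using permutes_in_image[OF perm, of u] permutes_in_image[OF perm, of v] by blast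
    then have "\<not> ?p u \<rightarrow>\<^bsub>G\<^esub> ?p v" using S.adj_V[of "?p u" "?p v"] by blast
    moreover have "\<not> u \<rightarrow>\<^bsub>G\<^esub> v" using False S.adj_V[of u v] by blast
    ultimately show ?thesis by blast
  qed
  with perm have "S.aut ?p" unfolding S.aut_def by (intro conjI allI)
  moreover have "\<phi> = restrict ?p (verts G)" using ext by (auto simp: extensional_def fun_eq_iff)
  ultimately show "\<exists>\<psi>. S.aut \<psi> \<and> \<phi> = restrict \<psi> (verts G)" by blast
next
  assume "\<exists>\<psi>. S.aut \<psi> \<and> \<phi> = restrict \<psi> (verts G)"
  then obtain \<psi> where psi: "S.aut \<psi>" "\<phi> = restrict \<psi> (verts G)" by blast
  have "bij_betw \<psi> (verts G) (verts G)" using permutes_imp_bij[OF S.aut_permutes[OF psi(1)]] .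
  then have "\<phi> \<in> Bij (verts G)"
    using psi(2) by (simp add: Bij_def bij_betw_def inj_on_def cong: image_cong_simp)
  then show "\<phi> \<in> automorphisms G" using psi S.aut_adj[OF psi(1)] by (simp add: automorphisms_def)
qed

lemma restrict_aut_eq_iff:
  assumes "S.aut \<phi>" "S.aut \<psi>"
  shows "restrict \<phi> (verts G) = restrict \<psi> (verts G) \<longleftrightarrow> \<phi> = \<psi>"
proof
  assume r: "restrict \<phi> (verts G) = restrict \<psi> (verts G)"
  have "\<phi> x = \<psi> x" for x
  proof (cases "x \<in> verts G")
    case True
    then show ?thesis using fun_cong[OF r, of x] by simp
  next
    case False
    then show ?thesis using permutes_not_in S.aut_permutes assms by metis
  qed
  then show "\<phi> = \<psi>" by blast
qed simp

lemma carrier_aut_group: "carrier (aut_group G) = automorphisms G"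
  by (simp add: aut_group_def)

lemma one_aut_group: "\<one>\<^bsub>aut_group G\<^esub> = restrict id (verts G)"
  by (simp add: aut_group_def BijGroup_def id_def)

lemma ball_automorphisms:
  "(\<forall>\<phi>\<in>automorphisms G. P \<phi>) \<longleftrightarrow> (\<forall>\<psi>. S.aut \<psi> \<longrightarrow> P (restrict \<psi> (verts G)))"
  unfolding Ball_def automorphisms_iff by blast

lemma determining_iff:
  "determining_set G R \<longleftrightarrow> R \<subseteq> verts G \<and> (\<forall>\<phi>. S.aut \<phi> \<longrightarrow> (\<forall>v\<in>R. \<phi> v = v) \<longrightarrow> \<phi> = id)"
proof (cases "R \<subseteq> verts G")
  case True
  then have eq: "(\<forall>v\<in>R. restrict \<phi> (verts G) v = v) \<longleftrightarrow> (\<forall>v\<in>R. \<phi> v = v)" for \<phi> by auto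
  show ?thesis
    unfolding determining_set_def carrier_aut_group one_aut_group ball_automorphisms eq
    using True restrict_aut_eq_iff[OF _ S.aut_id] by blast
qed (simp add: determining_set_def)

definition circuits :: "'a set set" where
  "circuits = S.moved ` {\<phi>. S.minaut \<phi>}"

text \<open>An eliminating automorphism need not be minimal: its moved set contains that of a
  minimal one, and this is the circuit required.\<close>

lemma circuit_clutter_circuits:
  assumes elim: "\<And>\<phi> \<psi> e. \<lbrakk>S.minaut \<phi>; S.minaut \<psi>; S.moved \<phi> \<noteq> S.moved \<psi>; e \<in> S.moved \<phi>; e \<in> S.moved \<psi>\<rbrakk>
    \<Longrightarrow> \<exists>\<theta>. S.aut \<theta> \<and> \<theta> \<noteq> id \<and> S.moved \<theta> \<subseteq> S.moved \<phi> \<union> S.moved \<psi> - {e}"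
  shows "circuit_clutter circuits"
proof
  fix M assume "M \<in> circuits"
  then obtain \<phi> where phi: "S.minaut \<phi>" "M = S.moved \<phi>" unfolding circuits_def by blast
  show "finite M" using phi S.moved_subset[OF S.minautD(1)] finite_subset[OF _ finite_verts] by blast
  fix N assume "N \<in> circuits"
  then obtain \<psi> where psi: "S.minaut \<psi>" "N = S.moved \<psi>" unfolding circuits_def by blast
  show "M = N" if "M \<subseteq> N" using that phi psi S.minautD(3)[OF psi(1) S.minautD(1,2)[OF phi(1)]] by simp
  fix e assume "M \<noteq> N" "e \<in> M" "e \<in> N"
  then obtain \<theta> where "S.aut \<theta>" "\<theta> \<noteq> id" "S.moved \<theta> \<subseteq> M \<union> N - {e}" using elim phi psi by blast
  moreover from this obtain \<tau> where "S.minaut \<tau>" "S.moved \<tau> \<subseteq> S.moved \<theta>" using S.exists_minaut by blast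
  ultimately show "\<exists>L\<in>circuits. L \<subseteq> M \<union> N - {e}" unfolding circuits_def by blast
qed

lemma determining_iff_hits:
  "determining_set G R \<longleftrightarrow> R \<subseteq> verts G \<and> (\<forall>M\<in>circuits. M \<inter> R \<noteq> {})"
proof -
  have "(\<forall>\<phi>. S.aut \<phi> \<longrightarrow> (\<forall>v\<in>R. \<phi> v = v) \<longrightarrow> \<phi> = id) \<longleftrightarrow> (\<forall>M\<in>circuits. M \<inter> R \<noteq> {})" (is "?l = ?r")
  proof
    assume ?l
    show ?r
    proof
      fix M assume "M \<in> circuits"
      then obtain \<phi> where phi: "S.minaut \<phi>" "M = S.moved \<phi>" unfolding circuits_def by blast
      then have "\<not> (\<forall>v\<in>R. \<phi> v = v)" using \<open>?l\<close> S.minautD(1,2)[OF phi(1)] by blast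
      then show "M \<inter> R \<noteq> {}" using phi(2) unfolding S.moved_def by blast
    qed
  next
    assume r: ?r
    show ?l
    proof (intro allI impI, rule ccontr)
      fix \<phi> assume phi: "S.aut \<phi>" "\<forall>v\<in>R. \<phi> v = v" "\<phi> \<noteq> id"
      then obtain \<tau> where t: "S.minaut \<tau>" "S.moved \<tau> \<subseteq> S.moved \<phi>" using S.exists_minaut by blast
      then have "S.moved \<tau> \<inter> R \<noteq> {}" using r unfolding circuits_def by blast
      then show False using t(2) phi(2) unfolding S.moved_def by blast
    qed
  qed
  then show ?thesis unfolding determining_iff by simp
qed

lemma exchange_property_of_elimination:
  assumes "circuit_clutter circuits"
  shows "exchange_property G"
proof -
  interpret C: circuit_clutter circuits by (rule assms)
  have iff: "minimal_determining_set G R \<longleftrightarrow> R \<subseteq> verts G \<and> C.minimal_transversal R" for R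
  proof -
    have "determining_set G T \<longleftrightarrow> T \<subseteq> verts G \<and> C.transversal T" for T
      unfolding determining_iff_hits C.transversal_def ..
    then show ?thesis
      unfolding minimal_determining_set_def C.minimal_transversal_def
      by (meson psubset_imp_subset subset_trans)
  qed
  show ?thesis
    unfolding exchange_property_def
  proof (intro allI impI ballI)
    fix Q R r assume a: "minimal_determining_set G Q" "minimal_determining_set G R" "r \<in> R"
    then obtain s where "s \<in> Q" "C.minimal_transversal ((Q - {s}) \<union> {r})"
      using C.minimal_transversal_exchange iff by blast
    moreover have "(Q - {s}) \<union> {r} \<subseteq> verts G" using a iff by blast
    ultimately show "\<exists>s\<in>Q. minimal_determining_set G ((Q - {s}) \<union> {r})" using iff by blast
  qed
qed

section \<open>Reflections of a block with trivial stabilizer\<close>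

lemma stab_trivial_iff:
  assumes "X \<subseteq> verts G"
  shows "stab G (G \<restriction> X) = {\<one>\<^bsub>aut_group G\<^esub>} \<longleftrightarrow> (\<forall>\<phi>. S.aut \<phi> \<longrightarrow> (\<forall>v\<in>X. \<phi> v = v) \<longrightarrow> \<phi> = id)"
proof -
  have "stab G (G \<restriction> X) = (\<lambda>\<phi>. restrict \<phi> (verts G)) ` {\<phi>. S.aut \<phi> \<and> (\<forall>v\<in>X. \<phi> v = v)}"
  proof (intro Set.set_eqI iffI)
    have eq: "(\<forall>v\<in>X. restrict \<phi> (verts G) v = v) \<longleftrightarrow> (\<forall>v\<in>X. \<phi> v = v)" for \<phi> using assms by auto
    fix \<theta>
    show "\<theta> \<in> (\<lambda>\<phi>. restrict \<phi> (verts G)) ` {\<phi>. S.aut \<phi> \<and> (\<forall>v\<in>X. \<phi> v = v)}" if "\<theta> \<in> stab G (G \<restriction> X)"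
      using that eq unfolding stab_def carrier_aut_group automorphisms_iff induce_subgraph_verts by blast
    show "\<theta> \<in> stab G (G \<restriction> X)" if "\<theta> \<in> (\<lambda>\<phi>. restrict \<phi> (verts G)) ` {\<phi>. S.aut \<phi> \<and> (\<forall>v\<in>X. \<phi> v = v)}"
      using that eq unfolding stab_def carrier_aut_group automorphisms_iff induce_subgraph_verts by blast
  qed
  moreover have "inj_on (\<lambda>\<phi>. restrict \<phi> (verts G)) {\<phi>. S.aut \<phi>}"
    using restrict_aut_eq_iff by (auto simp: inj_on_def)
  ultimately have "stab G (G \<restriction> X) = (\<lambda>\<phi>. restrict \<phi> (verts G)) ` {id} \<longleftrightarrow>
      {\<phi>. S.aut \<phi> \<and> (\<forall>v\<in>X. \<phi> v = v)} = {id}"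
    using S.aut_id by (simp only:) (rule inj_on_image_eq_iff, auto)
  then show ?thesis unfolding one_aut_group using S.aut_id by auto
qed

text \<open>An invariant block is preserved by all automorphisms, and with trivial stabilizer the
  cosets are singletons, so the quotient group can be replaced by the automorphisms
  themselves.\<close>

lemma reflections_eq:
  assumes X: "X \<subseteq> verts G" and inv: "\<And>\<phi>. S.aut \<phi> \<Longrightarrow> \<phi> ` X = X"
    and st: "stab G (G \<restriction> X) = {\<one>\<^bsub>aut_group G\<^esub>}"
  shows "reflections G (G \<restriction> X) = {{restrict \<phi> (verts G)} | \<phi>. S.aut \<phi> \<and> \<phi> \<noteq> id \<and>
    (card X = 2 \<or> (\<exists>vs. hamilton_cycle (G \<restriction> X) vs \<and> cycle_reflection vs \<phi>))}"
proof -
  let ?I = "invar_group G (G \<restriction> X)"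
  have im: "restrict \<phi> (verts G) ` X = X" if "S.aut \<phi>" for \<phi>
  proof -
    have "restrict \<phi> (verts G) ` X = \<phi> ` X" using X by (intro image_cong) auto
    then show ?thesis using inv[OF that] by simp
  qed
  then have "\<phi> ` X = X" if "\<phi> \<in> automorphisms G" for \<phi> using that unfolding automorphisms_iff by blast
  then have carr: "carrier ?I = automorphisms G" by (auto simp: invar_group_def carrier_aut_group)
  have coset: "stab G (G \<restriction> X) #>\<^bsub>?I\<^esub> \<theta> = {\<theta>}" if "\<theta> \<in> automorphisms G" for \<theta>
  proof -
    interpret A: group "aut_group G" by (rule group_aut_group)
    show ?thesis using that carrier_aut_group by (simp add: r_coset_def st invar_group_def)
  qed
  have carr2: "carrier (block_aut_group G (G \<restriction> X)) = {{\<theta>} | \<theta>. \<theta> \<in> automorphisms G}"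
    using coset carr by (auto simp: block_aut_group_def FactGroup_def RCOSETS_def)
  have one: "\<one>\<^bsub>block_aut_group G (G \<restriction> X)\<^esub> = {restrict id (verts G)}"
    using st one_aut_group by (simp add: block_aut_group_def FactGroup_def)
  have act: "cycle_reflection vs (coset_action {restrict \<phi> (verts G)}) \<longleftrightarrow> cycle_reflection vs \<phi>"
    if "hamilton_cycle (G \<restriction> X) vs" for vs \<phi>
  proof -
    have "vs ! i \<in> verts G" if "i < length vs" for i
      using \<open>hamilton_cycle _ vs\<close> that X nth_mem by (fastforce simp: hamilton_cycle_def)
    then show ?thesis unfolding cycle_reflection_def coset_action_def by (simp cong: conj_cong)
  qed
  show ?thesis
  proof (intro Set.set_eqI iffI)
    fix Y assume "Y \<in> reflections G (G \<restriction> X)"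
    then have Y: "Y \<in> carrier (block_aut_group G (G \<restriction> X))" "Y \<noteq> {restrict id (verts G)}"
      "card X = 2 \<or> (\<exists>vs. hamilton_cycle (G \<restriction> X) vs \<and> cycle_reflection vs (coset_action Y))"
      unfolding reflections_def one by auto
    from Y(1) obtain \<theta> where t: "\<theta> \<in> automorphisms G" "Y = {\<theta>}" unfolding carr2 by blast
    then obtain \<phi> where phi: "S.aut \<phi>" "Y = {restrict \<phi> (verts G)}" unfolding automorphisms_iff by blast
    moreover from this have "\<phi> \<noteq> id" using Y(2) by blast
    moreover have "card X = 2 \<or> (\<exists>vs. hamilton_cycle (G \<restriction> X) vs \<and> cycle_reflection vs \<phi>)"
      using Y(3) act unfolding phi(2) by blast
    ultimately show "Y \<in> {{restrict \<phi> (verts G)} | \<phi>. S.aut \<phi> \<and> \<phi> \<noteq> id \<and>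
      (card X = 2 \<or> (\<exists>vs. hamilton_cycle (G \<restriction> X) vs \<and> cycle_reflection vs \<phi>))}" by blast
  next
    fix Y assume "Y \<in> {{restrict \<phi> (verts G)} | \<phi>. S.aut \<phi> \<and> \<phi> \<noteq> id \<and>
      (card X = 2 \<or> (\<exists>vs. hamilton_cycle (G \<restriction> X) vs \<and> cycle_reflection vs \<phi>))}"
    then obtain \<phi> where phi: "S.aut \<phi>" "\<phi> \<noteq> id" "Y = {restrict \<phi> (verts G)}"
      "card X = 2 \<or> (\<exists>vs. hamilton_cycle (G \<restriction> X) vs \<and> cycle_reflection vs \<phi>)" by blast
    have "restrict \<phi> (verts G) \<in> automorphisms G" unfolding automorphisms_iff using phi(1) by blast
    then have "Y \<in> carrier (block_aut_group G (G \<restriction> X))" unfolding carr2 phi(3) by blast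
    moreover have "Y \<noteq> {restrict id (verts G)}" using phi restrict_aut_eq_iff[OF _ S.aut_id] by auto
    moreover have "card (verts (G \<restriction> X)) = 2 \<or>
      (\<exists>vs. hamilton_cycle (G \<restriction> X) vs \<and> cycle_reflection vs (coset_action Y))" using phi act by auto
    ultimately show "Y \<in> reflections G (G \<restriction> X)" unfolding reflections_def one by blast
  qed
qed

lemma hamilton_cycle_of_cycle:
  assumes "S.cycle ws"
  shows "hamilton_cycle (G \<restriction> set ws) ws"
proof -
  have w: "length ws \<ge> 3" "distinct ws" "successively (\<lambda>u v. u \<rightarrow>\<^bsub>G\<^esub> v) ws" "last ws \<rightarrow>\<^bsub>G\<^esub> hd ws"
    using assms unfolding S.cycle_def by auto
  have "ws ! i \<rightarrow>\<^bsub>G \<restriction> set ws\<^esub> ws ! ((i + 1) mod length ws)" if i: "i < length ws" for i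
  proof -
    have "ws ! i \<rightarrow>\<^bsub>G\<^esub> ws ! ((i + 1) mod length ws)"
    proof (cases "i + 1 < length ws")
      case True
      then show ?thesis using w(3) by (simp add: successively_conv_nth)
    next
      case False
      then have "i = length ws - 1" "ws \<noteq> []" using i by auto
      then show ?thesis using w(4) by (simp add: last_conv_nth hd_conv_nth)
    qed
    moreover have "ws ! i \<in> set ws" "ws ! ((i + 1) mod length ws) \<in> set ws"
      using i by (auto intro!: nth_mem mod_less_divisor)
    ultimately show ?thesis unfolding arcs_ends_conv by auto
  qed
  then show ?thesis using w unfolding hamilton_cycle_def by simp
qed

end

section \<open>An invariant block with trivial pointwise stabilizer\<close>

locale rigid_central_block = outerplanar_bc_graph +
  fixes X :: "'a set"
  assumes block_X: "S.block X"
    and invariant: "S.aut \<phi> \<Longrightarrow> \<phi> ` X = X"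
    and rigid: "S.aut \<phi> \<Longrightarrow> (\<And>v. v \<in> X \<Longrightarrow> \<phi> v = v) \<Longrightarrow> \<phi> = id"
begin

lemma X_verts: "X \<subseteq> verts G"
  by (rule S.block_subset[OF block_X])

lemma reflections_X:
  "reflections G (G \<restriction> X) = {{restrict \<phi> (verts G)} | \<phi>. S.aut \<phi> \<and> \<phi> \<noteq> id \<and>
    (card X = 2 \<or> (\<exists>vs. hamilton_cycle (G \<restriction> X) vs \<and> cycle_reflection vs \<phi>))}"
  by (rule reflections_eq[OF X_verts invariant]) (use stab_trivial_iff[OF X_verts] rigid in blast)+

lemma moves_block_vertex:
  assumes "S.aut \<phi>" "\<phi> \<noteq> id"
  obtains b where "b \<in> X" "\<phi> b \<noteq> b"
  using rigid assms by blast

text \<open>By rigidity \<open>\<phi>\<close> moves a vertex of the block, so there are at least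
  three vertices and \<open>\<phi>\<close> reverses a Hamilton cycle about \<open>u\<close>.\<close>

lemma reflection_fixing_vertex:
  assumes phi: "S.aut \<phi>" "\<phi> \<noteq> id" and u: "u \<in> X" "\<phi> u = u"
  shows "{restrict \<phi> (verts G)} \<in> reflections G (G \<restriction> X)"
proof -
  obtain b where b: "b \<in> X" "\<phi> b \<noteq> b" using moves_block_vertex[OF phi] .
  have card: "card X \<ge> 3" by (rule S.card_block_ge_3[OF block_X u(1) phi(1) invariant[OF phi(1)] u(2) b])
  obtain ws where ws: "S.cycle ws" "set ws = X"
    and refl: "\<forall>\<phi>. S.aut \<phi> \<and> \<phi> ` X = X \<and> \<phi> u = u \<and> (\<exists>b\<in>X. \<phi> b \<noteq> b) \<longrightarrow>
      (\<forall>i<length ws. \<phi> (ws ! i) = ws ! ((length ws - i) mod length ws))"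
    using S.block_reflection[OF block_X u(1) card] by blast
  have "\<forall>i<length ws. \<phi> (ws ! i) = ws ! ((length ws - i) mod length ws)"
    using refl phi(1) invariant[OF phi(1)] u(2) b by blast
  then have "cycle_reflection ws \<phi>" unfolding cycle_reflection_def by (intro exI[of _ 0]) simp
  moreover have "hamilton_cycle (G \<restriction> X) ws" using hamilton_cycle_of_cycle[OF ws(1)] ws(2) by simp
  ultimately show ?thesis unfolding reflections_X using phi by blast
qed

lemma reflectionE:
  assumes "\<rho> \<in> reflections G (G \<restriction> X)"
  obtains \<phi> where "S.aut \<phi>" "\<phi> \<noteq> id" "\<rho> = {restrict \<phi> (verts G)}"
  using assms unfolding reflections_X by blast

lemma coset_action_restrict: "v \<in> X \<Longrightarrow> coset_action {restrict \<phi> (verts G)} v = \<phi> v"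
  using X_verts by (auto simp: coset_action_def)

lemma eq_of_common_fixed_vertex:
  assumes "S.aut \<phi>" "\<phi> \<noteq> id" "S.aut \<psi>" "\<psi> \<noteq> id" "u \<in> X" "\<phi> u = u" "\<psi> u = u"
  shows "\<phi> = \<psi>"
proof -
  obtain b where b: "b \<in> X" "\<phi> b \<noteq> b" using moves_block_vertex[OF assms(1,2)] .
  obtain c where c: "c \<in> X" "\<psi> c \<noteq> c" using moves_block_vertex[OF assms(3,4)] .
  let ?t = "Hilbert_Choice.inv \<psi> \<circ> \<phi>"
  have "\<phi> x = \<psi> x" if "x \<in> X" for x
    using S.reflections_agree[OF block_X assms(5,1) invariant[OF assms(1)] assms(6) b assms(3) invariant[OF assms(3)] assms(7) c that] .
  then have "?t x = x" if "x \<in> X" for x using that S.aut_inv_simps[OF assms(3)] by simp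
  then have "?t = id" using rigid[OF S.aut_comp[OF S.aut_inv[OF assms(3)] assms(1)]] by blast
  then show ?thesis using S.aut_inv_simps(1)[OF assms(3)] by (metis comp_apply ext id_apply)
qed

text \<open>Cut down to the branch at \<open>w\<close>, the automorphism fixes all of
  \<open>X\<close> and is therefore trivial by rigidity.\<close>

lemma fixes_branch:
  assumes phi: "S.aut \<phi>" and w: "w \<in> X" "\<phi> w = w" and e: "e \<in> S.branch X w"
  shows "\<phi> e = e"
proof (rule ccontr)
  assume ne: "\<phi> e \<noteq> e"
  let ?K = "S.branch X w - {w}"
  have "S.aut (S.restr \<phi> ?K)"
    by (rule S.aut_restr[OF phi S.attached_branch[OF block_X w(1)] S.aut_branch[OF phi block_X invariant[OF phi] w(2)] w(2)])
  moreover have "S.restr \<phi> ?K v = v" if "v \<in> X" for v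
    using S.root_id[OF block_X that] unfolding S.restr_def S.branch_def by auto
  ultimately have "S.restr \<phi> ?K = id" using rigid by blast
  then have "S.restr \<phi> ?K e = e" by simp
  moreover have "e \<in> ?K" using e ne w by auto
  ultimately show False using ne by (simp add: S.restr_def)
qed

lemma not_exchange_property:
  assumes w: "w \<in> X" "\<And>\<rho>. \<rho> \<in> reflections G (G \<restriction> X) \<Longrightarrow> coset_action \<rho> w \<noteq> w"
    and uv: "u \<in> X" "v \<in> X" "u \<noteq> v"
    and rs: "\<rho> \<in> reflections G (G \<restriction> X)" "\<sigma> \<in> reflections G (G \<restriction> X)" "\<rho> \<noteq> \<sigma>"
    and fixed: "coset_action \<rho> u = u" "coset_action \<sigma> v = v"
  shows "\<not> exchange_property G"
proof
  assume ex: "exchange_property G"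
  obtain \<phi> where phi: "S.aut \<phi>" "\<phi> \<noteq> id" "\<rho> = {restrict \<phi> (verts G)}" using reflectionE[OF rs(1)] .
  obtain \<psi> where psi: "S.aut \<psi>" "\<psi> \<noteq> id" "\<sigma> = {restrict \<psi> (verts G)}" using reflectionE[OF rs(2)] .
  have fx: "\<phi> u = u" "\<psi> v = v" using fixed coset_action_restrict uv phi psi by simp_all
  have nd: "\<not> determining_set G R" if "R \<subseteq> {u} \<or> R \<subseteq> {v}" for R
  proof
    assume "determining_set G R"
    then have d: "\<And>\<phi>. S.aut \<phi> \<Longrightarrow> (\<forall>x\<in>R. \<phi> x = x) \<Longrightarrow> \<phi> = id" unfolding determining_iff by blast
    from that show False
    proof
      assume "R \<subseteq> {u}"
      then show False using d[OF phi(1)] fx phi(2) by blast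
    next
      assume "R \<subseteq> {v}"
      then show False using d[OF psi(1)] fx psi(2) by blast
    qed
  qed
  \<comment> \<open>A nonidentity automorphism fixing \<open>w\<close> would be a reflection fixing
    \<open>w\<close>.\<close>
  have "determining_set G {w}"
    unfolding determining_iff
  proof (intro conjI allI impI)
    show "{w} \<subseteq> verts G" using w X_verts by blast
    fix \<theta> assume t: "S.aut \<theta>" "\<forall>x\<in>{w}. \<theta> x = x"
    show "\<theta> = id"
    proof (rule ccontr)
      assume "\<theta> \<noteq> id"
      then have "{restrict \<theta> (verts G)} \<in> reflections G (G \<restriction> X)"
        using reflection_fixing_vertex[OF t(1) _ w(1)] t(2) by blast
      then have "coset_action {restrict \<theta> (verts G)} w \<noteq> w" by (rule w(2))
      then show False using coset_action_restrict[OF w(1)] t(2) by simp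
    qed
  qed
  moreover have "\<not> determining_set G T" if "T \<subset> {w}" for T using nd[of T] that by blast
  ultimately have m1: "minimal_determining_set G {w}" unfolding minimal_determining_set_def by blast
  \<comment> \<open>The only nonidentity automorphism fixing \<open>u\<close> is
    \<open>\<phi>\<close> and the only one fixing \<open>v\<close> is \<open>\<psi>\<close>, and
    these two differ.\<close>
  have "determining_set G {u, v}"
    unfolding determining_iff
  proof (intro conjI allI impI)
    show "{u, v} \<subseteq> verts G" using uv X_verts by blast
    fix \<theta> assume t: "S.aut \<theta>" "\<forall>x\<in>{u, v}. \<theta> x = x"
    show "\<theta> = id"
    proof (rule ccontr)
      assume "\<theta> \<noteq> id"
      then have "\<theta> = \<phi>" "\<theta> = \<psi>"
        using eq_of_common_fixed_vertex[OF t(1) _ phi(1,2) uv(1)] eq_of_common_fixed_vertex[OF t(1) _ psi(1,2) uv(2)]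
          t(2) fx by auto
      then show False using phi(3) psi(3) rs(3) by simp
    qed
  qed
  moreover have "\<not> determining_set G T" if "T \<subset> {u, v}" for T
  proof -
    have "T \<subseteq> {u} \<or> T \<subseteq> {v}" using that by blast
    then show ?thesis by (rule nd)
  qed
  ultimately have m2: "minimal_determining_set G {u, v}" unfolding minimal_determining_set_def by blast
  \<comment> \<open>Bringing \<open>u\<close> into \<open>{w}\<close> can only yield
    \<open>{u}\<close>, whose vertex is fixed by the nonidentity \<open>\<phi>\<close>.\<close>
  obtain s where "s \<in> {w}" "minimal_determining_set G (({w} - {s}) \<union> {u})"
    using ex m1 m2 unfolding exchange_property_def by blast
  then show False using nd[of "{u}"] unfolding minimal_determining_set_def by auto
qed

end

section \<open>From a failing elimination to the central block\<close>

context outerplanar_bc_graph begin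

lemma central_block_of_failed_elimination:
  assumes phi: "S.minaut \<phi>" and psi: "S.minaut \<psi>" and ne: "S.moved \<phi> \<noteq> S.moved \<psi>"
    and e: "e \<in> S.moved \<phi>" "e \<in> S.moved \<psi>"
    and fail: "\<And>\<theta>. S.aut \<theta> \<Longrightarrow> S.moved \<theta> \<subseteq> S.moved \<phi> \<union> S.moved \<psi> - {e} \<Longrightarrow> \<theta> = id"
  shows "\<exists>B. central_block G B \<and>
      stab G B = {\<one>\<^bsub>aut_group G\<^esub>} \<and>
      (\<exists>v \<in> verts B. \<forall>\<rho> \<in> reflections G B. coset_action \<rho> v \<noteq> v) \<and>
      (\<exists>u \<in> verts B. \<exists>v \<in> verts B. u \<noteq> v \<and>
        (\<exists>\<rho> \<in> reflections G B. \<exists>\<sigma> \<in> reflections G B.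
          \<rho> \<noteq> \<sigma> \<and> coset_action \<rho> u = u \<and> coset_action \<sigma> v = v))"
proof -
  note ap = S.minautD(1,2)[OF phi] and aq = S.minautD(1,2)[OF psi]
  have nofix: "\<phi> a \<noteq> a \<or> \<psi> a \<noteq> a" if "a \<in> verts G" for a
    using S.elimination_common_fixed_vertex[OF phi psi ne e that] fail by blast
  obtain B where central: "central_block G B"
    using fixed_vertex_or_central_block nofix ap aq by blast
  obtain X where X: "S.block X" "B = G \<restriction> X" and inv: "\<And>\<phi>. S.aut \<phi> \<Longrightarrow> \<phi> ` X = X"
    using central_block_invariant[OF central] by auto
  \<comment> \<open>A nonidentity automorphism fixing \<open>X\<close> pointwise moves something in
    a branch; cut down to this branch it still fixes the vertex \<open>c\<close> at which the branch
    hangs.\<close>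
  have rigid: "\<gamma> = id" if g: "S.aut \<gamma>" "\<And>v. v \<in> X \<Longrightarrow> \<gamma> v = v" for \<gamma>
  proof (rule ccontr)
    assume "\<gamma> \<noteq> id"
    then obtain x where x: "\<gamma> x \<noteq> x" by (metis eq_id_iff)
    then have xV: "x \<in> verts G" using S.moved_subset[OF g(1)] unfolding S.moved_def by blast
    define c where "c = S.root X x"
    have c: "c \<in> X" "c \<in> verts G" using S.root_props(1)[OF X(1) xV] S.block_subset[OF X(1)] unfolding c_def by auto
    let ?K = "S.branch X c - {c}"
    have xK: "x \<in> ?K" using x g(2)[OF c(1)] xV unfolding c_def S.branch_def by auto
    have r: "S.aut (S.restr \<gamma> ?K)"
      by (rule S.aut_restr[OF g(1) S.attached_branch[OF X(1) c(1)] S.aut_branch[OF g(1) X(1) inv[OF g(1)] g(2)[OF c(1)]] g(2)[OF c(1)]])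
    have "S.restr \<gamma> ?K x \<noteq> x" using x xK by (simp add: S.restr_def)
    then have rn: "S.restr \<gamma> ?K \<noteq> id" by auto
    have rK: "S.moved (S.restr \<gamma> ?K) \<subseteq> ?K" unfolding S.moved_def S.restr_def by auto
    \<comment> \<open>A minimal automorphism moving \<open>c\<close> would move the whole branch and
      so have a moved set properly containing that of the restriction. Hence \<open>\<phi>\<close>
      and \<open>\<psi>\<close> would both fix \<open>c\<close>.\<close>
    have "\<eta> c = c" if h: "S.minaut \<eta>" for \<eta>
    proof (rule ccontr)
      assume "\<eta> c \<noteq> c"
      then have "S.branch X c \<subseteq> S.moved \<eta>"
        using S.branch_moved[OF S.minautD(1)[OF h] X(1) inv[OF S.minautD(1)[OF h]]] by blast
      moreover from this have "S.moved (S.restr \<gamma> ?K) = S.moved \<eta>" using S.minautD(3)[OF h r rn] rK by blast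
      moreover have "c \<in> S.branch X c" using c S.root_id[OF X(1)] unfolding S.branch_def by simp
      ultimately show False using rK by blast
    qed
    then show False using nofix[OF c(2)] phi psi by blast
  qed
  interpret R: rigid_central_block G X
    by unfold_locales (use X inv rigid in blast)+
  \<comment> \<open>\<open>moved \<phi>\<close> is not everything, as it would then contain
    \<open>moved \<psi>\<close>. A vertex fixed by \<open>\<phi>\<close> has its root in the
    invariant block fixed as well.\<close>
  have fixpt: "\<exists>u\<in>X. \<phi> u = u" if min: "S.minaut \<phi>" "S.minaut \<psi>" "S.moved \<phi> \<noteq> S.moved \<psi>" for \<phi> \<psi>
  proof -
    have "S.moved \<phi> \<noteq> verts G"
      using S.minautD(3)[OF min(1) S.minautD(1,2)[OF min(2)]] S.moved_subset[OF S.minautD(1)[OF min(2)]] min(3) by blast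
    then obtain x where x: "x \<in> verts G" "\<phi> x = x"
      using S.moved_subset[OF S.minautD(1)[OF min(1)]] unfolding S.moved_def by blast
    have "\<phi> (S.root X x) = S.root X x"
      using S.aut_root[OF S.minautD(1)[OF min(1)] X(1) x(1)] inv[OF S.minautD(1)[OF min(1)]] x(2) by simp
    then show ?thesis using S.root_props(1)[OF X(1) x(1)] by blast
  qed
  obtain u where u: "u \<in> X" "\<phi> u = u" using fixpt[OF phi psi ne] by blast
  obtain v where v: "v \<in> X" "\<psi> v = v" using fixpt[OF psi phi ne[symmetric]] by blast
  have "u \<noteq> v" using u v nofix S.block_subset[OF X(1)] by blast
  moreover have "{restrict \<phi> (verts G)} \<noteq> {restrict \<psi> (verts G)}" using restrict_aut_eq_iff[OF ap(1) aq(1)] ne by auto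
  ultimately have iii: "\<exists>u \<in> verts B. \<exists>v \<in> verts B. u \<noteq> v \<and>
        (\<exists>\<rho> \<in> reflections G B. \<exists>\<sigma> \<in> reflections G B.
          \<rho> \<noteq> \<sigma> \<and> coset_action \<rho> u = u \<and> coset_action \<sigma> v = v)"
    using R.reflection_fixing_vertex[OF ap u] R.reflection_fixing_vertex[OF aq v]
      R.coset_action_restrict[OF u(1), of \<phi>] R.coset_action_restrict[OF v(1), of \<psi>] u v X(2)
    by (metis induce_subgraph_verts)
  have eV: "e \<in> verts G" using e S.moved_subset[OF ap(1)] by blast
  let ?w = "S.root X e"
  have w: "?w \<in> X" "e \<in> S.branch X ?w" using S.root_props(1)[OF X(1) eV] eV unfolding S.branch_def by auto
  \<comment> \<open>A reflection fixing the root of \<open>e\<close> fixes \<open>e\<close> too. As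
    \<open>\<phi>\<close> and \<open>\<psi>\<close> together move every vertex, it would eliminate
    \<open>e\<close>.\<close>
  have ii: "coset_action \<rho> ?w \<noteq> ?w" if rho: "\<rho> \<in> reflections G B" for \<rho>
  proof
    assume fx: "coset_action \<rho> ?w = ?w"
    obtain \<tau> where t: "S.aut \<tau>" "\<tau> \<noteq> id" "\<rho> = {restrict \<tau> (verts G)}"
      using R.reflectionE[OF rho[unfolded X(2)]] .
    then have "\<tau> ?w = ?w" using fx R.coset_action_restrict[OF w(1)] by simp
    then have "\<tau> e = e" using R.fixes_branch[OF t(1) w(1) _ w(2)] by blast
    then have "S.moved \<tau> \<subseteq> verts G - {e}" using S.moved_subset[OF t(1)] unfolding S.moved_def by auto
    moreover have "verts G \<subseteq> S.moved \<phi> \<union> S.moved \<psi>" using nofix unfolding S.moved_def by auto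
    ultimately have "\<tau> = id" using fail[OF t(1)] by blast
    then show False using t(2) by contradiction
  qed
  have "stab G B = {\<one>\<^bsub>aut_group G\<^esub>}"
    using stab_trivial_iff[OF S.block_subset[OF X(1)]] rigid X(2) by blast
  then show ?thesis using central ii w(1) iii X(2) by (metis induce_subgraph_verts)
qed

end

theorem theorem21:
  fixes G :: "('a, 'b) pre_digraph"
  assumes "graph G" and "Digraph_Component.connected G" and "outerplanar G"
  shows "\<not> exchange_property G \<longleftrightarrow>
    (\<exists>B. central_block G B \<and>
      stab G B = {\<one>\<^bsub>aut_group G\<^esub>} \<and>
      (\<exists>v \<in> verts B. \<forall>\<rho> \<in> reflections G B. coset_action \<rho> v \<noteq> v) \<and>
      (\<exists>u \<in> verts B. \<exists>v \<in> verts B. u \<noteq> v \<and>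
        (\<exists>\<rho> \<in> reflections G B. \<exists>\<sigma> \<in> reflections G B.
          \<rho> \<noteq> \<sigma> \<and> coset_action \<rho> u = u \<and> coset_action \<sigma> v = v)))"
    (is "_ \<longleftrightarrow> ?central")
proof -
  interpret graph G by (rule assms(1))
  interpret outerplanar_bc_graph G by unfold_locales (rule assms)+
  show ?thesis
  proof
    assume "\<not> exchange_property G"
    then have "\<not> circuit_clutter circuits" using exchange_property_of_elimination by blast
    then obtain \<phi> \<psi> e where "S.minaut \<phi>" "S.minaut \<psi>" "S.moved \<phi> \<noteq> S.moved \<psi>" "e \<in> S.moved \<phi>" "e \<in> S.moved \<psi>"
      "\<And>\<theta>. S.aut \<theta> \<Longrightarrow> S.moved \<theta> \<subseteq> S.moved \<phi> \<union> S.moved \<psi> - {e} \<Longrightarrow> \<theta> = id"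
      using circuit_clutter_circuits by metis
    then show ?central by (rule central_block_of_failed_elimination)
  next
    assume ?central
    then obtain B u v w \<rho> \<sigma> where B: "central_block G B" "stab G B = {\<one>\<^bsub>aut_group G\<^esub>}"
      and w: "w \<in> verts B" "\<And>\<rho>. \<rho> \<in> reflections G B \<Longrightarrow> coset_action \<rho> w \<noteq> w"
      and uv: "u \<in> verts B" "v \<in> verts B" "u \<noteq> v"
      and rs: "\<rho> \<in> reflections G B" "\<sigma> \<in> reflections G B" "\<rho> \<noteq> \<sigma>"
      and fixed: "coset_action \<rho> u = u" "coset_action \<sigma> v = v"
      by blast
    obtain X where X: "S.block X" "B = G \<restriction> X" "\<And>\<phi>. S.aut \<phi> \<Longrightarrow> \<phi> ` X = X"
      using central_block_invariant[OF B(1)] by auto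
    \<comment> \<open>The trivial stabilizer supplies rigidity; invariance holds because
      automorphisms preserve the center of the tree.\<close>
    interpret R: rigid_central_block G X
      by unfold_locales (use X stab_trivial_iff[OF S.block_subset[OF X(1)]] B(2) in blast)+
    show "\<not> exchange_property G"
      using R.not_exchange_property[of w u v \<rho> \<sigma>] w uv rs fixed unfolding X(2) by simp
  qed
qed


end
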